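(* Let $n\geqslant 1$, $\alpha\in[0,1)$, $0<p,q\leqslant\infty$, $s\in\mathbb{R}$. Then the embedding $$M^{s,\alpha}_{p,q}(\mathbb{R}^n)\subset L^\infty(\mathbb{R}^n)$$ holds if and only if $$s\geqslant n\alpha/p+(1-\alpha)B(\infty,q),$$ with strict inequality when $q>1$.
   Context: Convention $1/\infty=0$. For $(p,q)\in(0,\infty]^2$, $B(p,q)=\max\{0,\ n(1-1/p-1/q),\ n(1/p-1/q)\}$. $X\subset Y$ for (quasi-)normed spaces denotes embedding: $X\subset Y$ as sets with $\|f\|_Y\leqslant C\|f\|_X$ for all $f\in X$. Fourier transform: $\mathscr{F}f(\xi)=\hat f(\xi)=\int_{\mathbb{R}^n}f(x)e^{-2\pi i x\cdot\xi}dx$. Write $\langle k\rangle=(1+|k|^2)^{1/2}$. $\alpha$-modulation space: for $\alpha\in[0,1)$, take suitable constants $c,C>0$ and Schwartz functions $\{\eta_k^\alpha\}_{k\in\mathbb{Z}^n}$ such that: $|\eta_k^\alpha(\xi)|\geqslant 1$ if $|\xi-\langle k\rangle^{\frac{\alpha}{1-\alpha}}k|<c\langle k\rangle^{\frac{\alpha}{1-\alpha}}$; $\operatorname{supp}\eta_k^\alpha\subset\{\xi:|\xi-\langle k\rangle^{\frac{\alpha}{1-\alpha}}k|<C\langle k\rangle^{\frac{\alpha}{1-\alpha}}\}$; $\sum_{k\in\mathbb{Z}^n}\eta_k^\alpha(\xi)=1$ for all $\xi\in\mathbb{R}^n$; and for every multi-index $\gamma$ there is $C_{\gamma}$ with $|\partial^\gamma\eta_k^\alpha(\xi)|\leqslant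 C_{\gamma}\langle k\rangle^{-\frac{\alpha|\gamma|}{1-\alpha}}$ for all $\xi\in\mathbb{R}^n$, $k\in\mathbb{Z}^n$. Put $\Box_k^\alpha=\mathscr{F}^{-1}\eta_k^\alpha\mathscr{F}$. For $0<p,q\leqslant\infty$, $s\in\mathbb{R}$, $M^{s,\alpha}_{p,q}(\mathbb{R}^n)$ is the set of $f\in\mathscr{S}'(\mathbb{R}^n)$ with $\|f\|_{M^{s,\alpha}_{p,q}}=\big(\sum_{k\in\mathbb{Z}^n}\langle k\rangle^{\frac{sq}{1-\alpha}}\|\Box_k^\alpha f\|_{L^p}^q\big)^{1/q}<\infty$ (supremum over $k$ of $\langle k\rangle^{\frac{s}{1-\alpha}}\|\Box_k^\alpha f\|_{L^p}$ if $q=\infty$). Different choices of $\{\eta_k^\alpha\}$ give the same space with equivalent (quasi-)norms. *)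

theory Defs
  imports "HOL-Analysis.Analysis" "HOL-Probability.Essential_Supremum"
begin

definition partial_deriv :: "'n::finite \<Rightarrow> (real^'n \<Rightarrow> complex) \<Rightarrow> real^'n \<Rightarrow> complex" where
  "partial_deriv i f x = vector_derivative (\<lambda>t. f (x + t *\<^sub>R axis i 1)) (at 0)"

text \<open>Multi-indices are lists of coordinates: the list \<open>is\<close> stands for the multi-index whose
  \<open>i\<close>-th entry is \<open>count_list is i\<close>, of order \<open>length is\<close>. For smooth functions the order of
  differentiation is immaterial, so quantifying over lists is quantifying over multi-indices.\<close>

fun partials :: "'n::finite list \<Rightarrow> (real^'n \<Rightarrow> complex) \<Rightarrow> real^'n \<Rightarrow> complex" where
  "partials [] f = f"
| "partials (i # is) f = partial_deriv i (partials is f)"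

definition smooth :: "(real^'n::finite \<Rightarrow> complex) \<Rightarrow> bool" where
  "smooth f \<longleftrightarrow> (\<forall>is x. partials is f differentiable (at x))"

definition schwartz :: "(real^'n::finite \<Rightarrow> complex) set" where
  "schwartz = {f. smooth f \<and>
     (\<forall>m is. bdd_above (range (\<lambda>x. (1 + norm x) ^ m * norm (partials is f x))))}"

definition schwartz_seminorm :: "nat \<Rightarrow> 'n::finite list \<Rightarrow> (real^'n \<Rightarrow> complex) \<Rightarrow> real" where
  "schwartz_seminorm m is f = (SUP x. (1 + norm x) ^ m * norm (partials is f x))"

definition schwartz_topology :: "(real^'n::finite \<Rightarrow> complex) topology" where
  "schwartz_topology = topology_generated_by
     {{\<phi> \<in> schwartz. schwartz_seminorm m is (\<lambda>x. \<phi> x - \<psi> x) < \<epsilon>} | m is \<psi> \<epsilon>. \<psi> \<in> schwartz \<and> \<epsilon> > 0}"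

definition fourier :: "(real^'n::finite \<Rightarrow> complex) \<Rightarrow> real^'n \<Rightarrow> complex" where
  "fourier f \<xi> = (LINT x|lborel. f x * cis (- 2 * pi * (x \<bullet> \<xi>)))"

definition inv_fourier :: "(real^'n::finite \<Rightarrow> complex) \<Rightarrow> real^'n \<Rightarrow> complex" where
  "inv_fourier f x = (LINT \<xi>|lborel. f \<xi> * cis (2 * pi * (x \<bullet> \<xi>)))"

text \<open>Functionals are kept \<open>extensional\<close>, i.e. have a fixed junk value off the Schwartz space,
  so that equality of distributions is equality of functions.\<close>

type_synonym 'n functional = "(real^'n \<Rightarrow> complex) \<Rightarrow> complex"

definition tempered :: "'n::finite functional set" where
  "tempered = {u. u \<in> extensional schwartz \<and>
     (\<forall>\<phi>\<in>schwartz. \<forall>\<psi>\<in>schwartz. u (\<lambda>x. \<phi> x + \<psi> x) = u \<phi> + u \<psi>) \<and>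
     (\<forall>\<phi>\<in>schwartz. \<forall>a. u (\<lambda>x. a * \<phi> x) = a * u \<phi>) \<and>
     continuous_map schwartz_topology euclidean u}"

definition fourier_distr :: "'n::finite functional \<Rightarrow> 'n functional" where
  "fourier_distr u = (\<lambda>\<phi>\<in>schwartz. u (fourier \<phi>))"

definition inv_fourier_distr :: "'n::finite functional \<Rightarrow> 'n functional" where
  "inv_fourier_distr u = (\<lambda>\<phi>\<in>schwartz. u (inv_fourier \<phi>))"

definition mult_distr :: "(real^'n::finite \<Rightarrow> complex) \<Rightarrow> 'n functional \<Rightarrow> 'n functional" where
  "mult_distr g u = (\<lambda>\<phi>\<in>schwartz. u (\<lambda>x. g x * \<phi> x))"

definition represents :: "(real^'n::finite \<Rightarrow> complex) \<Rightarrow> 'n functional \<Rightarrow> bool" where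
  "represents g u \<longleftrightarrow> g \<in> borel_measurable lborel \<and>
     (\<forall>\<phi>\<in>schwartz. integrable lborel (\<lambda>x. g x * \<phi> x) \<and> u \<phi> = (LINT x|lborel. g x * \<phi> x))"

text \<open>Only used for exponents \<open>r > 0\<close>.\<close>

definition ennreal_powr :: "ennreal \<Rightarrow> real \<Rightarrow> ennreal" where
  "ennreal_powr x r = (if x = top then top else ennreal (enn2real x powr r))"

text \<open>Exponents in \<open>(0, \<infinity>]\<close> are positive extended nonnegative reals. The real number \<open>1/p\<close> is
  \<open>enn2real (1 / p)\<close>, which is \<open>0\<close> for \<open>p = top\<close>.\<close>

definition Lp_norm :: "ennreal \<Rightarrow> (real^'n::finite \<Rightarrow> complex) \<Rightarrow> ennreal" where
  "Lp_norm p g =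
     (if p = top then esssup lborel (\<lambda>x. ennreal (norm (g x)))
      else ennreal_powr (\<integral>\<^sup>+x. ennreal (norm (g x) powr enn2real p) \<partial>lborel) (enn2real (1 / p)))"

text \<open>Two functions representing the same distribution agree almost everywhere, so the infimum
  is over at most one value; it is \<open>top\<close> if the distribution is not a function.\<close>

definition Lp_norm_distr :: "ennreal \<Rightarrow> 'n::finite functional \<Rightarrow> ennreal" where
  "Lp_norm_distr p u = (INF g \<in> {g. represents g u}. Lp_norm p g)"

definition Linfty :: "'n::finite functional set" where
  "Linfty = {u \<in> tempered. Lp_norm_distr top u < top}"

definition lattice_vec :: "int^'n \<Rightarrow> real^'n::finite" where
  "lattice_vec k = (\<chi> i. real_of_int (k $ i))"

definition japanese :: "int^'n::finite \<Rightarrow> real" where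
  "japanese k = sqrt (1 + (norm (lattice_vec k))\<^sup>2)"

definition alpha_partition :: "real \<Rightarrow> (int^'n::finite \<Rightarrow> real^'n \<Rightarrow> complex) \<Rightarrow> bool" where
  "alpha_partition \<alpha> \<eta> \<longleftrightarrow>
     (\<forall>k. \<eta> k \<in> schwartz) \<and>
     (\<exists>c>0. \<forall>k \<xi>. 
        norm (\<xi> - japanese k powr (\<alpha> / (1 - \<alpha>)) *\<^sub>R lattice_vec k)
          < c * japanese k powr (\<alpha> / (1 - \<alpha>)) \<longrightarrow> norm (\<eta> k \<xi>) \<ge> 1) \<and>
     (\<exists>C>0. \<forall>k. closure {\<xi>. \<eta> k \<xi> \<noteq> 0} \<subseteq>
        {\<xi>. norm (\<xi> - japanese k powr (\<alpha> / (1 - \<alpha>)) *\<^sub>R lattice_vec k)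
               < C * japanese k powr (\<alpha> / (1 - \<alpha>))}) \<and>
     (\<forall>\<xi>. ((\<lambda>k. \<eta> k \<xi>) has_sum 1) UNIV) \<and>
     (\<forall>is. \<exists>C. \<forall>\<xi> k. norm (partials is (\<eta> k) \<xi>)
        \<le> C * japanese k powr (- (\<alpha> * real (length is) / (1 - \<alpha>))))"

definition box :: "(int^'n \<Rightarrow> real^'n::finite \<Rightarrow> complex) \<Rightarrow> int^'n \<Rightarrow> 'n functional \<Rightarrow> 'n functional" where
  "box \<eta> k u = inv_fourier_distr (mult_distr (\<eta> k) (fourier_distr u))"

definition modulation_norm ::
  "(int^'n \<Rightarrow> real^'n::finite \<Rightarrow> complex) \<Rightarrow> real \<Rightarrow> real \<Rightarrow> ennreal \<Rightarrow> ennreal \<Rightarrow> 'n functional \<Rightarrow> ennreal"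
  where
  "modulation_norm \<eta> \<alpha> s p q u =
     (if q = top
      then (SUP k. ennreal (japanese k powr (s / (1 - \<alpha>))) * Lp_norm_distr p (box \<eta> k u))
      else ennreal_powr
        (\<Sum>\<^sub>\<infinity>k. ennreal (japanese k powr (s * enn2real q / (1 - \<alpha>)))
               * ennreal_powr (Lp_norm_distr p (box \<eta> k u)) (enn2real q))
        (enn2real (1 / q)))"

definition modulation_space ::
  "(int^'n \<Rightarrow> real^'n::finite \<Rightarrow> complex) \<Rightarrow> real \<Rightarrow> real \<Rightarrow> ennreal \<Rightarrow> ennreal \<Rightarrow> 'n functional set"
  where
  "modulation_space \<eta> \<alpha> s p q = {u \<in> tempered. modulation_norm \<eta> \<alpha> s p q u < top}"

definition embeds :: "'a set \<Rightarrow> ('a \<Rightarrow> ennreal) \<Rightarrow> 'a set \<Rightarrow> ('a \<Rightarrow> ennreal) \<Rightarrow> bool" where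
  "embeds X normX Y normY \<longleftrightarrow>
     X \<subseteq> Y \<and> (\<exists>C::real. C > 0 \<and> (\<forall>f\<in>X. normY f \<le> ennreal C * normX f))"

definition B_index :: "nat \<Rightarrow> ennreal \<Rightarrow> ennreal \<Rightarrow> real" where
  "B_index n p q = Max {0, real n * (1 - enn2real (1 / p) - enn2real (1 / q)),
                           real n * (enn2real (1 / p) - enn2real (1 / q))}"

end

theory Submission
  imports Defs "HOL-Probability.Characteristic_Functions" "HOL-Probability.Sinc_Integral"
begin

text \<open>Write \<open>n = CARD('n)\<close> and let \<open>r_k = \<langle>k\<rangle>^(\<alpha>/(1-\<alpha>))\<close> be the radius of the \<open>k\<close>-th frequency ball, whose
  centre is \<open>r_k k\<close>. Everything depends on the number \<open>\<sigma> = (s - n\<alpha>/p)/(1-\<alpha>)\<close>. Since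
  \<open>B(\<infinity>,q) = max 0 (n(1-1/q))\<close>, the condition on \<open>s\<close> says that \<open>\<sigma> \<ge> 0\<close> if \<open>q \<le> 1\<close> and
  \<open>\<sigma> > n(1-1/q)\<close> if \<open>q > 1\<close>. This is exactly the condition under which the functional
  \<open>t \<mapsto> \<Sum>k. \<langle>k\<rangle>^(-\<sigma>) t_k\<close> is bounded on \<open>l^q\<close>, and the embedding is equivalent to that bound.

  Sufficiency. The \<open>k\<close>-th piece \<open>g_k\<close> of \<open>u\<close> has its spectrum in a ball of radius comparable to \<open>r_k\<close>,
  so the Nikolskii inequality (\<open>nikolskii\<close>) bounds its sup norm by a constant times \<open>r_k^(n/p)\<close> times its \<open>L^p\<close> norm,
  that is, by a constant times \<open>\<langle>k\<rangle>^(-\<sigma>) t_k\<close>, where the \<open>l^q\<close> norm of \<open>t\<close> is the modulation norm. By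
  \<open>discrete_hoelder\<close> the sup norms are summable, so the pieces add up almost everywhere to a bounded
  function, which represents \<open>u\<close> because the partial sums of the decomposition converge to \<open>u\<close> as
  distributions (\<open>decomposition_converges\<close>, \<open>bounded_pieces_sum\<close>).

  Necessity. For a finite set \<open>F\<close> of lattice points take \<open>f = \<Sum>k\<in>F. \<langle>k\<rangle>^(-\<tau>) r_k^(-n) h_k\<close>, where \<open>h_k\<close> is
  the inverse Fourier transform of a fixed bump moved to the \<open>k\<close>-th ball and normalized by
  \<open>h_k(0) = r_k^n\<close>. All packets add up at the origin, so \<open>f(0) = \<Sum>k\<in>F. \<langle>k\<rangle>^(-\<tau>)\<close>. The \<open>j\<close>-th piece of \<open>f\<close>
  meets only the packets with \<open>k\<close> near \<open>j\<close>, and its \<open>L^p\<close> norm is at most a constant times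
  \<open>\<langle>j\<rangle>^(-\<tau>) r_j^(-n/p)\<close> (\<open>wave_packets\<close>). The embedding thus gives
  \<open>\<Sum>k\<in>F. \<langle>k\<rangle>^(-\<tau>) \<le> A (\<Sum>k\<in>F. \<langle>k\<rangle>^((\<sigma>-\<tau>)q))^(1/q)\<close> for all \<open>F\<close>. With \<open>\<tau> = 0\<close> and one distant point this
  forces \<open>\<sigma> \<ge> 0\<close>. With \<open>\<tau> = n\<close> and \<open>\<sigma> \<le> n(1-1/q)\<close> it bounds \<open>T = \<Sum>k\<in>F. \<langle>k\<rangle>^(-n)\<close> by \<open>A T^(1/q)\<close>, which
  is impossible for \<open>q > 1\<close> since \<open>T\<close> is unbounded.

  Two geometric facts make the covering usable: the balls around \<open>r_j j\<close> and \<open>r_k k\<close> overlap only if \<open>j - k\<close> is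
  bounded, because \<open>r\<close> grows with \<open>\<bar>k\<bar>\<close> (\<open>center_separation\<close>), and all constants are uniform in \<open>k\<close> because
  the pieces, rescaled to unit size, form a bounded family of Schwartz functions. The analysis needed
  is Fourier inversion on the Schwartz space, uniqueness of the function that represents a
  distribution, and sequential continuity of tempered distributions.\<close>

section \<open>Smooth functions\<close>

lemma partial_deriv_has_derivative:
  assumes "(f has_derivative f') (at x)"
  shows "partial_deriv i f x = f' (axis i 1)"
proof -
  have "((\<lambda>t. x + t *\<^sub>R axis i (1::real)) has_vector_derivative axis i 1) (at 0)"
    by (auto intro!: derivative_eq_intros)
  moreover have "(f has_derivative f') (at (x + 0 *\<^sub>R axis i 1))" using assms by simp
  ultimately have "((f \<circ> (\<lambda>t. x + t *\<^sub>R axis i 1)) has_vector_derivative f' (axis i 1)) (at 0)"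
    by (intro vector_derivative_diff_chain_within)
       (auto intro: has_derivative_at_withinI)
  then show ?thesis
    unfolding partial_deriv_def o_def by (rule vector_derivative_at)
qed

lemma partial_deriv_along_line:
  assumes "\<And>y. f differentiable (at y)"
  shows "((\<lambda>t. f (x + t *\<^sub>R axis i 1)) has_vector_derivative
           partial_deriv i f (x + t *\<^sub>R axis i 1)) (at t)"
proof -
  obtain f' where f': "(f has_derivative f') (at (x + t *\<^sub>R axis i 1))"
    using assms unfolding differentiable_def by blast
  have "((\<lambda>t. x + t *\<^sub>R axis i (1::real)) has_vector_derivative axis i 1) (at t)"
    by (auto intro!: derivative_eq_intros)
  then have "((f \<circ> (\<lambda>t. x + t *\<^sub>R axis i 1)) has_vector_derivative f' (axis i 1)) (at t)"
    using f' by (intro vector_derivative_diff_chain_within) (auto intro: has_derivative_at_withinI)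
  then show ?thesis
    using partial_deriv_has_derivative[OF f'] by (simp add: o_def)
qed

lemma partial_deriv_add:
  assumes "f differentiable (at x)" "g differentiable (at x)"
  shows "partial_deriv i (\<lambda>x. f x + g x) x = partial_deriv i f x + partial_deriv i g x"
proof -
  obtain f' g' where "(f has_derivative f') (at x)" "(g has_derivative g') (at x)"
    using assms unfolding differentiable_def by blast
  note d = this
  show ?thesis
    using partial_deriv_has_derivative[OF has_derivative_add[OF d]]
    by (simp add: partial_deriv_has_derivative[OF d(1)] partial_deriv_has_derivative[OF d(2)])
qed

lemma partial_deriv_mult:
  assumes "f differentiable (at x)" "g differentiable (at x)"
  shows "partial_deriv i (\<lambda>x. f x * g x) x = partial_deriv i f x * g x + f x * partial_deriv i g x"
proof -
  obtain f' g' where "(f has_derivative f') (at x)" "(g has_derivative g') (at x)"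
    using assms unfolding differentiable_def by blast
  note d = this
  show ?thesis
    using partial_deriv_has_derivative[OF has_derivative_mult[OF d]]
    by (simp add: partial_deriv_has_derivative[OF d(1)] partial_deriv_has_derivative[OF d(2)])
qed

lemma partial_deriv_const [simp]: "partial_deriv i (\<lambda>x. c) = (\<lambda>x. 0)"
  by (rule ext, rule partial_deriv_has_derivative[of _ "\<lambda>_. 0"]) simp

lemma partial_deriv_affine:
  assumes "f differentiable (at (a + r *\<^sub>R x))"
  shows "partial_deriv i (\<lambda>x. f (a + r *\<^sub>R x)) x = r * partial_deriv i f (a + r *\<^sub>R x)"
proof -
  obtain f' where f': "(f has_derivative f') (at (a + r *\<^sub>R x))"
    using assms unfolding differentiable_def by blast
  have "((\<lambda>x. a + r *\<^sub>R x) has_derivative (\<lambda>h. r *\<^sub>R h)) (at x)"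
    by (auto intro!: derivative_eq_intros)
  then have "((\<lambda>x. f (a + r *\<^sub>R x)) has_derivative (\<lambda>h. f' (r *\<^sub>R h))) (at x)"
    using f' by (rule has_derivative_compose)
  then have "partial_deriv i (\<lambda>x. f (a + r *\<^sub>R x)) x = f' (r *\<^sub>R axis i 1)"
    by (rule partial_deriv_has_derivative)
  also have "\<dots> = r *\<^sub>R f' (axis i 1)"
    using f' by (simp add: has_derivative_linear linear_scale)
  finally show ?thesis
    unfolding partial_deriv_has_derivative[OF f'] by (simp only: scaleR_conv_of_real[where ?'a = complex])
qed

lemma partials_append: "partials (is @ js) f = partials is (partials js f)"
  by (induction "is") auto

lemma partials_snoc [simp]: "partials (is @ [i]) f = partials is (partial_deriv i f)"
  by (simp add: partials_append)

lemma smooth_differentiable: "smooth f \<Longrightarrow> f differentiable (at x)"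
  unfolding smooth_def by (metis partials.simps(1))

lemma smooth_partials: "smooth f \<Longrightarrow> smooth (partials js f)"
  unfolding smooth_def by (metis partials_append)

lemma smooth_partial_deriv: "smooth f \<Longrightarrow> smooth (partial_deriv i f)"
  using smooth_partials[of f "[i]"] by simp

lemma smooth_partials_differentiable: "smooth f \<Longrightarrow> partials is f differentiable (at x)"
  unfolding smooth_def by blast

text \<open>A class of differentiable functions that is closed under partial derivatives consists of smooth
  functions. Exhibiting such a class avoids computing iterated derivatives.\<close>

lemma smooth_coinduct:
  assumes "X f" and "\<And>f x. X f \<Longrightarrow> f differentiable (at x)"
    and "\<And>f i. X f \<Longrightarrow> X (partial_deriv i f)"
  shows "smooth f"
proof -
  have "X (partials is f)" for "is"
    by (induction "is") (auto intro: assms)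
  then show ?thesis
    unfolding smooth_def using assms(2) by blast
qed

lemma smooth_continuous: "smooth f \<Longrightarrow> continuous_on A f"
  by (intro continuous_at_imp_continuous_on ballI differentiable_imp_continuous_within smooth_differentiable)

lemma smooth_add:
  fixes f g :: "real^'n::finite \<Rightarrow> complex"
  assumes "smooth f" "smooth g"
  shows "smooth (\<lambda>x. f x + g x)"
proof (rule smooth_coinduct[where X = "\<lambda>h. \<exists>f g. smooth f \<and> smooth g \<and> h = (\<lambda>x. f x + g x)"])
  show "\<exists>f' g'. smooth f' \<and> smooth g' \<and> (\<lambda>x. f x + g x) = (\<lambda>x. f' x + g' x)"
    using assms by (intro exI[of _ f] exI[of _ g] conjI refl)
next
  fix h :: "real^'n \<Rightarrow> complex" and i :: 'n
  assume "\<exists>f g. smooth f \<and> smooth g \<and> h = (\<lambda>x. f x + g x)"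
  then obtain f g where "smooth f" "smooth g" and h: "h = (\<lambda>x. f x + g x)" by blast
  note sm = this(1,2)
  have "partial_deriv i h = (\<lambda>x. partial_deriv i f x + partial_deriv i g x)"
    unfolding h by (rule ext, intro partial_deriv_add smooth_differentiable sm)
  then show "\<exists>f g. smooth f \<and> smooth g \<and> partial_deriv i h = (\<lambda>x. f x + g x)"
    using sm smooth_partial_deriv by (intro exI[of _ "partial_deriv i f"] exI[of _ "partial_deriv i g"] conjI)
next
  fix h :: "real^'n \<Rightarrow> complex" and x
  assume "\<exists>f g. smooth f \<and> smooth g \<and> h = (\<lambda>x. f x + g x)"
  then obtain f g where "smooth f" "smooth g" and h: "h = (\<lambda>x. f x + g x)" by blast
  then show "h differentiable (at x)"
    unfolding h by (intro differentiable_add smooth_differentiable)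
qed

text \<open>Products of smooth functions are not closed under differentiation, but by the Leibniz rule their
  finite sums are.\<close>

inductive sum_of_products :: "(real^'n::finite \<Rightarrow> complex) \<Rightarrow> bool" where
  "smooth f \<Longrightarrow> smooth g \<Longrightarrow> sum_of_products (\<lambda>x. f x * g x)"
| "sum_of_products f \<Longrightarrow> sum_of_products g \<Longrightarrow> sum_of_products (\<lambda>x. f x + g x)"

lemma sum_of_products_differentiable:
  "sum_of_products f \<Longrightarrow> f differentiable (at x)"
proof (induction rule: sum_of_products.induct)
  case (1 f g) then show ?case by (intro differentiable_mult smooth_differentiable)
next
  case (2 f g) then show ?case by (intro differentiable_add)
qed

lemma smooth_mult:
  fixes f g :: "real^'n::finite \<Rightarrow> complex"
  assumes "smooth f" "smooth g"
  shows "smooth (\<lambda>x. f x * g x)"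
proof (rule smooth_coinduct[where X = sum_of_products])
  show "sum_of_products (\<lambda>x. f x * g x)" using assms by (rule sum_of_products.intros)
  show "h differentiable (at x)" if "sum_of_products h" for h :: "real^'n \<Rightarrow> complex" and x
    using that by (rule sum_of_products_differentiable)
  show "sum_of_products (partial_deriv i h)" if "sum_of_products h" for h :: "real^'n \<Rightarrow> complex" and i :: 'n
    using that
  proof (induction rule: sum_of_products.induct)
    case (1 f g)
    have "partial_deriv i (\<lambda>x. f x * g x) = (\<lambda>x. partial_deriv i f x * g x + f x * partial_deriv i g x)"
      by (rule ext, intro partial_deriv_mult smooth_differentiable 1)
    then show ?case using 1 by (auto intro!: sum_of_products.intros smooth_partial_deriv)
  next
    case (2 f g)
    have "partial_deriv i (\<lambda>x. f x + g x) = (\<lambda>x. partial_deriv i f x + partial_deriv i g x)"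
      by (rule ext, intro partial_deriv_add sum_of_products_differentiable 2)
    then show ?case using 2 by (auto intro!: sum_of_products.intros)
  qed
qed

lemma smooth_const [simp]: "smooth (\<lambda>x. c)"
proof (rule smooth_coinduct[where X = "\<lambda>h. h = (\<lambda>x. c) \<or> h = (\<lambda>x. 0)"])
  fix h :: "real^'a \<Rightarrow> complex" and x
  assume "h = (\<lambda>x. c) \<or> h = (\<lambda>x. 0)"
  then show "h differentiable (at x)" by (elim disjE) simp_all
next
  fix h :: "real^'a \<Rightarrow> complex" and i :: 'a
  assume "h = (\<lambda>x. c) \<or> h = (\<lambda>x. 0)"
  then show "partial_deriv i h = (\<lambda>x. c) \<or> partial_deriv i h = (\<lambda>x. 0)" by (elim disjE) simp_all
qed simp

lemma smooth_affine:
  fixes f :: "real^'n::finite \<Rightarrow> complex"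
  assumes "smooth f"
  shows "smooth (\<lambda>x. f (a + r *\<^sub>R x))"
proof (rule smooth_coinduct[where X = "\<lambda>h. \<exists>c f. smooth f \<and> h = (\<lambda>x. c * f (a + r *\<^sub>R x))"])
  show "\<exists>c f'. smooth f' \<and> (\<lambda>x. f (a + r *\<^sub>R x)) = (\<lambda>x. c * f' (a + r *\<^sub>R x))"
    using assms by (intro exI[of _ 1] exI[of _ f]) auto
next
  fix h :: "real^'n \<Rightarrow> complex" and x
  assume "\<exists>c f. smooth f \<and> h = (\<lambda>x. c * f (a + r *\<^sub>R x))"
  then obtain c f where "smooth f" "h = (\<lambda>x. c * f (a + r *\<^sub>R x))" by blast
  moreover have "(\<lambda>x. f (a + r *\<^sub>R x)) differentiable (at x)"
    using differentiable_compose[of f "\<lambda>x. a + r *\<^sub>R x" x UNIV] smooth_differentiable[OF \<open>smooth f\<close>] by auto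
  ultimately show "h differentiable (at x)" by auto
next
  fix h :: "real^'n \<Rightarrow> complex" and i :: 'n
  assume "\<exists>c f. smooth f \<and> h = (\<lambda>x. c * f (a + r *\<^sub>R x))"
  then obtain c f where sf: "smooth f" and h: "h = (\<lambda>x. c * f (a + r *\<^sub>R x))" by blast
  have d: "(\<lambda>x. f (a + r *\<^sub>R x)) differentiable (at x)" for x
    using differentiable_compose[of f "\<lambda>x. a + r *\<^sub>R x" x UNIV] smooth_differentiable[OF sf] by auto
  have "partial_deriv i h = (\<lambda>x. (c * r) * partial_deriv i f (a + r *\<^sub>R x))"
    unfolding h by (rule ext) (simp add: partial_deriv_mult d partial_deriv_affine smooth_differentiable sf)
  then show "\<exists>c f. smooth f \<and> partial_deriv i h = (\<lambda>x. c * f (a + r *\<^sub>R x))"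
    using smooth_partial_deriv[OF sf] by (intro exI[of _ "c * r"] exI[of _ "partial_deriv i f"] conjI)
qed

lemma partials_add:
  assumes "smooth f" "smooth g"
  shows "partials is (\<lambda>x. f x + g x) = (\<lambda>x. partials is f x + partials is g x)"
  by (induction "is") (auto simp: partial_deriv_add smooth_partials_differentiable assms)

lemma partials_cmult:
  assumes "smooth f"
  shows "partials is (\<lambda>x. c * f x) = (\<lambda>x. c * partials is f x)"
  by (induction "is") (auto simp: partial_deriv_mult smooth_partials_differentiable assms)

lemma partials_const: "partials is (\<lambda>x. c) = (\<lambda>x. if is = [] then c else 0)"
  by (induction "is" arbitrary: c rule: rev_induct) auto

lemma partials_affine:
  assumes "smooth f"
  shows "partials is (\<lambda>x. f (a + r *\<^sub>R x)) = (\<lambda>x. r ^ length is * partials is f (a + r *\<^sub>R x))"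
proof (induction "is")
  case (Cons i "is")
  have d: "(\<lambda>x. partials is f (a + r *\<^sub>R x)) differentiable (at x)" for x
    by (rule smooth_differentiable[OF smooth_affine[OF smooth_partials[OF assms]]])
  have "partial_deriv i (\<lambda>x. r ^ length is * partials is f (a + r *\<^sub>R x)) x
      = r ^ length is * (r * partial_deriv i (partials is f) (a + r *\<^sub>R x))" for x
    unfolding partial_deriv_affine[OF smooth_partials_differentiable[OF assms], symmetric]
    by (subst partial_deriv_mult) (use d in auto)
  then show ?case
    unfolding partials.simps Cons.IH by (simp add: mult_ac)
qed simp

lemma smooth_sum: "(\<And>j. j \<in> J \<Longrightarrow> smooth (f j)) \<Longrightarrow> smooth (\<lambda>x. \<Sum>j\<in>J. f j x)"
  by (induction J rule: infinite_finite_induct) (auto intro: smooth_add)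

lemma partials_sum:
  "(\<And>j. j \<in> J \<Longrightarrow> smooth (f j)) \<Longrightarrow>
    partials is (\<lambda>x. \<Sum>j\<in>J. f j x) = (\<lambda>x. \<Sum>j\<in>J. partials is (f j) x)"
  by (induction J rule: infinite_finite_induct) (auto simp: partials_const partials_add smooth_sum)

lemma partials_cong_open:
  assumes "open U" "x \<in> U" "\<And>y. y \<in> U \<Longrightarrow> f y = g y"
  shows "partials is f x = partials is g x"
  using assms(2)
proof (induction "is" arbitrary: x)
  case (Cons i "is")
  have "partial_deriv i (partials is f) x = partial_deriv i (partials is g) x"
    unfolding partial_deriv_def
  proof (rule vector_derivative_cong_eq)
    have "isCont (\<lambda>t. x + t *\<^sub>R axis i (1::real)) 0" by (intro continuous_intros)
    then have "((\<lambda>t. x + t *\<^sub>R axis i (1::real)) \<longlongrightarrow> x) (nhds 0)"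
      using tendsto_at_iff_tendsto_nhds[of "\<lambda>t. x + t *\<^sub>R axis i (1::real)" 0] unfolding isCont_def by simp
    then have "\<forall>\<^sub>F t in nhds 0. x + t *\<^sub>R axis i (1::real) \<in> U"
      using assms(1) Cons.prems by (rule topological_tendstoD)
    then show "\<forall>\<^sub>F t in nhds 0. t \<in> UNIV \<longrightarrow> partials is f (x + t *\<^sub>R axis i 1) = partials is g (x + t *\<^sub>R axis i 1)"
      by eventually_elim (use Cons.IH in blast)
  qed auto
  then show ?case by simp
qed (use assms in auto)

lemma partials_plane_wave:
  fixes a :: "real^'n::finite"
  shows "\<exists>c. partials is (\<lambda>\<xi>. cis (b * (a \<bullet> \<xi>))) = (\<lambda>\<xi>. c * cis (b * (a \<bullet> \<xi>)))"
  "smooth (\<lambda>\<xi>. cis (b * (a \<bullet> \<xi>)))"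
proof -
  have D: "((\<lambda>\<xi>. c * cis (b * (a \<bullet> \<xi>))) has_derivative
      (\<lambda>h. c * ((b * (a \<bullet> h)) *\<^sub>R (\<i> * cis (b * (a \<bullet> \<xi>)))))) (at \<xi>)" for c and \<xi> :: "real^'n"
    by (auto intro!: derivative_eq_intros simp: fun_eq_iff)
  have P: "partial_deriv i (\<lambda>\<xi>. c * cis (b * (a \<bullet> \<xi>))) = (\<lambda>\<xi>. (c * b * a $ i * \<i>) * cis (b * (a \<bullet> \<xi>)))" for c i
    by (rule ext, subst partial_deriv_has_derivative[OF D])
       (simp add: inner_axis scaleR_conv_of_real algebra_simps)
  show "\<exists>c. partials is (\<lambda>\<xi>. cis (b * (a \<bullet> \<xi>))) = (\<lambda>\<xi>. c * cis (b * (a \<bullet> \<xi>)))"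
  proof (induction "is")
    case Nil show ?case by (intro exI[of _ 1]) auto
  next
    case (Cons i "is") then show ?case using P by auto
  qed
  show "smooth (\<lambda>\<xi>. cis (b * (a \<bullet> \<xi>)))"
  proof (rule smooth_coinduct[where X = "\<lambda>h. \<exists>c. h = (\<lambda>\<xi>. c * cis (b * (a \<bullet> \<xi>)))"])
    show "\<exists>c. (\<lambda>\<xi>. cis (b * (a \<bullet> \<xi>))) = (\<lambda>\<xi>. c * cis (b * (a \<bullet> \<xi>)))"
      by (intro exI[of _ 1]) auto
  next
    fix h :: "real^'n \<Rightarrow> complex" and \<xi>
    assume "\<exists>c. h = (\<lambda>\<xi>. c * cis (b * (a \<bullet> \<xi>)))"
    then show "h differentiable (at \<xi>)" using D differentiableI by blast
  next
    fix h :: "real^'n \<Rightarrow> complex" and i :: 'n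
    assume "\<exists>c. h = (\<lambda>\<xi>. c * cis (b * (a \<bullet> \<xi>)))"
    then show "\<exists>c. partial_deriv i h = (\<lambda>\<xi>. c * cis (b * (a \<bullet> \<xi>)))" using P by blast
  qed
qed

lemma coordinate_has_derivative:
  "((\<lambda>x. complex_of_real (x $ i)) has_derivative (\<lambda>h. complex_of_real (h $ i))) (at x)"
proof -
  have "bounded_linear (\<lambda>x. complex_of_real (x $ i))"
    by (intro bounded_linear_compose[OF bounded_linear_of_real] bounded_linear_vec_nth)
  then show ?thesis by (rule bounded_linear_imp_has_derivative)
qed

lemma partial_deriv_coordinate:
  "partial_deriv j (\<lambda>x. complex_of_real (x $ i)) = (\<lambda>x. if i = j then 1 else 0)"
  by (rule ext, subst partial_deriv_has_derivative[OF coordinate_has_derivative])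
     (simp add: axis_def)

lemma smooth_coordinate: "smooth (\<lambda>x. complex_of_real (x $ i))"
proof (rule smooth_coinduct[where X = "\<lambda>h. h = (\<lambda>x. complex_of_real (x $ i)) \<or> (\<exists>c. h = (\<lambda>x. c))"])
  fix h :: "real^'a \<Rightarrow> complex" and x
  assume "h = (\<lambda>x. complex_of_real (x $ i)) \<or> (\<exists>c. h = (\<lambda>x. c))"
  then show "h differentiable (at x)"
    using coordinate_has_derivative differentiableI by (elim disjE exE) (blast, simp)
next
  fix h :: "real^'a \<Rightarrow> complex" and j
  assume "h = (\<lambda>x. complex_of_real (x $ i)) \<or> (\<exists>c. h = (\<lambda>x. c))"
  then have "\<exists>c. partial_deriv j h = (\<lambda>x. c)"
    by (elim disjE exE) (simp_all only: partial_deriv_coordinate partial_deriv_const, blast+)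
  then show "partial_deriv j h = (\<lambda>x. complex_of_real (x $ i)) \<or> (\<exists>c. partial_deriv j h = (\<lambda>x. c))" ..
qed simp

section \<open>Bounded families of Schwartz functions\<close>

text \<open>A bounded subset of the Schwartz space, given as an indexed family: the constants may depend on
  the seminorm but not on the index. Estimates that are uniform in the lattice point, or in a cut-off
  parameter, are instances of the closure properties of such families.\<close>

definition schwartz_bounded :: "'i set \<Rightarrow> ('i \<Rightarrow> real^'n::finite \<Rightarrow> complex) \<Rightarrow> bool" where
  "schwartz_bounded I F \<longleftrightarrow> (\<forall>i\<in>I. smooth (F i)) \<and>
     (\<forall>m is. \<exists>C. \<forall>i\<in>I. \<forall>x. (1 + norm x) ^ m * norm (partials is (F i) x) \<le> C)"

text \<open>Families of smooth functions of polynomial growth, uniformly in the index. They multiply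
  \<open>schwartz_bounded\<close> families into such families.\<close>

definition moderate :: "'i set \<Rightarrow> ('i \<Rightarrow> real^'n::finite \<Rightarrow> complex) \<Rightarrow> bool" where
  "moderate I F \<longleftrightarrow> (\<forall>i\<in>I. smooth (F i)) \<and>
     (\<forall>is. \<exists>C m. \<forall>i\<in>I. \<forall>x. norm (partials is (F i) x) \<le> C * (1 + norm x) ^ m)"

lemma schwartz_iff_bounded: "f \<in> schwartz \<longleftrightarrow> schwartz_bounded {()} (\<lambda>_. f)"
  unfolding schwartz_def schwartz_bounded_def bdd_above_def by auto

lemma schwartz_boundedD: "schwartz_bounded I F \<Longrightarrow> i \<in> I \<Longrightarrow> F i \<in> schwartz"
  unfolding schwartz_def schwartz_bounded_def bdd_above_def by (auto; metis)

lemma schwartz_smooth: "f \<in> schwartz \<Longrightarrow> smooth f"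
  unfolding schwartz_def by auto

lemma schwartz_bounded_smooth: "schwartz_bounded I F \<Longrightarrow> i \<in> I \<Longrightarrow> smooth (F i)"
  unfolding schwartz_bounded_def by auto

lemma moderate_smooth: "moderate I F \<Longrightarrow> i \<in> I \<Longrightarrow> smooth (F i)"
  unfolding moderate_def by auto

lemma schwartz_bounded_estimate:
  assumes "schwartz_bounded I F"
  shows "\<exists>C>0. \<forall>i\<in>I. \<forall>x. (1 + norm x) ^ m * norm (partials is (F i) x) \<le> C"
proof -
  obtain C where C: "\<forall>i\<in>I. \<forall>x. (1 + norm x) ^ m * norm (partials is (F i) x) \<le> C"
    using assms unfolding schwartz_bounded_def by blast
  show ?thesis
  proof (intro exI[of _ "max C 1"] conjI ballI allI)
    show "(1 + norm x) ^ m * norm (partials is (F i) x) \<le> max C 1" if "i \<in> I" for i x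
      using C that by (meson max.coboundedI1)
  qed simp
qed

lemma moderate_estimate:
  assumes "moderate I F"
  shows "\<exists>C>0. \<exists>m. \<forall>i\<in>I. \<forall>x. norm (partials is (F i) x) \<le> C * (1 + norm x) ^ m"
proof -
  obtain C m where C: "\<forall>i\<in>I. \<forall>x. norm (partials is (F i) x) \<le> C * (1 + norm x) ^ m"
    using assms unfolding moderate_def by blast
  have "C * (1 + norm x) ^ m \<le> max C 1 * (1 + norm x) ^ m" for x :: "real^'b"
    by (intro mult_right_mono) auto
  then show ?thesis
  proof (intro exI[of _ "max C 1"] exI[of _ m] conjI ballI allI)
    fix i x assume "i \<in> I" "\<And>x::real^'b. C * (1 + norm x) ^ m \<le> max C 1 * (1 + norm x) ^ m"
    then show "norm (partials is (F i) x) \<le> max C 1 * (1 + norm x) ^ m"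
      using C by (meson order_trans)
  qed auto
qed

lemma schwartz_bounded_single: "f \<in> schwartz \<Longrightarrow> schwartz_bounded I (\<lambda>_. f)"
  unfolding schwartz_iff_bounded schwartz_bounded_def by simp

lemma schwartz_bounded_deriv:
  assumes "schwartz_bounded I F"
  shows "schwartz_bounded I (\<lambda>i. partial_deriv j (F i))"
  unfolding schwartz_bounded_def
proof (intro conjI allI ballI)
  fix m "is"
  obtain C where "\<forall>i\<in>I. \<forall>x. (1 + norm x) ^ m * norm (partials (is @ [j]) (F i) x) \<le> C"
    using schwartz_bounded_estimate[OF assms, of m "is @ [j]"] by auto
  then show "\<exists>C. \<forall>i\<in>I. \<forall>x. (1 + norm x) ^ m * norm (partials is (partial_deriv j (F i)) x) \<le> C"
    unfolding partials_snoc by (intro exI[of _ C])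
qed (intro smooth_partial_deriv schwartz_bounded_smooth[OF assms])

lemma moderate_deriv:
  assumes "moderate I F"
  shows "moderate I (\<lambda>i. partial_deriv j (F i))"
  unfolding moderate_def
proof (intro conjI allI ballI)
  fix "is"
  obtain C m where "\<forall>i\<in>I. \<forall>x. norm (partials (is @ [j]) (F i) x) \<le> C * (1 + norm x) ^ m"
    using moderate_estimate[OF assms, of "is @ [j]"] by auto
  then show "\<exists>C m. \<forall>i\<in>I. \<forall>x. norm (partials is (partial_deriv j (F i)) x) \<le> C * (1 + norm x) ^ m"
    unfolding partials_snoc by (intro exI[of _ C] exI[of _ m])
qed (intro smooth_partial_deriv moderate_smooth[OF assms])

lemma schwartz_bounded_add:
  assumes "schwartz_bounded I F" "schwartz_bounded I G"
  shows "schwartz_bounded I (\<lambda>i x. F i x + G i x)"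
  unfolding schwartz_bounded_def
proof (intro conjI allI ballI)
  fix m "is"
  obtain C where C: "\<forall>i\<in>I. \<forall>x. (1 + norm x) ^ m * norm (partials is (F i) x) \<le> C"
    using schwartz_bounded_estimate[OF assms(1), of m "is"] by blast
  obtain D where D: "\<forall>i\<in>I. \<forall>x. (1 + norm x) ^ m * norm (partials is (G i) x) \<le> D"
    using schwartz_bounded_estimate[OF assms(2), of m "is"] by blast
  have "(1 + norm x) ^ m * norm (partials is (\<lambda>x. F i x + G i x) x) \<le> C + D" if "i \<in> I" for i x
  proof -
    have "(1 + norm x) ^ m * norm (partials is (\<lambda>x. F i x + G i x) x)
       \<le> (1 + norm x) ^ m * (norm (partials is (F i) x) + norm (partials is (G i) x))"
      unfolding partials_add[OF schwartz_bounded_smooth[OF assms(1) that] schwartz_bounded_smooth[OF assms(2) that]]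
      by (intro mult_left_mono norm_triangle_ineq) auto
    also have "\<dots> \<le> C + D"
      using C[rule_format, OF that, of x] D[rule_format, OF that, of x] by (simp add: distrib_left)
    finally show ?thesis .
  qed
  then show "\<exists>C. \<forall>i\<in>I. \<forall>x. (1 + norm x) ^ m * norm (partials is (\<lambda>x. F i x + G i x) x) \<le> C"
    by blast
qed (intro smooth_add schwartz_bounded_smooth[OF assms(1)] schwartz_bounded_smooth[OF assms(2)])

text \<open>By the Leibniz rule: differentiating the product once gives two products of the same kind, so
  the statement is proved for all \<open>F\<close> and \<open>G\<close> simultaneously by induction on the order. For the
  order zero, the polynomial growth of \<open>F\<close> is absorbed by a higher weight on \<open>G\<close>.\<close>

lemma schwartz_bounded_mult:
  assumes "moderate I F" "schwartz_bounded I G"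
  shows "schwartz_bounded I (\<lambda>i x. F i x * G i x)"
proof -
  have "\<exists>C. \<forall>i\<in>I. \<forall>x. (1 + norm x) ^ m * norm (partials is (\<lambda>x. F i x * G i x) x) \<le> C" for m "is"
    using assms
  proof (induction "is" arbitrary: F G rule: rev_induct)
    case Nil
    obtain C k where "C > 0" and C: "\<forall>i\<in>I. \<forall>x. norm (F i x) \<le> C * (1 + norm x) ^ k"
      using moderate_estimate[OF Nil(1), of "[]"] by auto
    obtain D where D: "\<forall>i\<in>I. \<forall>x. (1 + norm x) ^ (m + k) * norm (G i x) \<le> D"
      using schwartz_bounded_estimate[OF Nil(2), of "m + k" "[]"] by auto
    have "(1 + norm x) ^ m * norm (F i x * G i x) \<le> C * D" if "i \<in> I" for i x
    proof -
      have "(1 + norm x) ^ m * norm (F i x * G i x) = norm (F i x) * ((1 + norm x) ^ m * norm (G i x))"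
        by (simp add: norm_mult)
      also have "\<dots> \<le> (C * (1 + norm x) ^ k) * ((1 + norm x) ^ m * norm (G i x))"
        using C that by (intro mult_right_mono) auto
      also have "\<dots> = C * ((1 + norm x) ^ (m + k) * norm (G i x))" by (simp add: power_add mult_ac)
      also have "\<dots> \<le> C * D" using D that \<open>C > 0\<close> by (intro mult_left_mono) auto
      finally show ?thesis .
    qed
    then show ?case by auto
  next
    case (snoc j "is")
    have sF: "smooth (F i)" and sG: "smooth (G i)" if "i \<in> I" for i
      using moderate_smooth[OF snoc.prems(1) that] schwartz_bounded_smooth[OF snoc.prems(2) that] by auto
    obtain C where C: "\<forall>i\<in>I. \<forall>x. (1 + norm x) ^ m * norm (partials is (\<lambda>x. partial_deriv j (F i) x * G i x) x) \<le> C"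
      using snoc.IH[OF moderate_deriv[OF snoc.prems(1)] snoc.prems(2)] ..
    obtain D where D: "\<forall>i\<in>I. \<forall>x. (1 + norm x) ^ m * norm (partials is (\<lambda>x. F i x * partial_deriv j (G i) x) x) \<le> D"
      using snoc.IH[OF snoc.prems(1) schwartz_bounded_deriv[OF snoc.prems(2)]] ..
    have "(1 + norm x) ^ m * norm (partials (is @ [j]) (\<lambda>x. F i x * G i x) x) \<le> C + D" if "i \<in> I" for i x
    proof -
      have "partials (is @ [j]) (\<lambda>x. F i x * G i x) =
          partials is (\<lambda>x. partial_deriv j (F i) x * G i x + F i x * partial_deriv j (G i) x)"
        unfolding partials_snoc
        by (intro arg_cong[of _ _ "partials is"] ext partial_deriv_mult smooth_differentiable sF sG that)
      also have "\<dots> = (\<lambda>x. partials is (\<lambda>x. partial_deriv j (F i) x * G i x) x +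
            partials is (\<lambda>x. F i x * partial_deriv j (G i) x) x)"
        by (intro partials_add smooth_mult smooth_partial_deriv sF sG that)
      finally have "(1 + norm x) ^ m * norm (partials (is @ [j]) (\<lambda>x. F i x * G i x) x)
        \<le> (1 + norm x) ^ m * (norm (partials is (\<lambda>x. partial_deriv j (F i) x * G i x) x) +
            norm (partials is (\<lambda>x. F i x * partial_deriv j (G i) x) x))"
        by (auto intro!: mult_left_mono norm_triangle_ineq)
      also have "\<dots> \<le> C + D"
        using C[rule_format, OF that, of x] D[rule_format, OF that, of x] by (simp add: distrib_left)
      finally show ?thesis .
    qed
    then show ?case by blast
  qed
  then show ?thesis
    unfolding schwartz_bounded_def
    by (auto intro!: smooth_mult moderate_smooth[OF assms(1)] schwartz_bounded_smooth[OF assms(2)])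
qed

lemma schwartz_bounded_imp_moderate: "schwartz_bounded I F \<Longrightarrow> moderate I F"
  unfolding moderate_def
proof (intro conjI allI)
  fix "is" assume "schwartz_bounded I F"
  then obtain C where "\<forall>i\<in>I. \<forall>x. (1 + norm x) ^ 0 * norm (partials is (F i) x) \<le> C"
    using schwartz_bounded_estimate[of I F 0 "is"] by blast
  then show "\<exists>C m. \<forall>i\<in>I. \<forall>x. norm (partials is (F i) x) \<le> C * (1 + norm x) ^ m"
    by (intro exI[of _ C] exI[of _ 0]) auto
qed (auto simp: schwartz_bounded_smooth)

lemma moderate_const: 
  assumes "\<And>i. i \<in> I \<Longrightarrow> norm (c i) \<le> C" "C \<ge> 0"
  shows "moderate I (\<lambda>i x. c i)"
  unfolding moderate_def partials_const
  by (intro conjI allI ballI exI[of _ C] exI[of _ 0]) (use assms in auto)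

lemma moderate_plane_wave: "moderate I (\<lambda>_ \<xi>. cis (b * (a \<bullet> \<xi>)))"
  unfolding moderate_def
proof (intro conjI allI ballI)
  fix "is"
  obtain c where "partials is (\<lambda>\<xi>. cis (b * (a \<bullet> \<xi>))) = (\<lambda>\<xi>. c * cis (b * (a \<bullet> \<xi>)))"
    using partials_plane_wave by blast
  then show "\<exists>C m. \<forall>i\<in>I. \<forall>\<xi>. norm (partials is (\<lambda>\<xi>. cis (b * (a \<bullet> \<xi>))) \<xi>) \<le> C * (1 + norm \<xi>) ^ m"
    by (intro exI[of _ "norm c"] exI[of _ 0]) (auto simp: norm_mult)
qed (rule partials_plane_wave)

lemma moderate_coordinate: "moderate I (\<lambda>_ x. complex_of_real (x $ j))"
  unfolding moderate_def
proof (intro conjI allI ballI smooth_coordinate)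
  fix "is"
  show "\<exists>C m. \<forall>i\<in>I. \<forall>x. norm (partials is (\<lambda>x. complex_of_real (x $ j)) x) \<le> C * (1 + norm x) ^ m"
  proof (cases "is" rule: rev_cases)
    case Nil
    have "\<bar>x $ j\<bar> \<le> 1 + norm x" for x :: "real^'b" using component_le_norm_cart[of x j] by simp
    with Nil show ?thesis by (intro exI[of _ 1]) auto
  next
    case (snoc ys y)
    then show ?thesis
      by (intro exI[of _ 1] exI[of _ 0]) (auto simp: partial_deriv_coordinate partials_const)
  qed
qed

lemma schwartz_bounded_cmult:
  assumes "schwartz_bounded I F" "\<And>i. i \<in> I \<Longrightarrow> norm (c i) \<le> C" 
  shows "schwartz_bounded I (\<lambda>i x. c i * F i x)"
  by (rule schwartz_bounded_mult[OF moderate_const[of I c "max C 0"] assms(1)])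
     (use assms(2) in force)+

lemma schwartz_add: "f \<in> schwartz \<Longrightarrow> g \<in> schwartz \<Longrightarrow> (\<lambda>x. f x + g x) \<in> schwartz"
  unfolding schwartz_iff_bounded by (rule schwartz_bounded_add)

lemma schwartz_mult_moderate: "moderate {()} (\<lambda>_. f) \<Longrightarrow> g \<in> schwartz \<Longrightarrow> (\<lambda>x. f x * g x) \<in> schwartz"
  unfolding schwartz_iff_bounded by (rule schwartz_bounded_mult)

lemma schwartz_mult: "f \<in> schwartz \<Longrightarrow> g \<in> schwartz \<Longrightarrow> (\<lambda>x. f x * g x) \<in> schwartz"
  by (intro schwartz_mult_moderate schwartz_bounded_imp_moderate) (auto simp: schwartz_iff_bounded)

lemma schwartz_cmult: "f \<in> schwartz \<Longrightarrow> (\<lambda>x. c * f x) \<in> schwartz"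
  unfolding schwartz_iff_bounded by (rule schwartz_bounded_cmult) auto

lemma schwartz_diff: "f \<in> schwartz \<Longrightarrow> g \<in> schwartz \<Longrightarrow> (\<lambda>x. f x - g x) \<in> schwartz"
  using schwartz_add[of f "\<lambda>x. -1 * g x"] schwartz_cmult[of g "-1"] by simp

lemma schwartz_zero: "(\<lambda>x. 0) \<in> schwartz"
  unfolding schwartz_def by (auto simp: partials_const)

lemma schwartz_sum: "(\<And>j. j \<in> J \<Longrightarrow> f j \<in> schwartz) \<Longrightarrow> (\<lambda>x. \<Sum>j\<in>J. f j x) \<in> schwartz"
  by (induction J rule: infinite_finite_induct) (auto intro: schwartz_add schwartz_zero)

lemma schwartz_plane_wave: "f \<in> schwartz \<Longrightarrow> (\<lambda>\<xi>. cis (b * (a \<bullet> \<xi>)) * f \<xi>) \<in> schwartz"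
  by (intro schwartz_mult_moderate moderate_plane_wave)

lemma schwartz_coordinate: "f \<in> schwartz \<Longrightarrow> (\<lambda>x. complex_of_real (x $ i) * f x) \<in> schwartz"
  by (intro schwartz_mult_moderate moderate_coordinate)

text \<open>The weight at \<open>x\<close> is at most a constant times the weight at \<open>a + r x\<close>, and the chain rule only
  contributes a power of \<open>r\<close>.\<close>

lemma schwartz_bounded_affine:
  assumes "schwartz_bounded I F" "r \<noteq> 0"
  shows "schwartz_bounded I (\<lambda>i x. F i (a + r *\<^sub>R x))"
  unfolding schwartz_bounded_def
proof (intro conjI allI)
  have sf: "smooth (F i)" if "i \<in> I" for i using schwartz_bounded_smooth[OF assms(1) that] .
  then show "\<forall>i\<in>I. smooth (\<lambda>x. F i (a + r *\<^sub>R x))" by (auto intro: smooth_affine)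
  fix m "is"
  obtain C where C: "C > 0" "\<forall>i\<in>I. \<forall>x. (1 + norm x) ^ m * norm (partials is (F i) x) \<le> C"
    using schwartz_bounded_estimate[OF assms(1), of m "is"] by auto
  define L where "L = 1 + (norm a + 1) / \<bar>r\<bar>"
  have L: "L > 0" unfolding L_def by (intro add_pos_nonneg divide_nonneg_nonneg) auto
  have le: "1 + norm x \<le> L * (1 + norm (a + r *\<^sub>R x))" for x
  proof -
    have "\<bar>r\<bar> * norm x \<le> norm (a + r *\<^sub>R x) + norm a"
      using norm_triangle_ineq4[of "a + r *\<^sub>R x" a] by simp
    then have "norm x \<le> (norm (a + r *\<^sub>R x) + norm a) / \<bar>r\<bar>"
      using assms(2) by (simp add: field_simps)
    also have "\<dots> \<le> ((norm a + 1) * (1 + norm (a + r *\<^sub>R x))) / \<bar>r\<bar>"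
      by (intro divide_right_mono) (auto simp: algebra_simps)
    finally have *: "norm x \<le> ((norm a + 1) * (1 + norm (a + r *\<^sub>R x))) / \<bar>r\<bar>" .
    define Q where "Q = ((norm a + 1) * (1 + norm (a + r *\<^sub>R x))) / \<bar>r\<bar>"
    have "L * (1 + norm (a + r *\<^sub>R x)) = 1 + norm (a + r *\<^sub>R x) + Q"
      unfolding L_def Q_def by (simp add: distrib_right)
    then show ?thesis using * unfolding Q_def[symmetric]
      using norm_ge_zero[of "a + r *\<^sub>R x"] by linarith
  qed
  have "(1 + norm x) ^ m * norm (partials is (\<lambda>x. F i (a + r *\<^sub>R x)) x) \<le> L ^ m * \<bar>r\<bar> ^ length is * C"
    if "i \<in> I" for i x
  proof -
    have "(1 + norm x) ^ m * norm (partials is (\<lambda>x. F i (a + r *\<^sub>R x)) x)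
       \<le> (L * (1 + norm (a + r *\<^sub>R x))) ^ m * (\<bar>r\<bar> ^ length is * norm (partials is (F i) (a + r *\<^sub>R x)))"
      using le L by (auto simp: partials_affine[OF sf[OF that]] norm_mult norm_power intro!: mult_mono power_mono zero_le_power mult_nonneg_nonneg)
    also have "\<dots> = L ^ m * \<bar>r\<bar> ^ length is * ((1 + norm (a + r *\<^sub>R x)) ^ m * norm (partials is (F i) (a + r *\<^sub>R x)))"
      by (simp add: power_mult_distrib mult_ac)
    also have "\<dots> \<le> L ^ m * \<bar>r\<bar> ^ length is * C"
      using C L that by (intro mult_left_mono) auto
    finally show ?thesis .
  qed
  then show "\<exists>C. \<forall>i\<in>I. \<forall>x. (1 + norm x) ^ m * norm (partials is (\<lambda>x. F i (a + r *\<^sub>R x)) x) \<le> C"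
    by (intro exI[of _ "L ^ m * \<bar>r\<bar> ^ length is * C"]) auto
qed

lemma schwartz_affine:
  "f \<in> schwartz \<Longrightarrow> r \<noteq> 0 \<Longrightarrow> (\<lambda>x. f (a + r *\<^sub>R x)) \<in> schwartz"
  unfolding schwartz_iff_bounded by (rule schwartz_bounded_affine)

section \<open>Integration on Euclidean space\<close>

lemma nn_integral_affine:
  fixes t :: "'a::euclidean_space"
  assumes "f \<in> borel_measurable borel" "c \<noteq> 0"
  shows "(\<integral>\<^sup>+x. f x \<partial>lborel) = ennreal (\<bar>c\<bar> ^ DIM('a)) * (\<integral>\<^sup>+x. f (t + c *\<^sub>R x) \<partial>lborel)"
  using assms by (subst lborel_affine[OF assms(2), of t])
     (simp add: nn_integral_density nn_integral_distr nn_integral_cmult ennreal_power)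

lemma integrable_affine:
  fixes f :: "'a::euclidean_space \<Rightarrow> 'b::{banach, second_countable_topology}"
  assumes f: "integrable lborel f" and c: "c \<noteq> 0"
  shows "integrable lborel (\<lambda>x. f (t + c *\<^sub>R x))"
proof -
  note [measurable] = borel_measurable_integrable[OF f]
  have "(\<integral>\<^sup>+x. norm (f x) \<partial>lborel) < \<infinity>" using f by (simp add: integrable_iff_bounded)
  then have "(\<integral>\<^sup>+x. norm (f (t + c *\<^sub>R x)) \<partial>lborel) < \<infinity>"
    using c by (subst (asm) nn_integral_affine[where c = c and t = t]) (auto simp: ennreal_mult_less_top)
  then show ?thesis by (simp add: integrable_iff_bounded)
qed

lemma integral_affine:
  fixes f :: "'a::euclidean_space \<Rightarrow> 'b::{banach, second_countable_topology}"
  assumes f: "integrable lborel f" and c: "c \<noteq> 0"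
  shows "(\<integral>x. f x \<partial>lborel) = (\<bar>c\<bar> ^ DIM('a)) *\<^sub>R (\<integral>x. f (t + c *\<^sub>R x) \<partial>lborel)"
  using c f borel_measurable_integrable[OF f] integrable_affine[OF f c, of t]
  by (subst lborel_affine[OF c, of t]) (simp add: integral_density integral_distr)

text \<open>Fubini for a kernel dominated by a product of integrable functions, which is the only form in
  which the order of integration is interchanged below.\<close>

lemma Fubini_dominated:
  fixes h :: "'a::euclidean_space \<Rightarrow> 'b::euclidean_space \<Rightarrow> complex"
  assumes [measurable]: "(\<lambda>(x, y). h x y) \<in> borel_measurable (lborel \<Otimes>\<^sub>M lborel)"
    and F: "integrable lborel (F :: 'a \<Rightarrow> real)" and G: "integrable lborel (G :: 'b \<Rightarrow> real)"
    and le: "\<And>x y. norm (h x y) \<le> F x * G y"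
  shows "(\<integral>x. \<integral>y. h x y \<partial>lborel \<partial>lborel) = (\<integral>y. \<integral>x. h x y \<partial>lborel \<partial>lborel)"
    and "integrable lborel (\<lambda>x. \<integral>y. h x y \<partial>lborel)"
    and "integrable lborel (\<lambda>y. \<integral>x. h x y \<partial>lborel)"
proof -
  have int1: "integrable lborel (\<lambda>y. h x y)" for x
  proof (rule Bochner_Integration.integrable_bound)
    show "integrable lborel (\<lambda>y. F x * G y)" using G by (rule integrable_mult_right)
    show "(\<lambda>y. h x y) \<in> borel_measurable lborel" by measurable
    show "AE y in lborel. norm (h x y) \<le> norm (F x * G y)"
    proof (rule AE_I2)
      show "norm (h x y) \<le> norm (F x * G y)" for y
        using le[of x y] abs_ge_self[of "F x * G y"] unfolding real_norm_def by (rule order_trans)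
    qed
  qed
  have le1: "(\<integral>y. norm (h x y) \<partial>lborel) \<le> F x * (\<integral>y. G y \<partial>lborel)" for x
  proof -
    have "(\<integral>y. norm (h x y) \<partial>lborel) \<le> (\<integral>y. F x * G y \<partial>lborel)"
      by (rule integral_mono[OF integrable_norm[OF int1] integrable_mult_right[OF G] le])
    then show ?thesis by (simp only: integral_mult_right_zero)
  qed
  have int2: "integrable lborel (\<lambda>x. \<integral>y. norm (h x y) \<partial>lborel)"
  proof (rule Bochner_Integration.integrable_bound)
    show "integrable lborel (\<lambda>x. F x * (\<integral>y. G y \<partial>lborel))" using F by (rule integrable_mult_left)
    show "(\<lambda>x. \<integral>y. norm (h x y) \<partial>lborel) \<in> borel_measurable lborel" by measurable
    show "AE x in lborel. norm (\<integral>y. norm (h x y) \<partial>lborel) \<le> norm (F x * (\<integral>y. G y \<partial>lborel))"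
    proof (rule AE_I2)
      fix x
      have "0 \<le> (\<integral>y. norm (h x y) \<partial>lborel)" by (rule Bochner_Integration.integral_nonneg) simp
      then have "norm (\<integral>y. norm (h x y) \<partial>lborel) \<le> F x * (\<integral>y. G y \<partial>lborel)"
        using le1[of x] by (simp only: real_norm_def abs_of_nonneg)
      then show "norm (\<integral>y. norm (h x y) \<partial>lborel) \<le> norm (F x * (\<integral>y. G y \<partial>lborel))"
        unfolding real_norm_def using abs_ge_self by (rule order_trans)
    qed
  qed
  have int: "integrable (lborel \<Otimes>\<^sub>M lborel) (\<lambda>(x, y). h x y)"
  proof (rule lborel_pair.Fubini_integrable)
    show "integrable lborel (\<lambda>x. \<integral>y. norm (case (x, y) of (x, y) \<Rightarrow> h x y) \<partial>lborel)" using int2 by simp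
    show "AE x in lborel. integrable lborel (\<lambda>y. case (x, y) of (x, y) \<Rightarrow> h x y)" using int1 by simp
  qed measurable
  show "(\<integral>x. \<integral>y. h x y \<partial>lborel \<partial>lborel) = (\<integral>y. \<integral>x. h x y \<partial>lborel \<partial>lborel)"
    by (rule lborel_pair.Fubini_integral[OF int, symmetric])
  show "integrable lborel (\<lambda>x. \<integral>y. h x y \<partial>lborel)"
    using lborel_pair.integrable_fst'[OF int] by simp
  have "integrable (lborel \<Otimes>\<^sub>M lborel) (\<lambda>(x, y). case (y, x) of (x, y) \<Rightarrow> h x y)"
    using int by (rule lborel_pair.integrable_product_swap)
  from lborel_pair.integrable_fst'[OF this]
  show "integrable lborel (\<lambda>y. \<integral>x. h x y \<partial>lborel)" by simp
qed

text \<open>Compare with the product of the one-dimensional integrable functions \<open>1/(1 + x_b^2)\<close>: each factor is at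
  least \<open>(1 + \<bar>x\<bar>)^(-2)\<close>.\<close>

lemma integrable_inverse_weight:
  "integrable lborel (\<lambda>x::real^'n::finite. 1 / (1 + norm x) ^ (2 * CARD('n)))"
proof (rule integrableI_bounded)
  have "integrable lborel (\<lambda>x. inverse (1 + x^2 :: real))"
    using integrable_inverse_1_plus_square by (simp add: set_integrable_def)
  then have fin: "(\<integral>\<^sup>+x. ennreal (inverse (1 + x^2 :: real)) \<partial>lborel) < \<infinity>"
    by (subst (asm) integrable_iff_bounded) simp
  have "(\<integral>\<^sup>+x. ennreal (norm (1 / (1 + norm (x::real^'n)) ^ (2 * CARD('n)))) \<partial>lborel)
      \<le> (\<integral>\<^sup>+x. ennreal (\<Prod>b\<in>Basis. inverse (1 + ((x :: real^'n) \<bullet> b)^2)) \<partial>lborel)"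
  proof (intro nn_integral_mono ennreal_leI)
    fix x :: "real^'n"
    have "inverse ((1 + norm x)\<^sup>2) \<le> inverse (1 + (x \<bullet> b)^2)" if "b \<in> Basis" for b
    proof (rule le_imp_inverse_le)
      have "(x \<bullet> b)\<^sup>2 \<le> (norm x)\<^sup>2"
        using Basis_le_norm[OF that, of x] abs_le_square_iff[of "x \<bullet> b" "norm x"] by simp
      moreover have "(1 + norm x)\<^sup>2 = 1 + 2 * norm x + (norm x)\<^sup>2" by (simp add: power2_sum)
      ultimately show "1 + (x \<bullet> b)\<^sup>2 \<le> (1 + norm x)\<^sup>2" using norm_ge_zero[of x] by linarith
    qed (simp add: add_pos_nonneg)
    then have "(\<Prod>b\<in>(Basis::(real^'n) set). inverse ((1 + norm x)\<^sup>2)) \<le> (\<Prod>b\<in>Basis. inverse (1 + (x \<bullet> b)^2))"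
      by (intro prod_mono) auto
    then show "norm (1 / (1 + norm x) ^ (2 * CARD('n))) \<le> (\<Prod>b\<in>Basis. inverse (1 + (x \<bullet> b)^2))"
      by (simp add: power_mult power_inverse divide_inverse)
  qed
  also have "\<dots> = (\<integral>\<^sup>+x. (\<Prod>b\<in>Basis. ennreal (inverse (1 + ((x :: real^'n) \<bullet> b)^2))) \<partial>lborel)"
    by (subst prod_ennreal) auto
  also have "\<dots> = (\<Prod>b\<in>(Basis::(real^'n) set). (\<integral>\<^sup>+x. ennreal (inverse (1 + x^2 :: real)) \<partial>lborel))"
    by (subst nn_integral_lborel_prod) auto
  also have "\<dots> < \<infinity>" using fin by (simp add: power_less_top_ennreal)
  finally show "(\<integral>\<^sup>+x. ennreal (norm (1 / (1 + norm (x::real^'n)) ^ (2 * CARD('n)))) \<partial>lborel) < \<infinity>" .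
qed simp

lemma smooth_measurable [measurable_dest]: "smooth f \<Longrightarrow> f \<in> borel_measurable borel"
  by (intro borel_measurable_continuous_onI smooth_continuous)

lemma schwartz_measurable: "f \<in> schwartz \<Longrightarrow> f \<in> borel_measurable borel"
  by (intro smooth_measurable schwartz_smooth)

lemma schwartz_decay:
  assumes "schwartz_bounded I F"
  shows "\<exists>C>0. \<forall>i\<in>I. \<forall>x. norm (F i x) \<le> C * (1 / (1 + norm x) ^ m)"
proof -
  obtain C where C: "C > 0" "\<forall>i\<in>I. \<forall>x. (1 + norm x) ^ m * norm (F i x) \<le> C"
    using schwartz_bounded_estimate[OF assms, of m "[]"] by auto
  have "norm (F i x) \<le> C * (1 / (1 + norm x) ^ m)" if "i \<in> I" for i x
  proof -
    have "(1 + norm x) ^ m > 0" by (simp add: add_pos_nonneg)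
    then show ?thesis using C that by (simp add: field_simps)
  qed
  then show ?thesis using C by blast
qed

lemma schwartz_integrable_poly:
  fixes f :: "real^'n::finite \<Rightarrow> complex"
  assumes "f \<in> schwartz"
  shows "integrable lborel (\<lambda>x. norm x ^ k * norm (f x))"
proof -
  obtain C where C: "C > 0" "\<forall>x. norm (f x) \<le> C * (1 / (1 + norm x) ^ (2 * CARD('n) + k))"
    using schwartz_decay[OF assms[unfolded schwartz_iff_bounded], of "2 * CARD('n) + k"] by auto
  note [measurable] = schwartz_measurable[OF assms]
  show ?thesis
  proof (rule Bochner_Integration.integrable_bound)
    show "integrable lborel (\<lambda>x::real^'n. C * (1 / (1 + norm x) ^ (2 * CARD('n))))"
      by (intro integrable_mult_right integrable_inverse_weight)
    show "AE x in lborel. norm (norm x ^ k * norm (f x)) \<le> norm (C * (1 / (1 + norm x) ^ (2 * CARD('n))))"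
    proof (rule AE_I2)
      fix x :: "real^'n"
      have p: "1 + norm x > 0" by (simp add: add_pos_nonneg)
      have "norm x ^ k * norm (f x) \<le> (1 + norm x) ^ k * (C * (1 / (1 + norm x) ^ (2 * CARD('n) + k)))"
        using C by (intro mult_mono power_mono) auto
      also have "\<dots> = C * (1 / (1 + norm x) ^ (2 * CARD('n)))"
        using p by (simp add: power_add field_simps)
      finally show "norm (norm x ^ k * norm (f x)) \<le> norm (C * (1 / (1 + norm x) ^ (2 * CARD('n))))"
        using C by simp
    qed
  qed simp
qed

lemma schwartz_integrable: "f \<in> schwartz \<Longrightarrow> integrable lborel f"
  using schwartz_integrable_poly[of f 0] schwartz_measurable[of f]
  by (subst integrable_norm_iff[symmetric]) auto

lemma schwartz_bounded_integral:
  fixes F :: "'i \<Rightarrow> real^'n::finite \<Rightarrow> complex"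
  assumes "schwartz_bounded I F"
  shows "\<exists>C>0. \<forall>i\<in>I. (LINT x|lborel. norm (F i x)) \<le> C"
proof -
  obtain C where C: "C > 0" "\<forall>i\<in>I. \<forall>x. norm (F i x) \<le> C * (1 / (1 + norm x) ^ (2 * CARD('n)))"
    using schwartz_decay[OF assms, of "2 * CARD('n)"] by auto
  define D where "D = (LINT x::real^'n|lborel. C * (1 / (1 + norm x) ^ (2 * CARD('n))))"
  have "(LINT x|lborel. norm (F i x)) \<le> D" if "i \<in> I" for i
    unfolding D_def using C that schwartz_integrable[OF schwartz_boundedD[OF assms that]]
    by (intro integral_mono integrable_mult_right integrable_inverse_weight integrable_norm) auto
  then show ?thesis by (intro exI[of _ "max D 1"]) (auto simp: le_max_iff_disj)
qed

text \<open>Used for \<open>b = \<bar>x + t e\<bar>\<close> and \<open>c = \<bar>t e\<bar> \<le> 1\<close>: a shift of length at most one changes the weight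
  at most by a factor two.\<close>

lemma le_double: "a \<le> b + c \<Longrightarrow> c \<le> 1 \<Longrightarrow> 0 \<le> b \<Longrightarrow> 1 + a \<le> 2 * (1 + b)" for a b c :: real
  by simp

text \<open>Difference quotients have integral zero by translation invariance, and they converge to the
  partial derivative. This replaces integration by parts on lines.\<close>

lemma integral_partial_deriv_eq_0:
  fixes f :: "real^'n::finite \<Rightarrow> complex"
  assumes f: "f \<in> schwartz"
  shows "(LINT x|lborel. partial_deriv i f x) = 0"
proof -
  let ?e = "axis i 1 :: real^'n"
  define d where "d m x = (f (x + (1 / real (Suc m)) *\<^sub>R ?e) - f x) * of_nat (Suc m)" for m x
  define N where "N = 2 * CARD('n)"
  note sf = schwartz_smooth[OF f]
  have df: "partial_deriv i f \<in> schwartz"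
    using schwartz_bounded_deriv[OF f[unfolded schwartz_iff_bounded], of i] by (simp add: schwartz_iff_bounded)
  obtain C where C: "C > 0" "\<And>x. norm (partial_deriv i f x) \<le> C * (1 / (1 + norm x) ^ N)"
    using schwartz_decay[OF df[unfolded schwartz_iff_bounded], of N] by auto
  have line: "((\<lambda>t. f (x + t *\<^sub>R ?e)) has_vector_derivative partial_deriv i f (x + t *\<^sub>R ?e)) (at t)" for x t
    by (intro partial_deriv_along_line smooth_differentiable sf)
  \<comment> \<open>The mean value theorem and the rapid decay of the derivative dominate all difference quotients by one integrable function.\<close>
  have bound: "norm (d m x) \<le> C * 2 ^ N * (1 / (1 + norm x) ^ N)" for m x
  proof -
    define h where "h = 1 / real (Suc m)"
    have h: "0 < h" "h \<le> 1" unfolding h_def by auto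
    have "\<exists>t\<in>{0<..<h}. norm (f (x + h *\<^sub>R ?e) - f (x + 0 *\<^sub>R ?e))
        \<le> norm ((h - 0) *\<^sub>R partial_deriv i f (x + t *\<^sub>R ?e))"
    proof (rule mvt_general)
      show "continuous_on {0..h} (\<lambda>t. f (x + t *\<^sub>R ?e))"
        by (intro continuous_at_imp_continuous_on ballI has_vector_derivative_continuous[OF line])
    qed (use h line in \<open>auto simp: has_vector_derivative_def\<close>)
    then obtain t where t: "0 < t" "t < h" "norm (f (x + h *\<^sub>R ?e) - f x) \<le> h * norm (partial_deriv i f (x + t *\<^sub>R ?e))"
      using h by auto
    have "1 + norm x \<le> 2 * (1 + norm (x + t *\<^sub>R ?e))"
    proof -
      have "norm x \<le> norm (x + t *\<^sub>R ?e) + norm (t *\<^sub>R ?e)"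
        using norm_triangle_ineq4[of "x + t *\<^sub>R ?e" "t *\<^sub>R ?e"] by simp
      moreover have "norm (t *\<^sub>R ?e) \<le> 1" using t h by simp
      ultimately show ?thesis 
        using le_double[of "norm x" "norm (x + t *\<^sub>R ?e)" "norm (t *\<^sub>R ?e)"] by simp
    qed
    then have "(1 + norm x) ^ N \<le> 2 ^ N * (1 + norm (x + t *\<^sub>R ?e)) ^ N"
      unfolding power_mult_distrib[symmetric] by (intro power_mono) auto
    then have "1 / (1 + norm (x + t *\<^sub>R ?e)) ^ N \<le> 2 ^ N * (1 / (1 + norm x) ^ N)"
      by (simp add: field_simps add_pos_nonneg)
    then have "norm (partial_deriv i f (x + t *\<^sub>R ?e)) \<le> C * (2 ^ N * (1 / (1 + norm x) ^ N))"
      using C(1) by (intro order_trans[OF C(2) mult_left_mono]) auto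
    moreover have "norm (d m x) = norm (f (x + h *\<^sub>R ?e) - f x) / h"
      unfolding d_def h_def by (simp add: norm_mult del: of_nat_Suc)
    moreover have "norm (f (x + h *\<^sub>R ?e) - f x) / h \<le> norm (partial_deriv i f (x + t *\<^sub>R ?e))"
      using t h by (simp add: field_simps)
    ultimately show ?thesis by simp
  qed
  have lim: "(\<lambda>m. d m x) \<longlonglongrightarrow> partial_deriv i f x" for x
  proof -
    have "((\<lambda>t. norm (f (x + t *\<^sub>R ?e) - f x - t *\<^sub>R partial_deriv i f x) / norm t) \<longlongrightarrow> 0) (at 0)"
      using line[of x 0] unfolding has_vector_derivative_def has_derivative_at by simp
    moreover have "filterlim (\<lambda>m. 1 / real (Suc m)) (at 0) sequentially"
      by (rule filterlim_atI[OF LIMSEQ_Suc[OF lim_1_over_n]]) auto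
    ultimately have "(\<lambda>m. norm (f (x + (1 / real (Suc m)) *\<^sub>R ?e) - f x - (1 / real (Suc m)) *\<^sub>R partial_deriv i f x)
        / norm (1 / real (Suc m))) \<longlonglongrightarrow> 0"
      by (rule filterlim_compose)
    moreover have "norm (f (x + (1 / real (Suc m)) *\<^sub>R ?e) - f x - (1 / real (Suc m)) *\<^sub>R partial_deriv i f x)
        / norm (1 / real (Suc m)) = norm (d m x - partial_deriv i f x)" for m
    proof -
      define c :: complex where "c = of_nat (Suc m)"
      have c: "c \<noteq> 0" unfolding c_def by (simp del: of_nat_Suc)
      define a where "a = f (x + (1 / real (Suc m)) *\<^sub>R ?e) - f x"
      have "d m x - partial_deriv i f x = c * (a - (1 / c) * partial_deriv i f x)"
        unfolding d_def a_def[symmetric] c_def[symmetric] using c by (simp add: field_simps)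
      then show ?thesis unfolding a_def[symmetric]
        by (simp add: norm_mult c_def scaleR_conv_of_real del: of_nat_Suc)
    qed
    ultimately have "(\<lambda>m. norm (d m x - partial_deriv i f x)) \<longlonglongrightarrow> 0" by simp
    then show ?thesis by (simp add: tendsto_norm_zero_iff LIM_zero_iff)
  qed
  have int: "integrable lborel (\<lambda>x. f (x + h *\<^sub>R ?e))"
    and eq: "(LINT x|lborel. f (x + h *\<^sub>R ?e)) = (LINT x|lborel. f x)" for h
    using integrable_affine[OF schwartz_integrable[OF f], of 1 "h *\<^sub>R ?e"]
      integral_affine[OF schwartz_integrable[OF f], of 1 "h *\<^sub>R ?e"] by (simp_all add: add.commute)
  have "(\<lambda>m. LINT x|lborel. d m x) \<longlonglongrightarrow> (LINT x|lborel. partial_deriv i f x)"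
  proof (rule integral_dominated_convergence)
    show "integrable lborel (\<lambda>x::real^'n. C * 2 ^ N * (1 / (1 + norm x) ^ N))"
      unfolding N_def by (intro integrable_mult_right integrable_inverse_weight)
    show "AE x in lborel. norm (d m x) \<le> C * 2 ^ N * (1 / (1 + norm x) ^ N)" for m
      using bound by auto
    show "d m \<in> borel_measurable lborel" for m
      unfolding d_def using int schwartz_integrable[OF f] by (auto dest!: borel_measurable_integrable)
  qed (use lim schwartz_measurable[OF df] in auto)
  moreover have "(LINT x|lborel. d m x) = 0" for m
    unfolding d_def using int eq schwartz_integrable[OF f] by simp
  ultimately show ?thesis by (simp add: LIMSEQ_const_iff)
qed

section \<open>The Fourier transform on the Schwartz space\<close>

lemma integrable_cis:
  assumes "integrable lborel f" "g \<in> borel_measurable borel"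
  shows "integrable lborel (\<lambda>x. f x * cis (g x))"
proof (rule Bochner_Integration.integrable_bound[OF assms(1)])
  note [measurable] = borel_measurable_integrable[OF assms(1)] assms(2)
  have "(\<lambda>x. cis (g x)) \<in> borel_measurable borel"
    unfolding cis_conv_exp by measurable
  then show "(\<lambda>x. f x * cis (g x)) \<in> borel_measurable lborel" by measurable
qed (simp add: norm_mult)

lemma fourier_integrable:
  assumes "integrable lborel f"
  shows "integrable lborel (\<lambda>x. f x * cis (- 2 * pi * (x \<bullet> \<xi>)))"
  using assms by (rule integrable_cis) measurable

lemma inv_fourier_eq: "inv_fourier f x = fourier f (- x)"
  unfolding inv_fourier_def fourier_def by (simp add: inner_commute)

lemma norm_fourier_le: "norm (fourier f \<xi>) \<le> (LINT x|lborel. norm (f x))"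
  unfolding fourier_def
  by (rule order_trans[OF integral_norm_bound]) (simp add: norm_mult)

lemma fourier_cmult: "fourier (\<lambda>x. c * f x) \<xi> = c * fourier f \<xi>"
  unfolding fourier_def by (simp add: mult.assoc)

lemma fourier_add:
  assumes "integrable lborel f" "integrable lborel g"
  shows "fourier (\<lambda>x. f x + g x) \<xi> = fourier f \<xi> + fourier g \<xi>"
  unfolding fourier_def using fourier_integrable[OF assms(1)] fourier_integrable[OF assms(2)]
  by (simp add: distrib_right)

lemma fourier_sum:
  assumes "\<And>j. j \<in> J \<Longrightarrow> integrable lborel (f j)"
  shows "fourier (\<lambda>x. \<Sum>j\<in>J. f j x) \<xi> = (\<Sum>j\<in>J. fourier (f j) \<xi>)"
  unfolding fourier_def sum_distrib_right
  by (rule Bochner_Integration.integral_sum) (intro fourier_integrable assms)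

text \<open>The change of variables that turns a bump at the unit scale into one adapted to the ball with
  centre \<open>a\<close> and radius \<open>r\<close>.\<close>

lemma fourier_dilate:
  fixes f :: "real^'n::finite \<Rightarrow> complex"
  assumes "integrable lborel f" "r > 0"
  shows "fourier (\<lambda>\<xi>. f ((1 / r) *\<^sub>R (\<xi> - a))) x = r ^ CARD('n) * (cis (- 2 * pi * (a \<bullet> x)) * fourier f (r *\<^sub>R x))"
proof -
  have "integrable lborel (\<lambda>\<xi>. f ((- (1 / r)) *\<^sub>R a + (1 / r) *\<^sub>R \<xi>))"
    using assms by (intro integrable_affine) auto
  then have int: "integrable lborel (\<lambda>\<xi>. f ((1 / r) *\<^sub>R (\<xi> - a)))"
    by (simp add: scaleR_diff_right)
  have "fourier (\<lambda>\<xi>. f ((1 / r) *\<^sub>R (\<xi> - a))) x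
      = (\<bar>r\<bar> ^ DIM(real^'n)) *\<^sub>R (LINT y|lborel. f ((1 / r) *\<^sub>R (a + r *\<^sub>R y - a)) * cis (- 2 * pi * ((a + r *\<^sub>R y) \<bullet> x)))"
    unfolding fourier_def using assms(2) by (intro integral_affine fourier_integrable int) auto
  also have "(LINT y|lborel. f ((1 / r) *\<^sub>R (a + r *\<^sub>R y - a)) * cis (- 2 * pi * ((a + r *\<^sub>R y) \<bullet> x)))
      = (LINT y|lborel. cis (- 2 * pi * (a \<bullet> x)) * (f y * cis (- 2 * pi * (y \<bullet> (r *\<^sub>R x)))))"
    using assms(2) by (intro Bochner_Integration.integral_cong)
      (auto simp: inner_add_left distrib_left cis_mult mult_ac)
  finally show ?thesis
    unfolding fourier_def using assms(2) by (simp add: scaleR_conv_of_real)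
qed

text \<open>Both sides are the double integral of \<open>f x * g \<xi> * cis (- 2 * pi * (x \<bullet> \<xi>))\<close>.\<close>

lemma fourier_multiplication_formula:
  assumes "integrable lborel f" "integrable lborel g"
  shows "(LINT \<xi>|lborel. fourier f \<xi> * g \<xi>) = (LINT x|lborel. f x * fourier g x)"
proof -
  note [measurable] = borel_measurable_integrable[OF assms(1)] borel_measurable_integrable[OF assms(2)]
  let ?h = "\<lambda>x \<xi>. (f x * g \<xi>) * cis (- 2 * pi * (x \<bullet> \<xi>))"
  have m: "(\<lambda>(x, \<xi>). ?h x \<xi>) \<in> borel_measurable (lborel \<Otimes>\<^sub>M lborel)"
    unfolding cis_conv_exp by measurable
  have "(LINT \<xi>|lborel. fourier f \<xi> * g \<xi>) = (LINT \<xi>|lborel. LINT x|lborel. ?h x \<xi>)"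
    unfolding fourier_def integral_mult_left_zero[symmetric] by (simp add: mult_ac)
  also have "\<dots> = (LINT x|lborel. LINT \<xi>|lborel. ?h x \<xi>)"
    by (rule Fubini_dominated(1)[symmetric, OF m integrable_norm[OF assms(1)] integrable_norm[OF assms(2)]])
       (simp add: norm_mult)
  also have "\<dots> = (LINT x|lborel. f x * fourier g x)"
    unfolding fourier_def integral_mult_right_zero[symmetric] by (simp add: mult_ac inner_commute)
  finally show ?thesis .
qed

lemma schwartz_partial_deriv: "f \<in> schwartz \<Longrightarrow> partial_deriv i f \<in> schwartz"
  unfolding schwartz_iff_bounded by (rule schwartz_bounded_deriv)

text \<open>Apply \<open>integral_partial_deriv_eq_0\<close> to the product of \<open>f\<close> with a plane wave.\<close>

lemma fourier_partial_deriv: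
  assumes f: "f \<in> schwartz"
  shows "fourier (partial_deriv i f) \<xi> = (2 * pi * \<xi> $ i) * \<i> * fourier f \<xi>"
proof -
  let ?e = "\<lambda>x. cis ((- 2 * pi) * (\<xi> \<bullet> x))"
  have de: "partial_deriv i ?e x = - (2 * pi * \<xi> $ i) * \<i> * ?e x" for x
  proof -
    have "(?e has_derivative (\<lambda>h. ((- 2 * pi) * (\<xi> \<bullet> h)) *\<^sub>R (\<i> * ?e x))) (at x)"
      by (auto intro!: derivative_eq_intros simp: fun_eq_iff)
    from partial_deriv_has_derivative[OF this, of i] show ?thesis
      by (simp add: inner_axis scaleR_conv_of_real)
  qed
  have "partial_deriv i (\<lambda>x. ?e x * f x) x =
      ?e x * partial_deriv i f x - ((2 * pi * \<xi> $ i) * \<i>) * (?e x * f x)" for x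
    unfolding partial_deriv_mult[OF smooth_differentiable[OF partials_plane_wave(2)]
      smooth_differentiable[OF schwartz_smooth[OF f]]] de by (simp add: algebra_simps)
  moreover have "(LINT x|lborel. partial_deriv i (\<lambda>x. ?e x * f x) x) = 0"
    by (intro integral_partial_deriv_eq_0 schwartz_plane_wave f)
  ultimately have "(LINT x|lborel. ?e x * partial_deriv i f x - ((2 * pi * \<xi> $ i) * \<i>) * (?e x * f x)) = 0"
    by simp
  moreover have "integrable lborel (\<lambda>x. ?e x * partial_deriv i f x)" "integrable lborel (\<lambda>x. ?e x * f x)"
    by (intro schwartz_integrable schwartz_plane_wave schwartz_partial_deriv f)+
  ultimately have "(LINT x|lborel. ?e x * partial_deriv i f x) = ((2 * pi * \<xi> $ i) * \<i>) * (LINT x|lborel. ?e x * f x)"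
    by simp
  then show ?thesis
    unfolding fourier_def by (simp add: mult_ac inner_commute)
qed

text \<open>Differentiation under the integral sign, with an explicit remainder: the second order Taylor
  remainder of the plane wave is at most \<open>(2\<pi> \<bar>x\<bar> \<bar>h\<bar>)^2\<close>, and \<open>\<bar>x\<bar>^2 \<bar>f x\<bar>\<close> is integrable.\<close>

lemma fourier_has_derivative:
  fixes f :: "real^'n::finite \<Rightarrow> complex"
  assumes f: "f \<in> schwartz"
  shows "(fourier f has_derivative
    (\<lambda>h. \<Sum>j\<in>UNIV. h $ j *\<^sub>R fourier (\<lambda>x. (- 2 * pi * \<i>) * (complex_of_real (x $ j) * f x)) \<xi>)) (at \<xi>)"
    (is "(_ has_derivative ?D) _")
proof -
  define g where "g j x = (- 2 * pi * \<i>) * (complex_of_real (x $ j) * f x)" for j x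
  have g: "g j \<in> schwartz" for j
    unfolding g_def by (intro schwartz_cmult schwartz_coordinate f)
  have lin: "bounded_linear ?D"
    by (intro bounded_linear_sum bounded_linear_scaleR_const bounded_linear_vec_nth)
  define C where "C = (2 * pi)\<^sup>2 * (LINT x|lborel. norm x ^ 2 * norm (f x))"
  have C0: "C \<ge> 0" unfolding C_def by (intro mult_nonneg_nonneg Bochner_Integration.integral_nonneg) auto
  have rem: "norm (fourier f (\<xi> + h) - fourier f \<xi> - ?D h) \<le> C * (norm h)\<^sup>2" for h
  proof -
    define \<theta> where "\<theta> x = - 2 * pi * (x \<bullet> h)" for x
    define R where "R x = f x * cis (- 2 * pi * (x \<bullet> \<xi>)) * (cis (\<theta> x) - 1 - \<i> * \<theta> x)" for x
    have "?D h = (\<Sum>j\<in>UNIV. (LINT x|lborel. h $ j *\<^sub>R (g j x * cis (- 2 * pi * (x \<bullet> \<xi>)))))"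
      unfolding fourier_def g_def[symmetric] by simp
    also have "\<dots> = (LINT x|lborel. (\<Sum>j\<in>UNIV. h $ j *\<^sub>R (g j x * cis (- 2 * pi * (x \<bullet> \<xi>)))))"
      by (intro Bochner_Integration.integral_sum[symmetric] integrable_scaleR_right fourier_integrable schwartz_integrable g)
    also have "\<dots> = (LINT x|lborel. f x * cis (- 2 * pi * (x \<bullet> \<xi>)) * (\<i> * \<theta> x))"
    proof (rule Bochner_Integration.integral_cong[OF refl])
      fix x
      show "(\<Sum>j\<in>UNIV. h $ j *\<^sub>R (g j x * cis (- 2 * pi * (x \<bullet> \<xi>)))) = f x * cis (- 2 * pi * (x \<bullet> \<xi>)) * (\<i> * \<theta> x)"
        unfolding g_def \<theta>_def inner_vec_def[of x h]
        by (simp add: scaleR_conv_of_real sum_distrib_left sum_distrib_right mult_ac flip: sum_negf)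
    qed
    finally have D: "?D h = (LINT x|lborel. f x * cis (- 2 * pi * (x \<bullet> \<xi>)) * (\<i> * \<theta> x))" .
    have i0: "integrable lborel (\<lambda>x. f x * cis (- 2 * pi * (x \<bullet> \<xi>)))" for \<xi>
      by (intro fourier_integrable schwartz_integrable f)
    have "integrable lborel (\<lambda>x. \<Sum>j\<in>UNIV. h $ j *\<^sub>R (g j x * cis (- 2 * pi * (x \<bullet> \<xi>))))"
      by (intro Bochner_Integration.integrable_sum integrable_scaleR_right fourier_integrable schwartz_integrable g)
    also have "(\<lambda>x. \<Sum>j\<in>UNIV. h $ j *\<^sub>R (g j x * cis (- 2 * pi * (x \<bullet> \<xi>)))) = (\<lambda>x. f x * cis (- 2 * pi * (x \<bullet> \<xi>)) * (\<i> * \<theta> x))"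
      unfolding g_def \<theta>_def inner_vec_def[of _ h]
      by (simp add: scaleR_conv_of_real sum_distrib_left sum_distrib_right mult_ac flip: sum_negf)
    finally have i1: "integrable lborel (\<lambda>x. f x * cis (- 2 * pi * (x \<bullet> \<xi>)) * (\<i> * \<theta> x))" .
    have split: "f x * cis (- 2 * pi * (x \<bullet> (\<xi> + h))) = f x * cis (- 2 * pi * (x \<bullet> \<xi>)) * cis (\<theta> x)" for x
      unfolding \<theta>_def by (simp add: inner_add_right distrib_left cis_mult mult_ac)
    have "fourier f (\<xi> + h) - fourier f \<xi> - ?D h = (LINT x|lborel. R x)"
    proof -
      define a where "a x = f x * cis (- 2 * pi * (x \<bullet> \<xi>))" for x
      have i: "integrable lborel (\<lambda>x. a x * cis (\<theta> x))" "integrable lborel a" "integrable lborel (\<lambda>x. a x * (\<i> * \<theta> x))"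
        using i0[of "\<xi> + h"] i0[of \<xi>] i1 unfolding split a_def[abs_def] by blast+
      have "(LINT x|lborel. R x) = (LINT x|lborel. a x * cis (\<theta> x)) - (LINT x|lborel. a x) - (LINT x|lborel. a x * (\<i> * \<theta> x))"
        unfolding R_def a_def[symmetric] right_diff_distrib mult_1_right using i by simp
      also have "\<dots> = fourier f (\<xi> + h) - fourier f \<xi> - ?D h"
        unfolding D unfolding fourier_def split a_def ..
      finally show ?thesis ..
    qed
    moreover have "norm (LINT x|lborel. R x) \<le> (LINT x|lborel. (2 * pi)\<^sup>2 * (norm h)\<^sup>2 * (norm x ^ 2 * norm (f x)))"
    proof (rule order_trans[OF integral_norm_bound], rule integral_mono_AE)
      show "integrable lborel (\<lambda>x. (2 * pi)\<^sup>2 * (norm h)\<^sup>2 * (norm x ^ 2 * norm (f x)))"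
        by (intro integrable_mult_right schwartz_integrable_poly f)
      have "integrable lborel R"
        unfolding R_def right_diff_distrib using i0[of "\<xi> + h"] i0[of \<xi>] i1 unfolding split by simp
      then show "integrable lborel (\<lambda>x. norm (R x))" by (rule integrable_norm)
      show "AE x in lborel. norm (R x) \<le> (2 * pi)\<^sup>2 * (norm h)\<^sup>2 * (norm x ^ 2 * norm (f x))"
      proof (rule AE_I2)
        fix x
        have "norm (cis (\<theta> x) - 1 - \<i> * \<theta> x) \<le> \<bar>\<theta> x\<bar>\<^sup>2 / 2"
          using iexp_approx1[of "\<theta> x" 1] by (simp add: cis_conv_exp power2_eq_square algebra_simps)
        also have "\<dots> \<le> \<bar>\<theta> x\<bar>\<^sup>2" by simp
        also have "\<dots> \<le> (2 * pi * (norm x * norm h))\<^sup>2"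
          unfolding \<theta>_def by (intro power_mono) (auto simp: abs_mult Cauchy_Schwarz_ineq2)
        finally have "norm (f x) * norm (cis (\<theta> x) - 1 - \<i> * \<theta> x) \<le> norm (f x) * (2 * pi * (norm x * norm h))\<^sup>2"
          by (intro mult_left_mono) auto
        then show "norm (R x) \<le> (2 * pi)\<^sup>2 * (norm h)\<^sup>2 * (norm x ^ 2 * norm (f x))"
          unfolding R_def by (simp add: norm_mult power_mult_distrib mult_ac)
      qed
    qed
    ultimately show ?thesis unfolding C_def integral_mult_right_zero by (simp only: mult_ac)
  qed
  show ?thesis
    unfolding has_derivative_at
  proof (intro conjI lin)
    have "((\<lambda>h. C * norm h) \<longlongrightarrow> C * 0) (at (0 :: real^'n))"
      by (intro tendsto_intros tendsto_norm_zero)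
    then have "((\<lambda>h. C * norm h) \<longlongrightarrow> 0) (at (0 :: real^'n))" by simp
    then show "((\<lambda>h. norm (fourier f (\<xi> + h) - fourier f \<xi> - ?D h) / norm h) \<longlongrightarrow> 0) (at 0)"
    proof (rule tendsto_0_le[where K = 1], intro always_eventually allI)
      fix h :: "real^'n"
      have "norm (fourier f (\<xi> + h) - fourier f \<xi> - ?D h) / norm h \<le> C * norm h"
        using rem[of h] C0 by (cases "h = 0") (simp_all add: divide_le_eq power2_eq_square mult_ac)
      then show "norm (norm (fourier f (\<xi> + h) - fourier f \<xi> - ?D h) / norm h) \<le> norm (C * norm h) * 1"
        using C0 by simp
    qed
  qed
qed

lemma partial_deriv_fourier:
  assumes f: "f \<in> schwartz"
  shows "partial_deriv i (fourier f) = fourier (\<lambda>x. (- 2 * pi * \<i>) * (complex_of_real (x $ i) * f x))"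
proof
  fix \<xi>
  show "partial_deriv i (fourier f) \<xi> = fourier (\<lambda>x. (- 2 * pi * \<i>) * (complex_of_real (x $ i) * f x)) \<xi>"
    unfolding partial_deriv_has_derivative[OF fourier_has_derivative[OF f]]
    by (subst sum.remove[of _ i]) (auto simp: axis_def intro!: sum.neutral)
qed

lemma smooth_fourier:
  fixes f :: "real^'n::finite \<Rightarrow> complex"
  assumes f: "f \<in> schwartz"
  shows "smooth (fourier f)"
proof (rule smooth_coinduct[where X = "\<lambda>h. \<exists>f\<in>schwartz. h = fourier f"])
  show "\<exists>g\<in>schwartz. fourier f = fourier g" using f by (intro bexI[of _ f] refl)
next
  fix h :: "real^'n \<Rightarrow> complex" and x
  assume "\<exists>f\<in>schwartz. h = fourier f"
  then obtain g where g: "g \<in> schwartz" and h: "h = fourier g" by blast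
  show "h differentiable (at x)" unfolding h by (rule differentiableI[OF fourier_has_derivative[OF g]])
next
  fix h :: "real^'n \<Rightarrow> complex" and i
  assume "\<exists>f\<in>schwartz. h = fourier f"
  then obtain g where g: "g \<in> schwartz" and h: "h = fourier g" by blast
  show "\<exists>f\<in>schwartz. partial_deriv i h = fourier f"
    unfolding h partial_deriv_fourier[OF g]
    by (intro bexI[of _ "\<lambda>x. (- 2 * pi * \<i>) * (complex_of_real (x $ i) * g x)"] refl schwartz_cmult schwartz_coordinate g)
qed

text \<open>Multiplication by a coordinate is, up to a constant of modulus \<open>2\<pi> \<ge> 1\<close>, the transform of a derivative,
  so one more power of the weight costs one derivative of the family.\<close>

lemma fourier_decay:
  fixes F :: "'i \<Rightarrow> real^'n::finite \<Rightarrow> complex"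
  assumes "schwartz_bounded I F"
  shows "\<exists>C. \<forall>i\<in>I. \<forall>\<xi>. (1 + norm \<xi>) ^ m * norm (fourier (F i) \<xi>) \<le> C"
  using assms
proof (induction m arbitrary: F)
  case 0
  obtain C where "\<forall>i\<in>I. (LINT x|lborel. norm (F i x)) \<le> C"
    using schwartz_bounded_integral[OF 0] by blast
  then show ?case using norm_fourier_le by (intro exI[of _ C]) (auto intro: order_trans)
next
  case (Suc m)
  obtain C where C: "\<forall>i\<in>I. \<forall>\<xi>. (1 + norm \<xi>) ^ m * norm (fourier (F i) \<xi>) \<le> C"
    using Suc.IH[OF Suc.prems] by blast
  have "\<forall>j. \<exists>C. \<forall>i\<in>I. \<forall>\<xi>. (1 + norm \<xi>) ^ m * norm (fourier (partial_deriv j (F i)) \<xi>) \<le> C"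
    using Suc.IH[OF schwartz_bounded_deriv[OF Suc.prems]] by blast
  then obtain D where D: "\<forall>j. \<forall>i\<in>I. \<forall>\<xi>. (1 + norm \<xi>) ^ m * norm (fourier (partial_deriv j (F i)) \<xi>) \<le> D j"
    by (rule choice[THEN exE])
  have "(1 + norm \<xi>) ^ Suc m * norm (fourier (F i) \<xi>) \<le> C + (\<Sum>j\<in>UNIV. D j)" if i: "i \<in> I" for i \<xi>
  proof -
    let ?w = "(1 + norm \<xi>) ^ m * norm (fourier (F i) \<xi>)"
    have w0: "?w \<ge> 0" by simp
    have "\<bar>\<xi> $ j\<bar> * ?w \<le> D j" for j
    proof -
      have "norm (fourier (partial_deriv j (F i)) \<xi>) = 2 * pi * \<bar>\<xi> $ j\<bar> * norm (fourier (F i) \<xi>)"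
        by (simp add: fourier_partial_deriv[OF schwartz_boundedD[OF Suc.prems i]] norm_mult)
      moreover have "1 * (\<bar>\<xi> $ j\<bar> * norm (fourier (F i) \<xi>)) \<le> (2 * pi) * (\<bar>\<xi> $ j\<bar> * norm (fourier (F i) \<xi>))"
        using pi_gt3 by (intro mult_right_mono) auto
      ultimately have "\<bar>\<xi> $ j\<bar> * norm (fourier (F i) \<xi>) \<le> norm (fourier (partial_deriv j (F i)) \<xi>)"
        by (simp add: mult_ac)
      then have "(1 + norm \<xi>) ^ m * (\<bar>\<xi> $ j\<bar> * norm (fourier (F i) \<xi>)) \<le> (1 + norm \<xi>) ^ m * norm (fourier (partial_deriv j (F i)) \<xi>)"
        by (intro mult_left_mono) auto
      also have "\<dots> \<le> D j" using D i by blast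
      finally show ?thesis by (simp add: mult_ac)
    qed
    then have s: "(\<Sum>j\<in>UNIV. \<bar>\<xi> $ j\<bar> * ?w) \<le> (\<Sum>j\<in>UNIV. D j)" by (intro sum_mono)
    have "norm \<xi> * ?w \<le> (\<Sum>j\<in>UNIV. \<bar>\<xi> $ j\<bar>) * ?w" using norm_le_l1_cart[of \<xi>] w0 by (intro mult_right_mono)
    then have "?w + norm \<xi> * ?w \<le> C + (\<Sum>j\<in>UNIV. D j)"
      using s C i unfolding sum_distrib_right by (meson add_mono order_trans)
    then show ?thesis by (simp add: algebra_simps)
  qed
  then show ?case by (intro exI[of _ "C + (\<Sum>j\<in>UNIV. D j)"]) auto
qed

text \<open>Derivatives of transforms are transforms of the family multiplied by polynomials, and that family
  is again bounded.\<close>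

lemma fourier_partials:
  assumes "schwartz_bounded I F"
  shows "\<exists>G. schwartz_bounded I G \<and> (\<forall>i\<in>I. partials is (fourier (F i)) = fourier (G i))"
proof (induction "is")
  case Nil show ?case using assms by (intro exI[of _ F]) simp
next
  case (Cons j "is")
  then obtain G where G: "schwartz_bounded I G" "\<forall>i\<in>I. partials is (fourier (F i)) = fourier (G i)" by blast
  define H where "H i x = (- 2 * pi * \<i>) * (complex_of_real (x $ j) * G i x)" for i x
  have H: "schwartz_bounded I H"
    unfolding H_def by (intro schwartz_bounded_mult[OF moderate_const] schwartz_bounded_mult[OF moderate_coordinate] G)
      (auto intro: order_refl)
  have "partials (j # is) (fourier (F i)) = fourier (H i)" if "i \<in> I" for i
    using G(2) that partial_deriv_fourier[OF schwartz_boundedD[OF G(1) that], of j]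
    unfolding H_def[abs_def] by simp
  with H show ?case by (intro exI[of _ H]) auto
qed

theorem schwartz_bounded_fourier:
  assumes "schwartz_bounded I F"
  shows "schwartz_bounded I (\<lambda>i. fourier (F i))"
  unfolding schwartz_bounded_def
proof (intro conjI allI ballI)
  show "smooth (fourier (F i))" if "i \<in> I" for i
    by (intro smooth_fourier schwartz_boundedD[OF assms that])
  fix m "is"
  obtain G where G: "schwartz_bounded I G" "\<forall>i\<in>I. partials is (fourier (F i)) = fourier (G i)"
    using fourier_partials[OF assms] by blast
  then show "\<exists>C. \<forall>i\<in>I. \<forall>\<xi>. (1 + norm \<xi>) ^ m * norm (partials is (fourier (F i)) \<xi>) \<le> C"
    using fourier_decay[OF G(1), of m] by simp
qed

lemma schwartz_fourier: "f \<in> schwartz \<Longrightarrow> fourier f \<in> schwartz"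
  unfolding schwartz_iff_bounded by (rule schwartz_bounded_fourier)

lemma schwartz_bounded_inv_fourier:
  assumes "schwartz_bounded I F"
  shows "schwartz_bounded I (\<lambda>i. inv_fourier (F i))"
proof -
  have "schwartz_bounded I (\<lambda>i x. fourier (F i) (0 + (- 1) *\<^sub>R x))"
    by (intro schwartz_bounded_affine schwartz_bounded_fourier assms) simp
  then show ?thesis by (simp add: inv_fourier_eq[abs_def])
qed

lemma schwartz_inv_fourier: "f \<in> schwartz \<Longrightarrow> inv_fourier f \<in> schwartz"
  unfolding schwartz_iff_bounded by (rule schwartz_bounded_inv_fourier)

section \<open>Fourier inversion\<close>

definition gaussian :: "real^'n::finite \<Rightarrow> complex" where
  "gaussian x = complex_of_real (exp (- pi * (x \<bullet> x)))"

lemma integrable_gaussian_1D: "integrable lborel (\<lambda>x::real. exp (- pi * x\<^sup>2))"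
proof -
  have "integrable lborel (\<lambda>x. std_normal_density (0 + sqrt (2 * pi) * x))"
    using integrable_normal_density[of 1 0] by (intro lborel_integrable_real_affine) auto
  then have "integrable lborel (\<lambda>x. sqrt (2 * pi) * std_normal_density (sqrt (2 * pi) * x))"
    by simp
  then show ?thesis
    by (simp add: std_normal_density_def power_mult_distrib)
qed

text \<open>The characteristic function of the standard normal distribution, rescaled.\<close>

lemma fourier_gaussian_1D:
  "(LINT x|lborel. complex_of_real (exp (- pi * x\<^sup>2)) * cis (- 2 * pi * (x * \<xi>))) = complex_of_real (exp (- pi * \<xi>\<^sup>2))"
proof -
  define t where "t = - sqrt (2 * pi) * \<xi>"
  have tt: "t * (sqrt (2 * pi) * x) = - 2 * pi * (x * \<xi>)" for x
  proof -
    define c where "c = sqrt (2 * pi)"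
    have "t * (c * x) = - ((c * c) * (x * \<xi>))" unfolding t_def c_def[symmetric] by (simp add: mult_ac)
    moreover have "c * c = 2 * pi" unfolding c_def by simp
    ultimately show ?thesis unfolding c_def by simp
  qed
  have "complex_of_real (exp (- (t^2) / 2)) = char std_normal_distribution t"
    by (simp add: char_std_normal_distribution)
  also have "\<dots> = (LINT x|lborel. std_normal_density x *\<^sub>R iexp (t * x))"
    unfolding char_def by (subst integral_density) (auto simp: normal_density_nonneg)
  also have "\<dots> = \<bar>sqrt (2 * pi)\<bar> *\<^sub>R (LINT x|lborel. std_normal_density (0 + sqrt (2 * pi) * x) *\<^sub>R iexp (t * (0 + sqrt (2 * pi) * x)))"
    by (rule lborel_integral_real_affine) simp
  also have "\<dots> = (LINT x|lborel. complex_of_real (exp (- pi * x\<^sup>2)) * cis (- 2 * pi * (x * \<xi>)))"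
    unfolding integral_scaleR_right[symmetric]
    by (intro Bochner_Integration.integral_cong refl)
       (simp add: std_normal_density_def power_mult_distrib tt cis_conv_exp scaleR_conv_of_real del: of_real_mult)
  finally show ?thesis
    unfolding t_def by (simp add: power_mult_distrib)
qed

lemma gaussian_product:
  fixes x \<xi> :: "real^'n::finite"
  shows "gaussian x * cis (- 2 * pi * (x \<bullet> \<xi>)) =
    (\<Prod>b\<in>Basis. complex_of_real (exp (- pi * (x \<bullet> b)\<^sup>2)) * cis (- 2 * pi * ((x \<bullet> b) * (\<xi> \<bullet> b))))"
proof -
  have "(\<Prod>b\<in>(Basis :: (real^'n) set). exp (- pi * (x \<bullet> b)\<^sup>2)) = exp (- pi * (x \<bullet> x))"
    unfolding euclidean_inner[of x x] by (simp add: exp_sum power2_eq_square sum_distrib_left flip: sum_negf)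
  moreover have "(\<Prod>b\<in>(Basis :: (real^'n) set). cis (- 2 * pi * ((x \<bullet> b) * (\<xi> \<bullet> b)))) = cis (- 2 * pi * (x \<bullet> \<xi>))"
    unfolding euclidean_inner[of x \<xi>] by (simp add: cis_conv_exp exp_sum sum_distrib_left flip: sum_negf)
  ultimately show ?thesis
    unfolding gaussian_def by (simp add: prod.distrib flip: of_real_prod)
qed

lemma has_bochner_integral_product_lborel:
  fixes f :: "'a::euclidean_space \<Rightarrow> real \<Rightarrow> complex"
  assumes "\<And>b. b \<in> Basis \<Longrightarrow> integrable lborel (f b)"
  shows "integrable lborel (\<lambda>x. \<Prod>b\<in>Basis. f b (x \<bullet> b))"
    and "(LINT x|lborel. (\<Prod>b\<in>Basis. f b (x \<bullet> b))) = (\<Prod>b\<in>Basis. (LINT x|lborel. f b x))"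
proof -
  interpret product_sigma_finite "\<lambda>_::'a. lborel :: real measure" ..
  let ?S = "\<lambda>g. \<Sum>b\<in>Basis. g b *\<^sub>R b :: 'a"
  have [measurable]: "\<And>b. b \<in> Basis \<Longrightarrow> f b \<in> borel_measurable borel"
    using borel_measurable_integrable[OF assms] by simp
  have S[measurable]: "?S \<in> measurable (\<Pi>\<^sub>M b\<in>Basis. lborel) borel" by measurable
  have m[measurable]: "(\<lambda>x. \<Prod>b\<in>Basis. f b (x \<bullet> b)) \<in> borel_measurable borel" by measurable
  have e: "(\<Prod>b\<in>Basis. f b (?S g \<bullet> b)) = (\<Prod>b\<in>Basis. f b (g b))" for g by simp
  have int: "integrable (\<Pi>\<^sub>M b\<in>Basis. lborel) (\<lambda>g. \<Prod>b\<in>Basis. f b (g b))"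
    by (rule product_integrable_prod) (use assms in auto)
  show "integrable lborel (\<lambda>x. \<Prod>b\<in>Basis. f b (x \<bullet> b))"
    by (subst lborel_eq, subst integrable_distr_eq) (use int in \<open>simp_all only: e S m\<close>)
  have "(LINT x|lborel. (\<Prod>b\<in>Basis. f b (x \<bullet> b))) = (LINT g|(\<Pi>\<^sub>M b\<in>Basis. lborel). (\<Prod>b\<in>Basis. f b (g b)))"
    by (subst lborel_eq, subst integral_distr) (simp_all only: e S m)
  also have "\<dots> = (\<Prod>b\<in>Basis. (LINT x|lborel. f b x))"
    by (rule product_integral_prod) (use assms in auto)
  finally show "(LINT x|lborel. (\<Prod>b\<in>Basis. f b (x \<bullet> b))) = (\<Prod>b\<in>Basis. (LINT x|lborel. f b x))" .
qed

lemma integrable_gaussian: "integrable lborel (gaussian :: real^'n::finite \<Rightarrow> complex)"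
  and fourier_gaussian: "fourier gaussian \<xi> = gaussian (\<xi> :: real^'n)"
proof -
  let ?f = "\<lambda>\<xi>. \<lambda>b (x::real). complex_of_real (exp (- pi * x\<^sup>2)) * cis (- 2 * pi * (x * (\<xi> \<bullet> b)))"
  have i: "integrable lborel (?f \<xi> b)" for \<xi> b :: "real^'n"
  proof (rule integrable_cis)
    show "integrable lborel (\<lambda>x. complex_of_real (exp (- pi * x\<^sup>2)))"
      using integrable_gaussian_1D by (rule integrable_of_real)
  qed measurable
  have "integrable lborel (\<lambda>x::real^'n. gaussian x * cis (- 2 * pi * (x \<bullet> 0)))"
    unfolding gaussian_product by (rule has_bochner_integral_product_lborel(1)[OF i])
  then show "integrable lborel (gaussian :: real^'n \<Rightarrow> complex)" by simp
  have "fourier gaussian \<xi> = (\<Prod>b\<in>Basis. complex_of_real (exp (- pi * (\<xi> \<bullet> b)\<^sup>2)))"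
    unfolding fourier_def gaussian_product has_bochner_integral_product_lborel(2)[OF i] fourier_gaussian_1D ..
  also have "\<dots> = gaussian \<xi>"
    using gaussian_product[of \<xi> 0] by simp
  finally show "fourier gaussian \<xi> = gaussian \<xi>" .
qed

lemma integral_gaussian: "(LINT x|lborel. gaussian (x :: real^'n::finite)) = 1"
  using fourier_gaussian[of "0 :: real^'n"] unfolding fourier_def by (simp add: gaussian_def)

lemma norm_gaussian_le: "norm (gaussian x) \<le> 1"
  by (simp add: gaussian_def)

lemma continuous_gaussian: "isCont gaussian x"
  unfolding gaussian_def[abs_def] by (intro continuous_intros)

text \<open>Insert a wide Gaussian into the inversion integral. By the multiplication formula the Gaussian
  turns into an approximate identity acting on \<open>f\<close>, and both sides converge as its width on the Fourier side
  grows.\<close>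

theorem fourier_inversion:
  fixes f :: "real^'n::finite \<Rightarrow> complex"
  assumes f: "f \<in> schwartz"
  shows "inv_fourier (fourier f) = f"
proof
  fix x :: "real^'n"
  define t where "t m = 1 / real (Suc m)" for m
  have t: "t m > 0" for m unfolding t_def by simp
  have tlim: "t \<longlonglongrightarrow> 0" unfolding t_def by (rule LIMSEQ_Suc[OF lim_1_over_n])
  note [measurable] = schwartz_measurable[OF f] schwartz_measurable[OF schwartz_fourier[OF f]]
    borel_measurable_integrable[OF integrable_gaussian]
  \<comment> \<open>The inversion integrand at \<open>x\<close>, damped by a Gaussian of width \<open>1 / t m\<close>.\<close>
  define k where "k m \<xi> = gaussian (t m *\<^sub>R \<xi>) * cis (2 * pi * (x \<bullet> \<xi>))" for m \<xi>
  have ig: "integrable lborel (\<lambda>\<xi>::real^'n. gaussian (t m *\<^sub>R \<xi>))" for m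
    using integrable_affine[OF integrable_gaussian, of "t m" 0] t[of m] by simp
  have ik: "integrable lborel (k m)" for m
    unfolding k_def by (intro integrable_cis ig) measurable
  \<comment> \<open>The transform of the damped plane wave is a Gaussian concentrated at \<open>x\<close> on the scale \<open>t m\<close>.\<close>
  have fk: "(\<bar>t m\<bar> ^ DIM(real^'n)) *\<^sub>R fourier (k m) (x + t m *\<^sub>R y) = gaussian y" for m y
  proof -
    have "fourier (k m) (x + t m *\<^sub>R y) = (LINT \<xi>|lborel. gaussian (0 + t m *\<^sub>R \<xi>) * cis (- 2 * pi * ((0 + t m *\<^sub>R \<xi>) \<bullet> y)))"
      unfolding fourier_def k_def
      by (intro Bochner_Integration.integral_cong refl)
         (simp add: mult.assoc cis_mult inner_add_right algebra_simps inner_commute[of x])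
    also have "(\<bar>t m\<bar> ^ DIM(real^'n)) *\<^sub>R \<dots> = fourier gaussian y"
      unfolding fourier_def
      using integral_affine[OF fourier_integrable[OF integrable_gaussian, of y], of "t m" 0] t[of m] by simp
    finally show ?thesis by (simp add: fourier_gaussian)
  qed
  have eq: "(LINT \<xi>|lborel. fourier f \<xi> * k m \<xi>) = (LINT y|lborel. f (x + t m *\<^sub>R y) * gaussian y)" for m
  proof -
    have "(LINT \<xi>|lborel. fourier f \<xi> * k m \<xi>) = (LINT y|lborel. f y * fourier (k m) y)"
      by (rule fourier_multiplication_formula[OF schwartz_integrable[OF f] ik])
    also have "\<dots> = (\<bar>t m\<bar> ^ DIM(real^'n)) *\<^sub>R (LINT y|lborel. f (x + t m *\<^sub>R y) * fourier (k m) (x + t m *\<^sub>R y))"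
    proof (rule integral_affine)
      have "continuous_on UNIV (fourier (k m))"
      proof -
        have "fourier (k m) y = (1 / \<bar>t m\<bar> ^ DIM(real^'n)) *\<^sub>R gaussian ((1 / t m) *\<^sub>R (y - x))" for y
        proof -
          have "x + t m *\<^sub>R ((1 / t m) *\<^sub>R (y - x)) = y"
            unfolding scaleR_scaleR using t[of m] by simp
          then have "(\<bar>t m\<bar> ^ DIM(real^'n)) *\<^sub>R fourier (k m) y = gaussian ((1 / t m) *\<^sub>R (y - x))"
            using fk[of m "(1 / t m) *\<^sub>R (y - x)"] by simp
          then have "(1 / \<bar>t m\<bar> ^ DIM(real^'n)) *\<^sub>R ((\<bar>t m\<bar> ^ DIM(real^'n)) *\<^sub>R fourier (k m) y)
              = (1 / \<bar>t m\<bar> ^ DIM(real^'n)) *\<^sub>R gaussian ((1 / t m) *\<^sub>R (y - x))" by (rule arg_cong)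
          then show ?thesis using t[of m] unfolding scaleR_scaleR by simp
        qed
        then have "fourier (k m) = (\<lambda>y. (1 / \<bar>t m\<bar> ^ DIM(real^'n)) *\<^sub>R gaussian ((1 / t m) *\<^sub>R (y - x)))" ..
        then show ?thesis unfolding gaussian_def by (auto intro!: continuous_intros simp: t[of m, THEN less_imp_neq, symmetric])
      qed
      then have [measurable]: "fourier (k m) \<in> borel_measurable borel" by (rule borel_measurable_continuous_onI)
      show "integrable lborel (\<lambda>y. f y * fourier (k m) y)"
      proof (rule Bochner_Integration.integrable_bound[of _ "\<lambda>y. norm (f y) * (LINT z|lborel. norm (k m z))"])
        show "integrable lborel (\<lambda>y. norm (f y) * (LINT z|lborel. norm (k m z)))"
          by (intro integrable_mult_left integrable_norm schwartz_integrable f)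
        show "AE y in lborel. norm (f y * fourier (k m) y) \<le> norm (norm (f y) * (LINT z|lborel. norm (k m z)))"
          using norm_fourier_le[of "k m"] by (intro AE_I2) (simp add: norm_mult mult_left_mono)
      qed measurable
    qed (use t[of m] in simp)
    also have "\<dots> = (LINT y|lborel. f (x + t m *\<^sub>R y) * gaussian y)"
      unfolding integral_scaleR_right[symmetric] fk[of m, symmetric] by simp
    finally show ?thesis .
  qed
  have "(\<lambda>m. LINT \<xi>|lborel. fourier f \<xi> * k m \<xi>) \<longlonglongrightarrow> (LINT \<xi>|lborel. fourier f \<xi> * cis (2 * pi * (x \<bullet> \<xi>)))"
  proof (rule integral_dominated_convergence[where w = "\<lambda>\<xi>. norm (fourier f \<xi>)"])
    show "integrable lborel (\<lambda>\<xi>. norm (fourier f \<xi>))"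
      by (intro integrable_norm schwartz_integrable schwartz_fourier f)
    show "AE \<xi> in lborel. norm (fourier f \<xi> * k m \<xi>) \<le> norm (fourier f \<xi>)" for m
      unfolding k_def by (intro AE_I2) (simp add: norm_mult mult_left_le norm_gaussian_le)
    show "AE \<xi> in lborel. (\<lambda>m. fourier f \<xi> * k m \<xi>) \<longlonglongrightarrow> fourier f \<xi> * cis (2 * pi * (x \<bullet> \<xi>))"
    proof (rule AE_I2)
      fix \<xi> :: "real^'n"
      have "(\<lambda>m. t m *\<^sub>R \<xi>) \<longlonglongrightarrow> 0" using tendsto_scaleR[OF tlim tendsto_const[of \<xi>]] by simp
      then have "(\<lambda>m. gaussian (t m *\<^sub>R \<xi>)) \<longlonglongrightarrow> gaussian (0 :: real^'n)"
        by (rule isCont_tendsto_compose[OF continuous_gaussian])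
      then have "(\<lambda>m. gaussian (t m *\<^sub>R \<xi>)) \<longlonglongrightarrow> 1" by (simp add: gaussian_def)
      then have "(\<lambda>m. fourier f \<xi> * (gaussian (t m *\<^sub>R \<xi>) * cis (2 * pi * (x \<bullet> \<xi>)))) \<longlonglongrightarrow> fourier f \<xi> * (1 * cis (2 * pi * (x \<bullet> \<xi>)))"
        by (intro tendsto_intros)
      then show "(\<lambda>m. fourier f \<xi> * k m \<xi>) \<longlonglongrightarrow> fourier f \<xi> * cis (2 * pi * (x \<bullet> \<xi>))"
        by (simp add: k_def)
    qed
    show "(\<lambda>\<xi>. fourier f \<xi> * cis (2 * pi * (x \<bullet> \<xi>))) \<in> borel_measurable lborel"
      unfolding cis_conv_exp by measurable
    show "(\<lambda>\<xi>. fourier f \<xi> * k m \<xi>) \<in> borel_measurable lborel" for m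
      unfolding cis_conv_exp k_def by measurable
  qed
  note lim1 = this
  have "(\<lambda>m. LINT y|lborel. f (x + t m *\<^sub>R y) * gaussian y) \<longlonglongrightarrow> (LINT y|lborel. f x * gaussian (y :: real^'n))"
  proof -
    obtain C where C: "C > 0" "\<forall>x. norm (f x) \<le> C"
      using schwartz_decay[OF f[unfolded schwartz_iff_bounded], of 0] by auto
    show ?thesis
    proof (rule integral_dominated_convergence[where w = "\<lambda>y. C * norm (gaussian y)"])
      show "integrable lborel (\<lambda>y::real^'n. C * norm (gaussian y))"
        by (intro integrable_mult_right integrable_norm integrable_gaussian)
      show "AE y in lborel. norm (f (x + t m *\<^sub>R y) * gaussian y) \<le> C * norm (gaussian y)" for m
        using C by (auto simp: norm_mult intro!: mult_right_mono)
      show "AE y in lborel. (\<lambda>m. f (x + t m *\<^sub>R y) * gaussian y) \<longlonglongrightarrow> f x * gaussian y"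
      proof (rule AE_I2)
        fix y :: "real^'n"
        have "(\<lambda>m. x + t m *\<^sub>R y) \<longlonglongrightarrow> x" using tendsto_add[OF tendsto_const[of x] tendsto_scaleR[OF tlim tendsto_const[of y]]] by simp
        moreover have "isCont f x" using smooth_differentiable[OF schwartz_smooth[OF f]] by (rule differentiable_imp_continuous_within)
        ultimately have "(\<lambda>m. f (x + t m *\<^sub>R y)) \<longlonglongrightarrow> f x" by (rule isCont_tendsto_compose[rotated])
        then show "(\<lambda>m. f (x + t m *\<^sub>R y) * gaussian y) \<longlonglongrightarrow> f x * gaussian y" by (intro tendsto_intros)
      qed
    qed measurable
  qed
  note lim2 = this
  have "(LINT y|lborel. f x * gaussian (y :: real^'n)) = f x" by (simp add: integral_gaussian)
  then have "(LINT \<xi>|lborel. fourier f \<xi> * cis (2 * pi * (x \<bullet> \<xi>))) = f x"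
    using LIMSEQ_unique[OF lim1[unfolded eq] lim2] by simp
  then show "inv_fourier (fourier f) x = f x" unfolding inv_fourier_def .
qed

corollary fourier_inv_fourier:
  fixes f :: "real^'n::finite \<Rightarrow> complex"
  assumes f: "f \<in> schwartz"
  shows "fourier (inv_fourier f) = f"
proof
  fix x
  have "fourier (inv_fourier f) x = (LINT y|lborel. inv_fourier f y * cis (- 2 * pi * (y \<bullet> x)))"
    unfolding fourier_def ..
  also have "\<dots> = (LINT y|lborel. inv_fourier f (0 + (- 1) *\<^sub>R y) * cis (- 2 * pi * ((0 + (- 1) *\<^sub>R y) \<bullet> x)))"
    using integral_affine[OF fourier_integrable[OF schwartz_integrable[OF schwartz_inv_fourier[OF f]]], of "-1" x 0] by simp
  also have "\<dots> = inv_fourier (fourier f) x"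
    unfolding inv_fourier_def[of "fourier f"] by (simp add: inv_fourier_eq inner_commute)
  finally show "fourier (inv_fourier f) x = f x" by (simp add: fourier_inversion[OF f])
qed

lemma inv_fourier_multiplication_formula:
  assumes f: "f \<in> schwartz" and g: "g \<in> schwartz"
  shows "(LINT x|lborel. inv_fourier f x * g x) = (LINT \<xi>|lborel. f \<xi> * inv_fourier g \<xi>)"
proof -
  have "(LINT x|lborel. inv_fourier f x * g x) = (LINT x|lborel. inv_fourier f x * fourier (inv_fourier g) x)"
    by (simp add: fourier_inv_fourier[OF g])
  also have "\<dots> = (LINT \<xi>|lborel. fourier (inv_fourier f) \<xi> * inv_fourier g \<xi>)"
    by (intro fourier_multiplication_formula[symmetric] schwartz_integrable schwartz_inv_fourier f g)
  finally show ?thesis by (simp add: fourier_inv_fourier[OF f])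
qed

section \<open>Functions representing distributions\<close>

text \<open>The polynomial factors that appear in the derivatives of the Gaussian.\<close>

inductive polynomial_fun :: "(real^'n::finite \<Rightarrow> complex) \<Rightarrow> bool" where
  const: "polynomial_fun (\<lambda>x. c)"
| coord: "polynomial_fun p \<Longrightarrow> polynomial_fun (\<lambda>x. complex_of_real (x $ j) * p x)"
| add: "polynomial_fun p \<Longrightarrow> polynomial_fun q \<Longrightarrow> polynomial_fun (\<lambda>x. p x + q x)"

lemma smooth_polynomial_fun: "polynomial_fun p \<Longrightarrow> smooth p"
proof (induction rule: polynomial_fun.induct)
  case (const c) show ?case by (rule smooth_const)
next
  case (coord p j) then show ?case by (intro smooth_mult smooth_coordinate)
next
  case (add p q) then show ?case by (intro smooth_add)
qed

lemma polynomial_fun_cmult: "polynomial_fun p \<Longrightarrow> polynomial_fun (\<lambda>x. c * p x)"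
proof (induction rule: polynomial_fun.induct)
  case (const d) show ?case by (rule polynomial_fun.const)
next
  case (coord p j)
  have "(\<lambda>x. c * (complex_of_real (x $ j) * p x)) = (\<lambda>x. complex_of_real (x $ j) * (c * p x))" by (simp add: mult_ac)
  then show ?case using polynomial_fun.coord[OF coord.IH, of j] by (simp only:)
next
  case (add p q)
  then show ?case unfolding distrib_left by (intro polynomial_fun.add)
qed

lemma polynomial_fun_deriv: "polynomial_fun p \<Longrightarrow> polynomial_fun (partial_deriv i p)"
proof (induction rule: polynomial_fun.induct)
  case (const c) show ?case unfolding partial_deriv_const by (rule polynomial_fun.const)
next
  case (coord p j)
  have "partial_deriv i (\<lambda>x. complex_of_real (x $ j) * p x) =
      (\<lambda>x. (if j = i then 1 else 0) * p x + complex_of_real (x $ j) * partial_deriv i p x)"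
    by (rule ext, subst partial_deriv_mult[OF smooth_differentiable[OF smooth_coordinate]
          smooth_differentiable[OF smooth_polynomial_fun[OF coord.hyps]]])
      (simp only: partial_deriv_coordinate)
  then show ?case
    using polynomial_fun.add[OF polynomial_fun_cmult[OF coord.hyps] polynomial_fun.coord[OF coord.IH]]
    by (simp only:)
next
  case (add p q)
  have "partial_deriv i (\<lambda>x. p x + q x) = (\<lambda>x. partial_deriv i p x + partial_deriv i q x)"
    by (rule ext, intro partial_deriv_add smooth_differentiable smooth_polynomial_fun add.hyps)
  then show ?case using polynomial_fun.add[OF add.IH] by (simp only:)
qed

lemma polynomial_fun_growth: "polynomial_fun p \<Longrightarrow> \<exists>C m. \<forall>x. norm (p x) \<le> C * (1 + norm x) ^ m"
proof (induction rule: polynomial_fun.induct)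
  case (const c) show ?case by (intro exI[of _ "norm c"] exI[of _ 0]) simp
next
  case (coord p j)
  then obtain C m where C: "\<forall>x. norm (p x) \<le> C * (1 + norm x) ^ m" by blast
  have "norm (complex_of_real (x $ j) * p x) \<le> C * (1 + norm x) ^ Suc m" for x
  proof -
    have "norm (complex_of_real (x $ j) * p x) \<le> (1 + norm x) * (C * (1 + norm x) ^ m)"
      unfolding norm_mult using component_le_norm_cart[of x j] C by (intro mult_mono) (auto intro: order_trans)
    then show ?thesis by (simp add: mult_ac)
  qed
  then show ?case by blast
next
  case (add p q)
  obtain C m where C: "\<forall>x. norm (p x) \<le> C * (1 + norm x) ^ m" using add.IH(1) by blast
  obtain D k where D: "\<forall>x. norm (q x) \<le> D * (1 + norm x) ^ k" using add.IH(2) by blast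
  have "norm (p x + q x) \<le> (\<bar>C\<bar> + \<bar>D\<bar>) * (1 + norm x) ^ (m + k)" for x
  proof -
    have "norm (p x) \<le> \<bar>C\<bar> * (1 + norm x) ^ m"
      using C[rule_format, of x] by (rule order_trans) (intro mult_right_mono, auto)
    also have "\<dots> \<le> \<bar>C\<bar> * (1 + norm x) ^ (m + k)"
      by (intro mult_left_mono power_increasing) auto
    finally have 1: "norm (p x) \<le> \<bar>C\<bar> * (1 + norm x) ^ (m + k)" .
    have "norm (q x) \<le> \<bar>D\<bar> * (1 + norm x) ^ k"
      using D[rule_format, of x] by (rule order_trans) (intro mult_right_mono, auto)
    also have "\<dots> \<le> \<bar>D\<bar> * (1 + norm x) ^ (m + k)"
      by (intro mult_left_mono power_increasing) auto
    finally show ?thesis using 1 norm_triangle_ineq[of "p x" "q x"] by (simp add: distrib_right)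
  qed
  then show ?case by blast
qed

lemma gaussian_has_derivative:
  "(gaussian has_derivative (\<lambda>h. (- 2 * pi * (x \<bullet> h)) *\<^sub>R gaussian x)) (at x)"
proof -
  have "((\<lambda>x. exp (- pi * (x \<bullet> x))) has_derivative (\<lambda>h. exp (- pi * (x \<bullet> x)) * (- 2 * pi * (x \<bullet> h)))) (at x)"
    by (auto intro!: derivative_eq_intros simp: fun_eq_iff inner_commute)
  from has_derivative_of_real[OF this, where ?'a = complex]
  show ?thesis unfolding gaussian_def[abs_def] by (simp add: scaleR_conv_of_real mult_ac)
qed

lemma partial_deriv_gaussian: "partial_deriv j gaussian = (\<lambda>x. (- 2 * pi) * (complex_of_real (x $ j) * gaussian x))"
  by (rule ext, subst partial_deriv_has_derivative[OF gaussian_has_derivative])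
     (simp add: inner_axis scaleR_conv_of_real mult_ac)

lemma partials_gaussian: "\<exists>p. polynomial_fun p \<and> partials is gaussian = (\<lambda>x. p x * gaussian x)"
proof (induction "is")
  case Nil show ?case by (intro exI[of _ "\<lambda>x. 1"] conjI polynomial_fun.const) simp
next
  case (Cons j "is")
  then obtain p where p: "polynomial_fun p" "partials is gaussian = (\<lambda>x. p x * gaussian x)" by blast
  have "partials (j # is) gaussian x = (partial_deriv j p x + (- 2 * pi) * (complex_of_real (x $ j) * p x)) * gaussian x" for x
    unfolding partials.simps p(2)
    by (subst partial_deriv_mult[OF smooth_differentiable[OF smooth_polynomial_fun[OF p(1)]]
        differentiableI[OF gaussian_has_derivative]]) (simp add: partial_deriv_gaussian algebra_simps)
  moreover have "polynomial_fun (\<lambda>x. partial_deriv j p x + (- 2 * pi) * (complex_of_real (x $ j) * p x))"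
    by (intro polynomial_fun.add polynomial_fun_deriv polynomial_fun_cmult polynomial_fun.coord p)
  ultimately show ?case
    by (intro exI[of _ "\<lambda>x. partial_deriv j p x + (- 2 * pi) * (complex_of_real (x $ j) * p x)"] conjI ext)
qed

text \<open>Since \<open>1 + \<bar>x\<bar> \<le> exp \<bar>x\<bar>\<close>, it suffices that \<open>m \<bar>x\<bar> - \<pi> \<bar>x\<bar>^2 \<le> m^2\<close>.\<close>

lemma gaussian_decay: "(1 + norm x) ^ m * norm (gaussian x) \<le> exp ((real m)\<^sup>2)"
proof -
  have "(1 + norm x) ^ m \<le> exp (norm x) ^ m" by (intro power_mono) auto
  also have "\<dots> = exp (real m * norm x)" by (simp add: exp_of_nat_mult)
  finally have "(1 + norm x) ^ m * norm (gaussian x) \<le> exp (real m * norm x) * exp (- pi * (x \<bullet> x))"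
    unfolding gaussian_def by (intro mult_mono) auto
  also have "\<dots> = exp (real m * norm x - pi * (norm x)\<^sup>2)"
    by (simp add: exp_add[symmetric] power2_norm_eq_inner)
  finally have 1: "(1 + norm x) ^ m * norm (gaussian x) \<le> exp (real m * norm x - pi * (norm x)\<^sup>2)" .
  have "real m * norm x - pi * (norm x)\<^sup>2 \<le> (real m)\<^sup>2"
  proof -
    have "2 * (real m * norm x) \<le> (real m)\<^sup>2 + (norm x)\<^sup>2" using sum_squares_bound[of "real m" "norm x"] by simp
    moreover have "1 * (norm x)\<^sup>2 \<le> pi * (norm x)\<^sup>2" using pi_gt3 by (intro mult_right_mono) auto
    moreover have "0 \<le> (real m)\<^sup>2" "0 \<le> (norm x)\<^sup>2" by auto
    ultimately show ?thesis by linarith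
  qed
  then have "exp (real m * norm x - pi * (norm x)\<^sup>2) \<le> exp ((real m)\<^sup>2)" by simp
  with 1 show ?thesis by (rule order_trans)
qed

lemma schwartz_gaussian: "(gaussian :: real^'n::finite \<Rightarrow> complex) \<in> schwartz"
  unfolding schwartz_iff_bounded schwartz_bounded_def
proof (intro conjI allI ballI)
  show "smooth (gaussian :: real^'n \<Rightarrow> complex)"
    unfolding smooth_def
  proof (intro allI)
    fix "is" :: "'n list" and x
    obtain p where p: "polynomial_fun p" "partials is gaussian = (\<lambda>x::real^'n. p x * gaussian x)"
      using partials_gaussian by blast
    show "partials is gaussian differentiable (at x)"
      unfolding p(2) by (intro differentiable_mult smooth_differentiable[OF smooth_polynomial_fun[OF p(1)]]
        differentiableI[OF gaussian_has_derivative])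
  qed
  fix m and "is" :: "'n list"
  obtain p where p: "polynomial_fun p" "partials is gaussian = (\<lambda>x::real^'n. p x * gaussian x)"
    using partials_gaussian by blast
  obtain C k where C: "\<forall>x. norm (p x) \<le> C * (1 + norm x) ^ k" using polynomial_fun_growth[OF p(1)] by blast
  have C0: "C \<ge> 0" using order_trans[OF norm_ge_zero C[rule_format, of 0]] by simp
  have "(1 + norm x) ^ m * norm (partials is gaussian x) \<le> C * exp ((real (k + m))\<^sup>2)" for x
  proof -
    have "(1 + norm x) ^ m * norm (partials is gaussian x) = norm (p x) * ((1 + norm x) ^ m * norm (gaussian x))"
      unfolding p(2) by (simp add: norm_mult)
    also have "\<dots> \<le> (C * (1 + norm x) ^ k) * ((1 + norm x) ^ m * norm (gaussian x))"
      using C by (intro mult_right_mono) auto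
    also have "\<dots> = C * ((1 + norm x) ^ (k + m) * norm (gaussian x))" by (simp add: power_add)
    also have "\<dots> \<le> C * exp ((real (k + m))\<^sup>2)" using gaussian_decay C0 by (intro mult_left_mono)
    finally show ?thesis .
  qed
  then show "\<exists>C. \<forall>i\<in>{()}. \<forall>x. (1 + norm x) ^ m * norm (partials is gaussian x) \<le> C" by blast
qed

text \<open>The name \<open>box\<close> denotes the frequency localization operator here; this is the open interval of the
  Euclidean space.\<close>

abbreviation (input) open_box :: "'a::euclidean_space \<Rightarrow> 'a \<Rightarrow> 'a set" where
  "open_box \<equiv> Topology_Euclidean_Space.box"

lemma AE_notin_frontier_box: "AE x in lborel. x \<notin> cbox a b - open_box (a :: 'a::euclidean_space) b"
proof -
  have "negligible (cbox a b - open_box a b)" by (rule negligible_frontier_interval)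
  then have "cbox a b - open_box a b \<in> null_sets lborel"
    by (simp add: negligible_iff_null_sets null_sets_completion_iff)
  then show ?thesis by (rule AE_not_in)
qed

text \<open>Convolutions of the indicator function of the box with narrow Gaussians are superpositions of
  Schwartz functions, hence orthogonal to \<open>E\<close>. They converge to the indicator function off the
  boundary of the box, which is a null set.\<close>

lemma set_integral_box_eq_0:
  fixes E :: "real^'n::finite \<Rightarrow> complex"
  assumes E: "integrable lborel E" and orth: "\<And>\<phi>. \<phi> \<in> schwartz \<Longrightarrow> (LINT x|lborel. E x * \<phi> x) = 0"
  shows "(LINT x:open_box a b|lborel. E x) = 0"
proof -
  let ?B = "open_box a b" let ?n = "DIM(real^'n)"
  note [measurable] = borel_measurable_integrable[OF E] borel_measurable_integrable[OF integrable_gaussian]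
  define J :: "real^'n \<Rightarrow> complex" where "J x = indicator ?B x" for x
  have [measurable]: "J \<in> borel_measurable borel" unfolding J_def by measurable
  have J1: "norm (J x) \<le> 1" for x unfolding J_def by (auto simp: indicator_def)
  define t where "t m = 1 / real (Suc m)" for m
  have t: "t m > 0" for m unfolding t_def by simp
  have tlim: "t \<longlonglongrightarrow> 0" unfolding t_def by (rule LIMSEQ_Suc[OF lim_1_over_n])
  \<comment> \<open>The indicator function of the box, averaged over shifts of size \<open>t m\<close> with Gaussian weight.\<close>
  define \<Phi> where "\<Phi> m x = (LINT z|lborel. J (x + (- t m) *\<^sub>R z) * gaussian z)" for m x
  have intJ: "integrable lborel (\<lambda>y. norm (J y))"
  proof -
    have "(\<lambda>y. norm (J y)) = indicator ?B" by (auto simp: J_def indicator_def fun_eq_iff)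
    then show ?thesis by (simp add: emeasure_lborel_box_eq integrable_real_indicator)
  qed
  have orth\<Phi>: "(LINT x|lborel. E x * \<Phi> m x) = 0" for m
  proof -
    define g where "g z = gaussian ((1 / t m) *\<^sub>R z) / (t m ^ ?n)" for z :: "real^'n"
    have gm[measurable]: "g \<in> borel_measurable borel" unfolding g_def by measurable
    have g1: "norm (g z) \<le> 1 / t m ^ ?n" for z
      using t[of m] unfolding g_def by (simp add: norm_divide norm_power divide_right_mono norm_gaussian_le)
    have "\<Phi> m x = (LINT y|lborel. J y * g (x - y))" for x
    proof -
      have "(LINT y|lborel. J y * g (x - y)) = (\<bar>- t m\<bar> ^ ?n) *\<^sub>R (LINT z|lborel. J (x + (- t m) *\<^sub>R z) * g (x - (x + (- t m) *\<^sub>R z)))"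
      proof (rule integral_affine)
        show "integrable lborel (\<lambda>y. J y * g (x - y))"
        proof (rule Bochner_Integration.integrable_bound[of _ "\<lambda>y. norm (J y) * (1 / t m ^ ?n)"])
          show "integrable lborel (\<lambda>y. norm (J y) * (1 / t m ^ ?n))" using intJ by (rule integrable_mult_left)
          show "AE y in lborel. norm (J y * g (x - y)) \<le> norm (norm (J y) * (1 / t m ^ ?n))"
            using t[of m] g1 by (intro AE_I2) (simp add: norm_mult mult_left_mono del: times_divide_eq_right)
        qed measurable
      qed (use t[of m] in simp)
      also have "\<dots> = (LINT z|lborel. J (x + (- t m) *\<^sub>R z) * gaussian z)"
        unfolding integral_scaleR_right[symmetric] using t[of m]
        by (intro Bochner_Integration.integral_cong refl) (simp add: g_def scaleR_conv_of_real[of _ "_ :: complex"])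
      finally show ?thesis unfolding \<Phi>_def ..
    qed
    then have "(LINT x|lborel. E x * \<Phi> m x) = (LINT x|lborel. LINT y|lborel. E x * (J y * g (x - y)))"
      by simp
    also have "\<dots> = (LINT y|lborel. LINT x|lborel. E x * (J y * g (x - y)))"
    proof (rule Fubini_dominated(1)[where F = "\<lambda>x. norm (E x)" and G = "\<lambda>y. norm (J y) * (1 / t m ^ ?n)"])
      show "norm (E x * (J y * g (x - y))) \<le> norm (E x) * (norm (J y) * (1 / t m ^ ?n))" for x y
        unfolding norm_mult by (intro mult_left_mono g1 norm_ge_zero)
    qed (measurable, use E intJ in auto)
    also have "\<dots> = (LINT y|lborel. J y * (LINT x|lborel. E x * g (x - y)))"
      unfolding integral_mult_right_zero[symmetric] by (simp add: mult_ac)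
    also have "\<dots> = 0"
    proof -
      have "(\<lambda>x. g (x - y)) \<in> schwartz" for y
      proof -
        have "(\<lambda>x. (1 / t m ^ ?n) * gaussian ((- (1 / t m)) *\<^sub>R y + (1 / t m) *\<^sub>R x)) \<in> schwartz"
          using t[of m] by (intro schwartz_cmult schwartz_affine schwartz_gaussian) simp
        then show ?thesis unfolding g_def by (simp add: scaleR_diff_right)
      qed
      then show ?thesis using orth by simp
    qed
    finally show ?thesis .
  qed
  have ig: "integrable lborel (\<lambda>z::real^'n. norm (gaussian z))" by (intro integrable_norm integrable_gaussian)
  have \<Phi>m[measurable]: "\<Phi> m \<in> borel_measurable borel" for m unfolding \<Phi>_def by measurable
  have "(\<lambda>m. LINT x|lborel. E x * \<Phi> m x) \<longlonglongrightarrow> (LINT x|lborel. E x * J x)"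
  proof (rule integral_dominated_convergence[where w = "\<lambda>x. norm (E x) * (LINT z|lborel. norm (gaussian (z::real^'n)))"])
    show "integrable lborel (\<lambda>x. norm (E x) * (LINT z|lborel. norm (gaussian (z::real^'n))))"
      using E by (intro integrable_mult_left integrable_norm)
    show "AE x in lborel. norm (E x * \<Phi> m x) \<le> norm (E x) * (LINT z|lborel. norm (gaussian (z::real^'n)))" for m
    proof (rule AE_I2)
      fix x
      have "norm (\<Phi> m x) \<le> (LINT z|lborel. norm (gaussian (z::real^'n)))"
        unfolding \<Phi>_def
        by (rule order_trans[OF integral_norm_bound], rule integral_mono_AE)
           (use ig J1 in \<open>auto intro!: Bochner_Integration.integrable_bound[OF ig] AE_I2 simp: norm_mult mult_left_le_one_le\<close>)
      then show "norm (E x * \<Phi> m x) \<le> norm (E x) * (LINT z|lborel. norm (gaussian (z::real^'n)))"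
        by (simp add: norm_mult mult_left_mono)
    qed
    show "AE x in lborel. (\<lambda>m. E x * \<Phi> m x) \<longlonglongrightarrow> E x * J x"
      using AE_notin_frontier_box[of a b]
    proof eventually_elim
      case (elim x)
      have "(\<lambda>m. \<Phi> m x) \<longlonglongrightarrow> (LINT z|lborel. J x * gaussian (z::real^'n))"
        unfolding \<Phi>_def
      proof (rule integral_dominated_convergence[OF _ _ ig])
        show "AE z in lborel. (\<lambda>m. J (x + (- t m) *\<^sub>R z) * gaussian z) \<longlonglongrightarrow> J x * gaussian z"
        proof (rule AE_I2)
          fix z :: "real^'n"
          have lim: "(\<lambda>m. x + (- t m) *\<^sub>R z) \<longlonglongrightarrow> x"
            using tendsto_add[OF tendsto_const[of x] tendsto_scaleR[OF tendsto_minus[OF tlim] tendsto_const[of z]]] by simp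
          have "\<forall>\<^sub>F m in sequentially. J (x + (- t m) *\<^sub>R z) = J x"
          proof (cases "x \<in> ?B")
            case True
            from topological_tendstoD[OF lim open_box True] show ?thesis
              by eventually_elim (use True in \<open>simp add: J_def\<close>)
          next
            case False
            then have out: "x \<in> - cbox a b" using elim by auto
            have "open (- cbox a b)" by (intro open_Compl closed_cbox)
            from topological_tendstoD[OF lim this out] show ?thesis
              by eventually_elim (use False box_subset_cbox[of a b] in \<open>auto simp: J_def indicator_def\<close>)
          qed
          then have "\<forall>\<^sub>F m in sequentially. J x * gaussian z = J (x + (- t m) *\<^sub>R z) * gaussian z"
            by eventually_elim simp
          then show "(\<lambda>m. J (x + (- t m) *\<^sub>R z) * gaussian z) \<longlonglongrightarrow> J x * gaussian z"
            by (rule Lim_transform_eventually[OF tendsto_const])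
        qed
        show "AE z in lborel. norm (J (x + (- t m) *\<^sub>R z) * gaussian z) \<le> norm (gaussian z)" for m
          using J1 by (intro AE_I2) (simp add: norm_mult mult_left_le_one_le)
      qed measurable
      then show ?case by (simp add: integral_gaussian tendsto_mult_left)
    qed
  qed measurable
  then have "(LINT x|lborel. E x * J x) = 0" unfolding orth\<Phi> by (simp add: LIMSEQ_const_iff)
  moreover have "E x * J x = indicator ?B x *\<^sub>R E x" for x
    unfolding J_def by (auto simp: indicator_def)
  ultimately show ?thesis unfolding set_lebesgue_integral_def by simp
qed

text \<open>Boxes are stable under intersection and generate the Borel sets, so the integral of \<open>E\<close> vanishes over every
  Borel set by the \<open>\<pi>\<close>-\<open>\<lambda>\<close> theorem.\<close>

lemma AE_zero_if_set_integral_box_0: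
  fixes E :: "'a::euclidean_space \<Rightarrow> complex"
  assumes E: "integrable lborel E" and box: "\<And>a b. (LINT x:open_box a b|lborel. E x) = 0"
    and UNIV: "(LINT x|lborel. E x) = 0"
  shows "AE x in lborel. E x = 0"
proof (rule sigma_finite_measure.density_zero[OF sigma_finite_lborel E])
  have sb: "sigma_sets UNIV (range (\<lambda>(a, b). open_box a b :: 'a set)) = sets borel"
    unfolding borel_eq_box by simp
  have si: "set_integrable lborel A E" if "A \<in> sets borel" for A
    using that E unfolding set_integrable_def by (intro integrable_mult_indicator) auto
  fix A :: "'a set" assume "A \<in> sets lborel"
  then have A: "A \<in> sigma_sets UNIV (range (\<lambda>(a, b). open_box a b :: 'a set))"
    using sb by simp
  have stable: "Int_stable (range (\<lambda>(a, b). open_box a b :: 'a set))" by (auto simp: Int_stable_def box_Int_box)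
  show "(LINT x:A|lborel. E x) = 0"
    using stable subset_Pow_Union[of "range (\<lambda>(a, b). open_box a b :: 'a set)", THEN order_trans, OF Pow_mono[OF subset_UNIV]] A
  proof (induction A rule: sigma_sets_induct_disjoint)
    case (basic A) then show ?case using box by auto
  next
    case empty show ?case by (simp add: set_lebesgue_integral_def)
  next
    case (compl A)
    have "(\<lambda>x. indicator (UNIV - A) x *\<^sub>R E x) = (\<lambda>x. E x - indicator A x *\<^sub>R E x)"
      by (auto simp: indicator_def)
    moreover have "integrable lborel (\<lambda>x. indicator A x *\<^sub>R E x)"
      using si compl sb unfolding set_integrable_def by auto
    ultimately have "(LINT x:UNIV - A|lborel. E x) = (LINT x|lborel. E x) - (LINT x:A|lborel. E x)"
      using E unfolding set_lebesgue_integral_def by simp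
    then show ?case using compl UNIV by simp
  next
    case (union A)
    have "(LINT x:(\<Union>i. A i)|lborel. E x) = (\<Sum>i. (LINT x:A i|lborel. E x))"
      using union sb by (intro lebesgue_integral_countable_add si) (auto simp: disjoint_family_on_def intro!: sets.countable_UN)
    then show ?case using union by simp
  qed
qed

text \<open>\<open>D\<close> is not integrable in general, but \<open>D\<close> times the Gaussian is; it is still orthogonal to
  the Schwartz space and has the same zeros.\<close>

lemma AE_zero_if_orthogonal_to_schwartz:
  fixes D :: "real^'n::finite \<Rightarrow> complex"
  assumes D: "\<And>\<phi>. \<phi> \<in> schwartz \<Longrightarrow> integrable lborel (\<lambda>x. D x * \<phi> x)"
    and orth: "\<And>\<phi>. \<phi> \<in> schwartz \<Longrightarrow> (LINT x|lborel. D x * \<phi> x) = 0"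
  shows "AE x in lborel. D x = 0"
proof -
  define E where "E x = D x * gaussian x" for x
  have E: "integrable lborel E" unfolding E_def by (intro D schwartz_gaussian)
  have orthE: "(LINT x|lborel. E x * \<phi> x) = 0" if "\<phi> \<in> schwartz" for \<phi>
    using orth[OF schwartz_mult[OF schwartz_gaussian that]] by (simp add: E_def mult_ac)
  have "(LINT x|lborel. E x) = 0" unfolding E_def by (intro orth schwartz_gaussian)
  with E orthE have "AE x in lborel. E x = 0"
    by (intro AE_zero_if_set_integral_box_0 set_integral_box_eq_0)
  then show ?thesis
    by eventually_elim (simp add: E_def gaussian_def)
qed

lemma represents_unique:
  assumes "represents g u" "represents h u"
  shows "AE x in lborel. g x = h x"
proof -
  have i: "integrable lborel (\<lambda>x. g x * \<phi> x)" "integrable lborel (\<lambda>x. h x * \<phi> x)"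
    "(LINT x|lborel. g x * \<phi> x) = (LINT x|lborel. h x * \<phi> x)" if "\<phi> \<in> schwartz" for \<phi>
    using assms that unfolding represents_def by auto
  have "AE x in lborel. g x - h x = 0"
    by (rule AE_zero_if_orthogonal_to_schwartz) (use i in \<open>simp_all add: left_diff_distrib\<close>)
  then show ?thesis by simp
qed

lemma Lp_norm_cong_AE:
  assumes "g \<in> borel_measurable lborel" "h \<in> borel_measurable lborel" "AE x in lborel. g x = h x"
  shows "Lp_norm p g = Lp_norm p h"
proof -
  have "esssup lborel (\<lambda>x. ennreal (norm (g x))) = esssup lborel (\<lambda>x. ennreal (norm (h x)))"
    using assms by (intro esssup_AE_cong) auto
  moreover have "(\<integral>\<^sup>+x. ennreal (norm (g x) powr enn2real p) \<partial>lborel) = (\<integral>\<^sup>+x. ennreal (norm (h x) powr enn2real p) \<partial>lborel)"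
    using assms(3) by (intro nn_integral_cong_AE) auto
  ultimately show ?thesis unfolding Lp_norm_def by simp
qed

text \<open>Any representing function computes the norm of the distribution, by uniqueness.\<close>

lemma Lp_norm_distr_eq:
  assumes "represents g u"
  shows "Lp_norm_distr p u = Lp_norm p g"
proof -
  have "Lp_norm p h = Lp_norm p g" if "represents h u" for h
    by (intro Lp_norm_cong_AE represents_unique[OF that assms]) (use that assms in \<open>auto simp: represents_def\<close>)
  note eq = this
  show ?thesis unfolding Lp_norm_distr_def
  proof (rule antisym)
    show "(INF g\<in>{g. represents g u}. Lp_norm p g) \<le> Lp_norm p g"
      by (rule INF_lower) (simp add: assms)
    show "Lp_norm p g \<le> (INF g\<in>{g. represents g u}. Lp_norm p g)"
      by (rule INF_greatest) (simp add: eq)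
  qed
qed

lemma Lp_norm_distr_finite:
  assumes "Lp_norm_distr p u < top"
  shows "\<exists>g. represents g u \<and> Lp_norm p g = Lp_norm_distr p u"
proof -
  obtain g where g: "represents g u" using assms unfolding Lp_norm_distr_def INF_less_iff by auto
  show ?thesis using g Lp_norm_distr_eq[OF g, of p] by (intro exI[of _ g]) simp
qed

section \<open>Tempered distributions\<close>

lemma tempered_add:
  assumes "u \<in> tempered" "\<phi> \<in> schwartz" "\<psi> \<in> schwartz"
  shows "u (\<lambda>x. \<phi> x + \<psi> x) = u \<phi> + u \<psi>"
proof -
  have "\<forall>\<phi>\<in>schwartz. \<forall>\<psi>\<in>schwartz. u (\<lambda>x. \<phi> x + \<psi> x) = u \<phi> + u \<psi>"
    using assms(1) unfolding tempered_def mem_Collect_eq by (elim conjE)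
  from bspec[OF bspec[OF this assms(2)] assms(3)] show ?thesis .
qed

lemma tempered_cmult:
  assumes "u \<in> tempered" "\<phi> \<in> schwartz"
  shows "u (\<lambda>x. a * \<phi> x) = a * u \<phi>"
proof -
  have "\<forall>\<phi>\<in>schwartz. \<forall>a. u (\<lambda>x. a * \<phi> x) = a * u \<phi>"
    using assms(1) unfolding tempered_def mem_Collect_eq by (elim conjE)
  from spec[OF bspec[OF this assms(2)]] show ?thesis .
qed

lemma tempered_zero: "u \<in> tempered \<Longrightarrow> u (\<lambda>x. 0) = 0"
  using tempered_cmult[OF _ schwartz_zero, of u 0] by simp

lemma tempered_sum:
  assumes "u \<in> tempered" "\<And>j. j \<in> J \<Longrightarrow> f j \<in> schwartz"
  shows "u (\<lambda>x. \<Sum>j\<in>J. f j x) = (\<Sum>j\<in>J. u (f j))"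
  using assms(2)
proof (induction J rule: infinite_finite_induct)
  case (insert j J)
  have "u (\<lambda>x. f j x + (\<Sum>j\<in>J. f j x)) = u (f j) + u (\<lambda>x. \<Sum>j\<in>J. f j x)"
    using insert.prems by (intro tempered_add assms(1) schwartz_sum) auto
  then show ?case using insert by simp
qed (use tempered_zero[OF assms(1)] in simp_all)

lemma seminorm_bdd:
  "f \<in> schwartz \<Longrightarrow> bdd_above (range (\<lambda>x. (1 + norm x) ^ m * norm (partials is f x)))"
  by (simp add: schwartz_def)

lemma seminorm_ge: "f \<in> schwartz \<Longrightarrow> (1 + norm x) ^ m * norm (partials is f x) \<le> schwartz_seminorm m is f"
  unfolding schwartz_seminorm_def by (rule cSUP_upper[OF UNIV_I seminorm_bdd])

lemma seminorm_le: "(\<And>x. (1 + norm x) ^ m * norm (partials is f x) \<le> C) \<Longrightarrow> schwartz_seminorm m is f \<le> C"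
  unfolding schwartz_seminorm_def by (rule cSUP_least) auto

lemma seminorm_add:
  assumes "f \<in> schwartz" "g \<in> schwartz"
  shows "schwartz_seminorm m is (\<lambda>x. f x + g x) \<le> schwartz_seminorm m is f + schwartz_seminorm m is g"
proof (rule seminorm_le)
  fix x
  have "(1 + norm x) ^ m * norm (partials is (\<lambda>x. f x + g x) x)
      \<le> (1 + norm x) ^ m * (norm (partials is f x) + norm (partials is g x))"
    unfolding partials_add[OF schwartz_smooth[OF assms(1)] schwartz_smooth[OF assms(2)]]
    by (intro mult_left_mono norm_triangle_ineq) auto
  also have "\<dots> \<le> schwartz_seminorm m is f + schwartz_seminorm m is g"
    unfolding distrib_left by (intro add_mono seminorm_ge assms)
  finally show "(1 + norm x) ^ m * norm (partials is (\<lambda>x. f x + g x) x) \<le> \<dots>" .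
qed

text \<open>The seminorms tending to zero give convergence to zero in the generated topology; it is enough to
  check subbasic sets, by induction on the generation of open sets.\<close>

lemma tempered_null_sequence:
  fixes u :: "'n::finite functional"
  assumes u: "u \<in> tempered" and G: "\<And>N::nat. G N \<in> schwartz"
    and lim: "\<And>m is. (\<lambda>N. schwartz_seminorm m is (G N)) \<longlonglongrightarrow> 0"
  shows "(\<lambda>N. u (G N)) \<longlonglongrightarrow> 0"
proof -
  let ?S = "{{\<phi> \<in> schwartz. schwartz_seminorm m is (\<lambda>x. \<phi> x - \<psi> x) < \<epsilon>} | m is (\<psi> :: real^'n \<Rightarrow> complex) \<epsilon>. \<psi> \<in> schwartz \<and> \<epsilon> > 0}"
  have "limitin schwartz_topology G (\<lambda>x. 0) sequentially"
    unfolding limitin_def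
  proof (intro conjI allI impI)
    have "schwartz_seminorm 0 [] (\<lambda>x::real^'n. 0 - 0) \<le> 0" by (rule seminorm_le) simp
    then have "(\<lambda>x::real^'n. 0) \<in> {\<phi> \<in> schwartz. schwartz_seminorm 0 [] (\<lambda>x. \<phi> x - 0) < 1}"
      using schwartz_zero by simp
    moreover have "{\<phi> \<in> schwartz. schwartz_seminorm 0 [] (\<lambda>x::real^'n. \<phi> x - (\<lambda>x. 0) x) < 1} \<in> ?S"
      by (intro CollectI exI[of _ 0] exI[of _ "[]"] exI[of _ "\<lambda>x. 0"] exI[of _ "1::real"] conjI refl schwartz_zero zero_less_one)
    ultimately show "(\<lambda>x::real^'n. 0) \<in> topspace schwartz_topology"
      unfolding schwartz_topology_def topology_generated_by_topspace by (rule UnionI[rotated])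
    fix U :: "(real^'n \<Rightarrow> complex) set"
    assume "openin schwartz_topology U \<and> (\<lambda>x. 0) \<in> U"
    then have "generate_topology_on ?S U" "(\<lambda>x. 0) \<in> U"
      unfolding schwartz_topology_def openin_topology_generated_by_iff by auto
    then show "\<forall>\<^sub>F N in sequentially. G N \<in> U"
    proof (induction rule: generate_topology_on.induct)
      case Empty then show ?case by simp
    next
      case (Int A B)
      then have "\<forall>\<^sub>F N in sequentially. G N \<in> A" "\<forall>\<^sub>F N in sequentially. G N \<in> B" by simp_all
      then show ?case by eventually_elim (rule IntI)
    next
      case (UN K)
      then obtain A where A: "A \<in> K" "(\<lambda>x. 0) \<in> A" by (elim UnionE)
      from UN.IH[OF this] show ?case by eventually_elim (rule UnionI[OF A(1)])
    next
      case (Basis s)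
      then obtain m "is" \<psi> \<epsilon> where s: "s = {\<phi> \<in> schwartz. schwartz_seminorm m is (\<lambda>x. \<phi> x - \<psi> x) < \<epsilon>}"
        and \<psi>: "\<psi> \<in> schwartz" and \<epsilon>: "\<epsilon> > 0"
        by (elim CollectE exE conjE)
      have 0: "schwartz_seminorm m is (\<lambda>x. 0 - \<psi> x) < \<epsilon>" using Basis.prems s by simp
      have "\<forall>\<^sub>F N in sequentially. schwartz_seminorm m is (G N) < \<epsilon> - schwartz_seminorm m is (\<lambda>x. 0 - \<psi> x)"
        using order_tendstoD(2)[OF lim[of m "is"]] 0 by simp
      then show ?case
      proof eventually_elim
        case (elim N)
        have "schwartz_seminorm m is (\<lambda>x. G N x + (0 - \<psi> x)) \<le> schwartz_seminorm m is (G N) + schwartz_seminorm m is (\<lambda>x. 0 - \<psi> x)"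
          by (intro seminorm_add G schwartz_diff schwartz_zero \<psi>)
        with elim show ?case unfolding s using G by simp
      qed
    qed
  qed
  moreover have "continuous_map schwartz_topology euclidean u" using u unfolding tempered_def mem_Collect_eq by (elim conjE)
  ultimately have "limitin euclidean (u \<circ> G) (u (\<lambda>x. 0)) sequentially"
    by (rule continuous_map_limit[rotated])
  then show ?thesis by (simp add: tempered_zero[OF u] o_def)
qed

text \<open>The pairing with \<open>f\<close> is Lipschitz for the sup norm, which is one of the seminorms, with the \<open>L^1\<close> norm of \<open>f\<close>
  as constant.\<close>

lemma tempered_of_schwartz:
  fixes f :: "real^'n::finite \<Rightarrow> complex"
  assumes f: "f \<in> schwartz"
  defines "u \<equiv> (\<lambda>\<phi>\<in>schwartz. LINT x|lborel. f x * \<phi> x)"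
  shows "u \<in> tempered" "represents f u"
proof -
  have i: "integrable lborel (\<lambda>x. f x * \<phi> x)" if "\<phi> \<in> schwartz" for \<phi>
    by (intro schwartz_integrable schwartz_mult f that)
  have u: "u \<phi> = (LINT x|lborel. f x * \<phi> x)" if "\<phi> \<in> schwartz" for \<phi>
    using that unfolding u_def by simp
  show "represents f u"
    unfolding represents_def using schwartz_measurable[OF f] i u by simp
  \<comment> \<open>The summand \<open>1\<close> makes the constant positive also for \<open>f = 0\<close>.\<close>
  define A where "A = (LINT x|lborel. norm (f x)) + 1"
  have A: "A > 0" unfolding A_def by (intro add_nonneg_pos Bochner_Integration.integral_nonneg) auto
  have est: "norm (u \<phi> - u \<psi>) \<le> A * schwartz_seminorm 0 [] (\<lambda>x. \<phi> x - \<psi> x)"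
    if s: "\<phi> \<in> schwartz" "\<psi> \<in> schwartz" for \<phi> \<psi>
  proof -
    let ?s = "schwartz_seminorm 0 [] (\<lambda>x. \<phi> x - \<psi> x)"
    have d: "(\<lambda>x. \<phi> x - \<psi> x) \<in> schwartz" by (intro schwartz_diff s)
    have s0: "0 \<le> ?s" using order_trans[OF _ seminorm_ge[OF d, of 0 0 "[]"]] by simp
    have "u \<phi> - u \<psi> = (LINT x|lborel. f x * (\<phi> x - \<psi> x))"
      unfolding u[OF s(1)] u[OF s(2)] right_diff_distrib using i[OF s(1)] i[OF s(2)] by simp
    also have "norm \<dots> \<le> (LINT x|lborel. norm (f x) * ?s)"
    proof (rule order_trans[OF integral_norm_bound], rule integral_mono)
      show "integrable lborel (\<lambda>x. norm (f x) * ?s)" by (intro integrable_mult_left integrable_norm schwartz_integrable f)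
      show "norm (f x * (\<phi> x - \<psi> x)) \<le> norm (f x) * ?s" for x
        unfolding norm_mult using seminorm_ge[OF d, of x 0 "[]"] by (intro mult_left_mono) auto
    qed (intro integrable_norm i d)
    also have "\<dots> \<le> A * ?s" unfolding A_def using s0 by (simp add: mult_right_mono distrib_right)
    finally show ?thesis .
  qed
  have "continuous_map schwartz_topology euclidean u"
    unfolding continuous_map_def
  proof (intro conjI allI impI)
    show "u \<in> topspace schwartz_topology \<rightarrow> topspace euclidean" by simp
    fix V :: "complex set" assume V: "openin euclidean V"
    show "openin schwartz_topology {x \<in> topspace schwartz_topology. u x \<in> V}"
    proof (subst openin_subopen, intro ballI)
      fix \<phi> assume \<phi>: "\<phi> \<in> {x \<in> topspace schwartz_topology. u x \<in> V}"
      then have \<phi>s: "\<phi> \<in> schwartz" "u \<phi> \<in> V"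
        unfolding schwartz_topology_def topology_generated_by_topspace by auto
      then obtain e where e: "e > 0" "ball (u \<phi>) e \<subseteq> V" using V by (auto simp: open_contains_ball)
      let ?T = "{\<psi> \<in> schwartz. schwartz_seminorm 0 [] (\<lambda>x. \<psi> x - \<phi> x) < e / A}"
      have T: "openin schwartz_topology ?T"
        unfolding schwartz_topology_def
        by (rule topology_generated_by_Basis) (use \<phi>s e A in \<open>auto intro!: exI[of _ 0] exI[of _ "[]"] exI[of _ \<phi>] exI[of _ "e / A"]\<close>)
      have "schwartz_seminorm 0 [] (\<lambda>x. \<phi> x - \<phi> x) \<le> 0" by (rule seminorm_le) simp
      then have "schwartz_seminorm 0 [] (\<lambda>x. \<phi> x - \<phi> x) < e / A"
        using divide_pos_pos[OF e(1) A] by (rule order.strict_trans1)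
      then have "\<phi> \<in> ?T" using \<phi>s by simp
      moreover have "u \<psi> \<in> V" if "\<psi> \<in> ?T" for \<psi>
      proof -
        have "norm (u \<psi> - u \<phi>) \<le> A * schwartz_seminorm 0 [] (\<lambda>x. \<psi> x - \<phi> x)" using that \<phi>s est by simp
        also have "\<dots> < A * (e / A)" using that A by (intro mult_strict_left_mono) auto
        finally have "u \<psi> \<in> ball (u \<phi>) e" using A by (simp add: dist_norm norm_minus_commute)
        then show ?thesis using e by blast
      qed
      ultimately show "\<exists>T. openin schwartz_topology T \<and> \<phi> \<in> T \<and> T \<subseteq> {x \<in> topspace schwartz_topology. u x \<in> V}"
        using T openin_subset[OF T] by (intro exI[of _ ?T]) auto
    qed
  qed
  moreover have "u \<in> extensional schwartz" unfolding u_def by (rule restrict_extensional)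
  moreover have "u (\<lambda>x. \<phi> x + \<psi> x) = u \<phi> + u \<psi>" if "\<phi> \<in> schwartz" "\<psi> \<in> schwartz" for \<phi> \<psi>
    using u[OF schwartz_add[OF that]] u[OF that(1)] u[OF that(2)] i[OF that(1)] i[OF that(2)]
    by (simp add: distrib_left)
  moreover have "u (\<lambda>x. a * \<phi> x) = a * u \<phi>" if "\<phi> \<in> schwartz" for a \<phi>
    using u[OF schwartz_cmult[OF that]] u[OF that] by (simp add: mult.left_commute)
  ultimately show "u \<in> tempered" unfolding tempered_def mem_Collect_eq by (intro conjI ballI allI)
qed

lemma box_apply:
  assumes "\<eta> k \<in> schwartz" "\<phi> \<in> schwartz"
  shows "Defs.box \<eta> k u \<phi> = u (fourier (\<lambda>\<xi>. \<eta> k \<xi> * inv_fourier \<phi> \<xi>))"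
  using assms unfolding box_def inv_fourier_distr_def mult_distr_def fourier_distr_def
  by (simp add: schwartz_inv_fourier schwartz_mult)

section \<open>The lattice and the covering\<close>

lemma lattice_vec_diff: "lattice_vec (j - k) = lattice_vec j - lattice_vec k"
  and lattice_vec_0 [simp]: "lattice_vec 0 = 0"
  by (simp_all add: lattice_vec_def vec_eq_iff)

lemma japanese_ge_1: "1 \<le> japanese k"
  unfolding japanese_def by simp

lemma japanese_pos: "0 < japanese k"
  using japanese_ge_1[of k] by simp

lemma norm_lattice_vec_le: "norm (lattice_vec k) \<le> japanese k"
  unfolding japanese_def by (rule real_le_rsqrt) simp

lemma japanese_le: "japanese k \<le> 1 + norm (lattice_vec k)"
  unfolding japanese_def by (rule real_le_lsqrt) (auto simp: power2_sum)

text \<open>The Peetre inequality: the weights at two lattice points are comparable in terms of their difference.\<close>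

lemma japanese_peetre: "japanese j \<le> 4 * japanese k * japanese (j - k)"
proof -
  have "lattice_vec j = lattice_vec k + lattice_vec (j - k)" by (simp add: lattice_vec_diff)
  then have "japanese j \<le> 1 + (norm (lattice_vec k) + norm (lattice_vec (j - k)))"
    using japanese_le[of j] norm_triangle_ineq[of "lattice_vec k" "lattice_vec (j - k)"] by simp
  also have "\<dots> \<le> (1 + norm (lattice_vec k)) * (1 + norm (lattice_vec (j - k)))"
    by (simp add: algebra_simps)
  also have "\<dots> \<le> (2 * japanese k) * (2 * japanese (j - k))"
  proof (intro mult_mono)
    show "1 + norm (lattice_vec k) \<le> 2 * japanese k" using norm_lattice_vec_le[of k] japanese_ge_1[of k] by simp
    show "1 + norm (lattice_vec (j - k)) \<le> 2 * japanese (j - k)"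
      using norm_lattice_vec_le[of "j - k"] japanese_ge_1[of "j - k"] by simp
    show "0 \<le> 2 * japanese k" using japanese_pos[of k] by simp
  qed simp
  finally show ?thesis by simp
qed

lemma finite_lattice_ball: "finite {k :: int^'n::finite. norm (lattice_vec k) \<le> R}"
proof (rule finite_subset)
  let ?M = "\<lceil>R\<rceil>"
  show "{k :: int^'n. norm (lattice_vec k) \<le> R} \<subseteq> vec_lambda ` (UNIV \<rightarrow>\<^sub>E {- ?M..?M})"
  proof
    fix k :: "int^'n" assume "k \<in> {k. norm (lattice_vec k) \<le> R}"
    then have "\<bar>real_of_int (k $ i)\<bar> \<le> R" for i
      using component_le_norm_cart[of "lattice_vec k" i] by (simp add: lattice_vec_def)
    then have "\<bar>real_of_int (k $ i)\<bar> \<le> real_of_int ?M" for i using le_of_int_ceiling[of R] by (rule order_trans)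
    then have M: "\<bar>k $ i\<bar> \<le> ?M" for i unfolding of_int_abs[symmetric] of_int_le_iff .
    have "vec_nth k \<in> UNIV \<rightarrow>\<^sub>E {- ?M..?M}" using M by (auto simp: abs_le_iff minus_le_iff)
    then show "k \<in> vec_lambda ` (UNIV \<rightarrow>\<^sub>E {- ?M..?M})" by (rule rev_image_eqI) (simp add: vec_eq_iff)
  qed
  show "finite (vec_lambda ` (UNIV \<rightarrow>\<^sub>E {- ?M..?M}) :: (int^'n) set)" by (intro finite_imageI finite_PiE) auto
qed

text \<open>A partition of unity subordinate to the \<open>\<alpha>\<close>-covering, with a fixed constant \<open>C\<close> for its supports.\<close>

locale alpha_decomposition =
  fixes \<alpha> :: real and \<eta> :: "int^'n::finite \<Rightarrow> real^'n \<Rightarrow> complex" and C :: real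
  assumes \<alpha>0: "0 \<le> \<alpha>" and \<alpha>1: "\<alpha> < 1"
    and \<eta>_schwartz: "\<And>k. \<eta> k \<in> schwartz"
    and C_pos: "C > 0"
    and \<eta>_support: "\<And>k. closure {\<xi>. \<eta> k \<xi> \<noteq> 0} \<subseteq>
        {\<xi>. norm (\<xi> - japanese k powr (\<alpha> / (1 - \<alpha>)) *\<^sub>R lattice_vec k) < C * japanese k powr (\<alpha> / (1 - \<alpha>))}"
    and \<eta>_sum: "\<And>\<xi>. ((\<lambda>k. \<eta> k \<xi>) has_sum 1) UNIV"
    and \<eta>_partials: "\<And>is. \<exists>D. \<forall>\<xi> k. norm (partials is (\<eta> k) \<xi>)
        \<le> D * japanese k powr (- (\<alpha> * real (length is) / (1 - \<alpha>)))"
begin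

definition radius :: "int^'n \<Rightarrow> real" where "radius k = japanese k powr (\<alpha> / (1 - \<alpha>))"
definition center :: "int^'n \<Rightarrow> real^'n" where "center k = radius k *\<^sub>R lattice_vec k"

lemma exponent_nonneg: "0 \<le> \<alpha> / (1 - \<alpha>)" using \<alpha>0 \<alpha>1 by simp

lemma radius_ge_1: "1 \<le> radius k"
  unfolding radius_def by (rule ge_one_powr_ge_zero[OF japanese_ge_1 exponent_nonneg])

lemma radius_pos: "0 < radius k" using radius_ge_1[of k] by simp

lemma radius_mono: "norm (lattice_vec j) \<le> norm (lattice_vec k) \<Longrightarrow> radius j \<le> radius k"
  unfolding radius_def japanese_def
  by (intro powr_mono2 exponent_nonneg real_sqrt_le_mono) (auto intro: power_mono)

text \<open>The radius is a nondecreasing function of \<open>\<bar>k\<bar>\<close>, so \<open>k \<mapsto> r_k k\<close> is a monotone map. Writing \<open>a\<close>, \<open>b\<close> for the lattice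
  points and \<open>A\<close>, \<open>B\<close> for the radii, \<open>(A a - B b) \<bullet> (a - b)\<close> equals
  \<open>(A + B)/2 \<bar>a - b\<bar>^2 + (A - B)(\<bar>a\<bar>^2 - \<bar>b\<bar>^2)/2\<close>, and the last summand is nonnegative.\<close>

lemma center_separation: "(radius j + radius k) / 2 * norm (lattice_vec (j - k)) \<le> norm (center j - center k)"
proof (cases "lattice_vec (j - k) = 0")
  case False
  define a b where "a = lattice_vec j" and "b = lattice_vec k"
  define A B where "A = radius j" and "B = radius k"
  have "(A - B) * ((norm a)\<^sup>2 - (norm b)\<^sup>2) \<ge> 0"
  proof (cases "norm a \<le> norm b")
    case True
    then have "A - B \<le> 0" "(norm a)\<^sup>2 - (norm b)\<^sup>2 \<le> 0"
      unfolding A_def B_def a_def b_def using radius_mono by (auto intro: power_mono)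
    then show ?thesis by (rule mult_nonpos_nonpos)
  next
    case False
    then have "A - B \<ge> 0" "(norm a)\<^sup>2 - (norm b)\<^sup>2 \<ge> 0"
      unfolding A_def B_def a_def b_def using radius_mono[of k j] by (auto intro: power_mono)
    then show ?thesis by (rule mult_nonneg_nonneg)
  qed
  moreover have "(A *\<^sub>R a - B *\<^sub>R b) \<bullet> (a - b) = (A + B) / 2 * (norm (a - b))\<^sup>2 + (A - B) * ((norm a)\<^sup>2 - (norm b)\<^sup>2) / 2"
    unfolding power2_norm_eq_inner by (simp add: inner_diff_left inner_diff_right inner_commute field_simps)
  ultimately have "(A + B) / 2 * (norm (a - b))\<^sup>2 \<le> (A *\<^sub>R a - B *\<^sub>R b) \<bullet> (a - b)" by simp
  also have "\<dots> \<le> norm (A *\<^sub>R a - B *\<^sub>R b) * norm (a - b)" by (rule norm_cauchy_schwarz)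
  finally have "(A + B) / 2 * norm (a - b) * norm (a - b) \<le> norm (A *\<^sub>R a - B *\<^sub>R b) * norm (a - b)"
    by (simp add: power2_eq_square mult.assoc)
  moreover have "norm (a - b) > 0" using False unfolding a_def b_def lattice_vec_diff by simp
  ultimately have "(A + B) / 2 * norm (a - b) \<le> norm (A *\<^sub>R a - B *\<^sub>R b)" by (rule mult_right_le_imp_le)
  then show ?thesis unfolding A_def B_def a_def b_def center_def lattice_vec_diff .
qed simp

text \<open>Balls enlarged by the same factor meet only if their indices are close; the radii cancel, so the bound is
  the same at every scale.\<close>

lemma overlap:
  assumes "norm (\<xi> - center j) < R * radius j" "norm (\<xi> - center k) < R * radius k"
  shows "norm (lattice_vec (j - k)) < 2 * R"
proof -
  have "(radius j + radius k) / 2 * norm (lattice_vec (j - k)) \<le> norm (center j - center k)"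
    by (rule center_separation)
  also have "\<dots> \<le> norm (\<xi> - center j) + norm (\<xi> - center k)"
    using norm_triangle_ineq4[of "\<xi> - center k" "\<xi> - center j"] by simp
  also have "\<dots> < R * radius j + R * radius k" using assms by (rule add_strict_mono)
  also have "\<dots> = (radius j + radius k) / 2 * (2 * R)" by (simp add: field_simps)
  finally show ?thesis using radius_pos[of j] radius_pos[of k] by (simp add: mult_less_cancel_left_pos)
qed

lemma partials_support:
  assumes "partials is (\<eta> k) \<xi> \<noteq> 0"
  shows "norm (\<xi> - center k) < C * radius k"
proof (rule ccontr)
  assume "\<not> ?thesis"
  then have "\<xi> \<in> - closure {\<xi>. \<eta> k \<xi> \<noteq> 0}"
    using \<eta>_support[of k] unfolding center_def radius_def by auto
  moreover have "\<eta> k y = 0" if "y \<in> - closure {\<xi>. \<eta> k \<xi> \<noteq> 0}" for y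
    using that closure_subset[of "{\<xi>. \<eta> k \<xi> \<noteq> 0}"] by auto
  ultimately have "partials is (\<eta> k) \<xi> = partials is (\<lambda>x. 0) \<xi>"
    by (intro partials_cong_open[OF open_Compl[OF closed_closure]])
  then show False using assms by (simp add: partials_const)
qed

lemma support: "\<eta> k \<xi> \<noteq> 0 \<Longrightarrow> norm (\<xi> - center k) < C * radius k"
  using partials_support[of "[]"] by simp

text \<open>Since all radii are at least one, a piece that lives near a frequency of size \<open>\<bar>\<xi>\<bar>\<close> has an index of
  size less than \<open>\<bar>\<xi>\<bar> + C\<close>. In particular only finitely many pieces live on a bounded set.\<close>

lemma support_norm:
  assumes "\<eta> k \<xi> \<noteq> 0"
  shows "norm (lattice_vec k) < norm \<xi> + C"
proof -
  have "radius k * norm (lattice_vec k) = norm (center k)"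
    unfolding center_def using radius_pos[of k] by simp
  also have "\<dots> \<le> norm \<xi> + norm (\<xi> - center k)"
    using norm_triangle_ineq4[of \<xi> "\<xi> - center k"] by simp
  also have "\<dots> < radius k * norm \<xi> + C * radius k"
    using support[OF assms] radius_ge_1[of k] mult_right_mono[of 1 "radius k" "norm \<xi>"] by simp
  finally have "radius k * norm (lattice_vec k) < radius k * (norm \<xi> + C)" by (simp add: algebra_simps)
  then show ?thesis using radius_pos by (simp add: mult_less_cancel_left_pos)
qed

definition lattice_ball :: "real \<Rightarrow> (int^'n) set" where
  "lattice_ball R = {k. norm (lattice_vec k) \<le> R}"

lemma finite_ball: "finite (lattice_ball R)"
  unfolding lattice_ball_def by (rule finite_lattice_ball)

lemma partial_sum_eq_1:
  assumes "norm \<xi> \<le> R - C"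
  shows "(\<Sum>k\<in>lattice_ball R. \<eta> k \<xi>) = 1"
proof -
  have "\<eta> k \<xi> = 0" if "k \<in> UNIV - lattice_ball R" for k
    using support_norm[of k \<xi>] that assms unfolding lattice_ball_def by auto
  then have "((\<lambda>k. \<eta> k \<xi>) has_sum 1) (lattice_ball R)"
    using \<eta>_sum[of \<xi>] has_sum_cong_neutral[of "lattice_ball R" UNIV "\<lambda>k. \<eta> k \<xi>" "\<lambda>k. \<eta> k \<xi>" 1] by simp
  then show ?thesis using has_sum_finite[OF finite_ball, of "\<lambda>k. \<eta> k \<xi>" R] by (rule has_sum_unique[symmetric])
qed

text \<open>The partition itself supplies compactly supported functions that are one on a given ball: add up all members
  that meet it.\<close>

lemma bump_exists:
  "\<exists>J\<in>(schwartz :: (real^'n \<Rightarrow> complex) set). \<exists>R'>0. (\<forall>\<xi>. norm \<xi> \<le> R \<longrightarrow> J \<xi> = 1) \<and> (\<forall>\<xi>. J \<xi> \<noteq> 0 \<longrightarrow> norm \<xi> < R')"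
proof -
  define F where "F = lattice_ball (R + C)"
  define R' where "R' = 1 + (\<Sum>k\<in>F. norm (center k) + C * radius k)"
  have nn: "0 \<le> norm (center k) + C * radius k" for k using C_pos radius_pos[of k] by (simp add: add_nonneg_nonneg)
  have R: "R' > 0" unfolding R'_def by (intro add_pos_nonneg sum_nonneg nn) auto
  have s: "(\<lambda>\<xi>. \<Sum>k\<in>F. \<eta> k \<xi>) \<in> schwartz" by (intro schwartz_sum \<eta>_schwartz)
  have one: "\<forall>\<xi>. norm \<xi> \<le> R \<longrightarrow> (\<Sum>k\<in>F. \<eta> k \<xi>) = 1"
    unfolding F_def by (auto intro: partial_sum_eq_1)
  have supp: "\<forall>\<xi>. (\<Sum>k\<in>F. \<eta> k \<xi>) \<noteq> 0 \<longrightarrow> norm \<xi> < R'"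
  proof (intro allI impI)
    fix \<xi> assume "(\<Sum>k\<in>F. \<eta> k \<xi>) \<noteq> 0"
    then obtain k where k: "k \<in> F" "\<eta> k \<xi> \<noteq> 0" by (rule sum.not_neutral_contains_not_neutral)
    have "norm \<xi> \<le> norm (center k) + norm (\<xi> - center k)" by (rule norm_triangle_sub)
    also have "\<dots> \<le> norm (center k) + C * radius k" using support[OF k(2)] by simp
    also have "\<dots> \<le> (\<Sum>k\<in>F. norm (center k) + C * radius k)"
      using nn k(1) finite_ball unfolding F_def by (intro member_le_sum) auto
    finally show "norm \<xi> < R'" unfolding R'_def by simp
  qed
  show ?thesis
    by (rule rev_bexI[OF s]) (use R one supp in auto)
qed

lemma card_overlap: "card {k \<in> F. norm (\<xi> - center k) < C * radius k} \<le> card {d :: int^'n. norm (lattice_vec d) \<le> 2 * C}"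
proof (cases "{k \<in> F. norm (\<xi> - center k) < C * radius k} = {}")
  case False
  then obtain k0 where k0: "norm (\<xi> - center k0) < C * radius k0" by auto
  have "(\<lambda>k. k - k0) ` {k \<in> F. norm (\<xi> - center k) < C * radius k} \<subseteq> {d. norm (lattice_vec d) \<le> 2 * C}"
    using overlap[OF _ k0] by (auto intro: less_imp_le)
  moreover have "inj_on (\<lambda>k. k - k0) {k \<in> F. norm (\<xi> - center k) < C * radius k}" by (simp add: inj_on_def)
  ultimately show ?thesis by (intro card_inj_on_le[OF _ _ finite_lattice_ball])
next
  case True show ?thesis unfolding True by simp
qed

text \<open>The tail of the partition beyond \<open>N\<close> vanishes on the ball of radius \<open>N - C\<close>, so off that ball the factor \<open>N\<close> is at most
  a constant times \<open>1 + \<bar>\<xi>\<bar>\<close>. The derivatives of the tail are bounded because at each point at most a fixed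
  number of members are nonzero. Hence the tail is, as a multiplier, of size \<open>1/N\<close>.\<close>

lemma moderate_tail:
  "moderate (UNIV :: nat set) (\<lambda>N \<xi>. of_nat N * (1 - (\<Sum>k\<in>lattice_ball (real N). \<eta> k \<xi>)))"
  unfolding moderate_def
proof (intro conjI allI ballI)
  define T where "T N \<xi> = 1 + (- 1) * (\<Sum>k\<in>lattice_ball (real N). \<eta> k \<xi>)" for N \<xi>
  have sS: "smooth (\<lambda>\<xi>. \<Sum>k\<in>J. \<eta> k \<xi>)" for J by (intro smooth_sum schwartz_smooth \<eta>_schwartz)
  have sT: "smooth (T N)" for N unfolding T_def by (intro smooth_add smooth_mult smooth_const sS)
  have eq: "(\<lambda>\<xi>. of_nat N * (1 - (\<Sum>k\<in>lattice_ball (real N). \<eta> k \<xi>))) = (\<lambda>\<xi>. of_nat N * T N \<xi>)" for N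
    unfolding T_def by simp
  show "smooth (\<lambda>\<xi>. of_nat N * (1 - (\<Sum>k\<in>lattice_ball (real N). \<eta> k \<xi>)))" for N
    unfolding eq by (intro smooth_mult smooth_const sT)
  fix "is" :: "'n list"
  obtain D where D: "\<forall>\<xi> k. norm (partials is (\<eta> k) \<xi>) \<le> D * japanese k powr (- (\<alpha> * real (length is) / (1 - \<alpha>)))"
    using \<eta>_partials by blast
  define K where "K = real (card {d :: int^'n. norm (lattice_vec d) \<le> 2 * C})"
  have D1: "norm (partials is (\<eta> k) \<xi>) \<le> \<bar>D\<bar>" for k \<xi>
  proof -
    have "japanese k powr (- (\<alpha> * real (length is) / (1 - \<alpha>))) \<le> 1"
      using powr_mono[of "- (\<alpha> * real (length is) / (1 - \<alpha>))" 0 "japanese k"] japanese_ge_1[of k] \<alpha>0 \<alpha>1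
      by simp
    then have "D * japanese k powr (- (\<alpha> * real (length is) / (1 - \<alpha>))) \<le> \<bar>D\<bar> * 1"
      by (intro mult_mono) auto
    then show ?thesis using D[rule_format, of k \<xi>] by simp
  qed
  have T: "norm (partials is (T N) \<xi>) \<le> 1 + \<bar>D\<bar> * K" for N \<xi>
  proof -
    let ?F = "lattice_ball (real N)" let ?G = "{k \<in> ?F. norm (\<xi> - center k) < C * radius k}"
    have "partials is (T N) \<xi> = (if is = [] then 1 else 0) + (- 1) * (\<Sum>k\<in>?F. partials is (\<eta> k) \<xi>)"
      unfolding T_def
      by (subst partials_add[OF smooth_const smooth_mult[OF smooth_const sS]], subst partials_cmult[OF sS],
          subst partials_sum) (auto simp: partials_const intro!: schwartz_smooth \<eta>_schwartz)
    then have "norm (partials is (T N) \<xi>) \<le> 1 + norm (\<Sum>k\<in>?F. partials is (\<eta> k) \<xi>)"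
      by (auto intro: order_trans[OF norm_triangle_ineq4])
    also have "(\<Sum>k\<in>?F. partials is (\<eta> k) \<xi>) = (\<Sum>k\<in>?G. partials is (\<eta> k) \<xi>)"
      using finite_ball partials_support by (intro sum.mono_neutral_right) auto
    also have "norm \<dots> \<le> (\<Sum>k\<in>?G. \<bar>D\<bar>)" using D1 by (intro sum_norm_le)
    also have "\<dots> = \<bar>D\<bar> * real (card ?G)" by (simp add: mult.commute)
    also have "\<dots> \<le> \<bar>D\<bar> * K"
      unfolding K_def by (intro mult_left_mono of_nat_mono card_overlap) simp
    finally show ?thesis by simp
  qed
  have "norm (partials is (\<lambda>\<xi>. of_nat N * T N \<xi>) \<xi>) \<le> ((1 + C) * (1 + \<bar>D\<bar> * K)) * (1 + norm \<xi>) ^ 1" for N \<xi>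
  proof -
    have e: "partials is (\<lambda>\<xi>. of_nat N * T N \<xi>) \<xi> = of_nat N * partials is (T N) \<xi>"
      by (simp add: partials_cmult[OF sT])
    have K0: "0 \<le> 1 + \<bar>D\<bar> * K" unfolding K_def by simp
    show ?thesis
    proof (cases "norm \<xi> < real N - C")
      case True
      have "partials is (T N) \<xi> = partials is (\<lambda>x. 0) \<xi>"
      proof (rule partials_cong_open[of "ball 0 (real N - C)"])
        show "T N y = 0" if "y \<in> ball 0 (real N - C)" for y
          unfolding T_def using partial_sum_eq_1[of y "real N"] that by simp
      qed (use True in auto)
      then show ?thesis unfolding e using K0 C_pos by (simp add: partials_const)
    next
      case False
      then have "real N \<le> C + norm \<xi>" by simp
      also have "\<dots> \<le> (1 + C) * (1 + norm \<xi>)" using C_pos by (simp add: algebra_simps)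
      finally have "real N * norm (partials is (T N) \<xi>) \<le> ((1 + C) * (1 + norm \<xi>)) * (1 + \<bar>D\<bar> * K)"
        using T C_pos by (intro mult_mono) auto
      then show ?thesis unfolding e by (simp add: norm_mult mult_ac)
    qed
  qed
  then show "\<exists>D m. \<forall>N\<in>UNIV. \<forall>\<xi>. norm (partials is (\<lambda>\<xi>. of_nat N * (1 - (\<Sum>k\<in>lattice_ball (real N). \<eta> k \<xi>))) \<xi>) \<le> D * (1 + norm \<xi>) ^ m"
    unfolding eq by (intro exI[of _ "(1 + C) * (1 + \<bar>D\<bar> * K)"] exI[of _ 1]) blast
qed

text \<open>The error of the \<open>N\<close>-th partial sum is \<open>u\<close> applied to the test function with its frequencies in the tail, and by
  \<open>moderate_tail\<close> this is \<open>1/N\<close> times a bounded family, hence a null sequence in the Schwartz space.\<close>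

theorem decomposition_converges:
  assumes u: "u \<in> tempered" and \<phi>: "\<phi> \<in> schwartz"
  shows "(\<lambda>N. \<Sum>k\<in>lattice_ball (real N). Defs.box \<eta> k u \<phi>) \<longlonglongrightarrow> u \<phi>"
proof -
  define \<psi> where "\<psi> = inv_fourier \<phi>"
  have \<psi>: "\<psi> \<in> schwartz" unfolding \<psi>_def by (rule schwartz_inv_fourier[OF \<phi>])
  define S where "S N \<xi> = (\<Sum>k\<in>lattice_ball (real N). \<eta> k \<xi>)" for N \<xi>
  have S: "S N \<in> schwartz" for N unfolding S_def by (intro schwartz_sum \<eta>_schwartz)
  \<comment> \<open>\<open>W N\<close> is \<open>N\<close> times the tail part of \<open>\<psi>\<close>, and \<open>G N\<close> is the part of \<open>\<phi>\<close> with frequencies in the tail.\<close>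
  define W where "W N \<xi> = (of_nat N * (1 - S N \<xi>)) * \<psi> \<xi>" for N \<xi>
  have W: "schwartz_bounded UNIV (\<lambda>N::nat. fourier (W N))"
    unfolding W_def S_def by (intro schwartz_bounded_fourier schwartz_bounded_mult moderate_tail schwartz_bounded_single \<psi>)
  define G where "G N = fourier (\<lambda>\<xi>. \<psi> \<xi> - S N \<xi> * \<psi> \<xi>)" for N
  have rest: "(\<lambda>\<xi>. \<psi> \<xi> - S N \<xi> * \<psi> \<xi>) \<in> schwartz" for N by (intro schwartz_diff schwartz_mult S \<psi>)
  have G: "G N \<in> schwartz" for N unfolding G_def by (intro schwartz_fourier rest)
  have WG: "fourier (W N) = (\<lambda>x. of_nat N * G N x)" for N
    unfolding G_def fourier_cmult[symmetric] W_def by (simp add: algebra_simps)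
  have lim: "(\<lambda>N. schwartz_seminorm m is (G N)) \<longlonglongrightarrow> 0" for m "is"
  proof -
    obtain D where D: "D > 0" "\<forall>N x. (1 + norm x) ^ m * norm (partials is (fourier (W N)) x) \<le> D"
      using schwartz_bounded_estimate[OF W, of m "is"] by auto
    have le: "schwartz_seminorm m is (G N) \<le> D * (1 / real N)" if "N > 0" for N
    proof (rule seminorm_le)
      fix x
      have "real N * ((1 + norm x) ^ m * norm (partials is (G N) x)) \<le> D"
        using D(2)[rule_format, of x N] unfolding WG partials_cmult[OF schwartz_smooth[OF G]]
        by (simp add: norm_mult mult_ac)
      then show "(1 + norm x) ^ m * norm (partials is (G N) x) \<le> D * (1 / real N)"
        using that by (simp add: field_simps)
    qed
    have nn: "0 \<le> schwartz_seminorm m is (G N)" for N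
      using order_trans[OF _ seminorm_ge[OF G, of 0 m "is"]] by simp
    have up: "(\<lambda>N. D * (1 / real N)) \<longlonglongrightarrow> 0"
      using tendsto_mult_left[OF lim_1_over_n, of D] by simp
    have ev: "\<forall>\<^sub>F N in sequentially. schwartz_seminorm m is (G N) \<le> D * (1 / real N)"
      using eventually_gt_at_top[of 0] by eventually_elim (rule le)
    show ?thesis
      by (rule tendsto_sandwich[OF always_eventually[OF allI[OF nn]] ev tendsto_const up])
  qed
  have "(\<lambda>N. u (G N)) \<longlonglongrightarrow> 0" by (rule tempered_null_sequence[OF u G lim])
  moreover have "(\<Sum>k\<in>lattice_ball (real N). Defs.box \<eta> k u \<phi>) = u \<phi> - u (G N)" for N
  proof -
    let ?F = "lattice_ball (real N)"
    have s: "(\<lambda>\<xi>. \<eta> k \<xi> * \<psi> \<xi>) \<in> schwartz" for k by (intro schwartz_mult \<eta>_schwartz \<psi>)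
    have "(\<Sum>k\<in>?F. Defs.box \<eta> k u \<phi>) = (\<Sum>k\<in>?F. u (fourier (\<lambda>\<xi>. \<eta> k \<xi> * \<psi> \<xi>)))"
      by (intro sum.cong refl) (simp add: box_apply[OF \<eta>_schwartz \<phi>] \<psi>_def)
    also have "\<dots> = u (\<lambda>x. \<Sum>k\<in>?F. fourier (\<lambda>\<xi>. \<eta> k \<xi> * \<psi> \<xi>) x)"
      by (intro tempered_sum[symmetric] u schwartz_fourier s)
    finally have 1: "(\<Sum>k\<in>?F. Defs.box \<eta> k u \<phi>) = u (\<lambda>x. \<Sum>k\<in>?F. fourier (\<lambda>\<xi>. \<eta> k \<xi> * \<psi> \<xi>) x)" .
    have "\<phi> x = (\<Sum>k\<in>?F. fourier (\<lambda>\<xi>. \<eta> k \<xi> * \<psi> \<xi>) x) + G N x" for x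
    proof -
      have "(\<Sum>k\<in>?F. fourier (\<lambda>\<xi>. \<eta> k \<xi> * \<psi> \<xi>) x) = fourier (\<lambda>\<xi>. \<Sum>k\<in>?F. \<eta> k \<xi> * \<psi> \<xi>) x"
        by (intro fourier_sum[symmetric] schwartz_integrable s)
      also have "\<dots> + G N x = fourier (\<lambda>\<xi>. (\<Sum>k\<in>?F. \<eta> k \<xi> * \<psi> \<xi>) + (\<psi> \<xi> - S N \<xi> * \<psi> \<xi>)) x"
        unfolding G_def by (intro fourier_add[symmetric] schwartz_integrable rest schwartz_sum s)
      also have "\<dots> = fourier \<psi> x" unfolding S_def by (simp add: sum_distrib_right)
      finally show ?thesis by (simp add: \<psi>_def fourier_inv_fourier[OF \<phi>])
    qed
    then have "\<phi> = (\<lambda>x. (\<Sum>k\<in>?F. fourier (\<lambda>\<xi>. \<eta> k \<xi> * \<psi> \<xi>) x) + G N x)" ..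
    then have "u \<phi> = u (\<lambda>x. (\<Sum>k\<in>?F. fourier (\<lambda>\<xi>. \<eta> k \<xi> * \<psi> \<xi>) x) + G N x)" by (rule arg_cong)
    also have "\<dots> = u (\<lambda>x. \<Sum>k\<in>?F. fourier (\<lambda>\<xi>. \<eta> k \<xi> * \<psi> \<xi>) x) + u (G N)"
      by (intro tempered_add u schwartz_sum schwartz_fourier s G)
    finally show ?thesis unfolding 1 by simp
  qed
  moreover have "(\<lambda>N. u \<phi> - u (G N)) \<longlonglongrightarrow> u \<phi> - 0"
    by (intro tendsto_diff tendsto_const) fact
  ultimately show ?thesis by simp
qed

end

section \<open>Band-limited functions\<close>

text \<open>Restricting frequencies by \<open>J\<close> is the same as averaging against the reflected kernel \<open>fourier J\<close>.\<close>

lemma fourier_mult_inv_fourier: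
  assumes J: "J \<in> schwartz" and \<phi>: "\<phi> \<in> schwartz"
  shows "fourier (\<lambda>\<xi>. J \<xi> * inv_fourier \<phi> \<xi>) y = (LINT x|lborel. \<phi> x * fourier J (y - x))"
proof -
  have k: "(\<lambda>\<xi>. cis ((- 2 * pi) * (y \<bullet> \<xi>)) * J \<xi>) \<in> schwartz" by (rule schwartz_plane_wave[OF J])
  have "fourier (\<lambda>\<xi>. J \<xi> * inv_fourier \<phi> \<xi>) y = (LINT \<xi>|lborel. inv_fourier \<phi> \<xi> * (cis ((- 2 * pi) * (y \<bullet> \<xi>)) * J \<xi>))"
    unfolding fourier_def by (simp add: mult_ac inner_commute)
  also have "\<dots> = (LINT x|lborel. \<phi> x * inv_fourier (\<lambda>\<xi>. cis ((- 2 * pi) * (y \<bullet> \<xi>)) * J \<xi>) x)"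
    by (rule inv_fourier_multiplication_formula[OF \<phi> k])
  finally have 1: "fourier (\<lambda>\<xi>. J \<xi> * inv_fourier \<phi> \<xi>) y =
    (LINT x|lborel. \<phi> x * inv_fourier (\<lambda>\<xi>. cis ((- 2 * pi) * (y \<bullet> \<xi>)) * J \<xi>) x)" .
  have 2: "inv_fourier (\<lambda>\<xi>. cis ((- 2 * pi) * (y \<bullet> \<xi>)) * J \<xi>) x = fourier J (y - x)" for x
    unfolding inv_fourier_def fourier_def
    by (intro Bochner_Integration.integral_cong refl)
       (simp add: mult_ac cis_mult inner_diff_right inner_commute algebra_simps)
  show ?thesis unfolding 1 2 ..
qed

text \<open>Multiplication by \<open>fourier \<theta>\<close> spreads frequencies by the support of \<open>\<theta>\<close>.\<close>

lemma inv_fourier_mult_fourier: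
  assumes \<theta>: "\<theta> \<in> schwartz" and f: "f \<in> schwartz"
  shows "inv_fourier (\<lambda>x. fourier \<theta> x * f x) \<xi> = (LINT \<zeta>|lborel. \<theta> \<zeta> * inv_fourier f (\<xi> - \<zeta>))"
proof -
  have k: "(\<lambda>x. cis ((2 * pi) * (\<xi> \<bullet> x)) * f x) \<in> schwartz" by (rule schwartz_plane_wave[OF f])
  have "inv_fourier (\<lambda>x. fourier \<theta> x * f x) \<xi> = (LINT x|lborel. fourier \<theta> x * (cis ((2 * pi) * (\<xi> \<bullet> x)) * f x))"
    unfolding inv_fourier_def by (simp add: mult_ac inner_commute)
  also have "\<dots> = (LINT \<zeta>|lborel. \<theta> \<zeta> * fourier (\<lambda>x. cis ((2 * pi) * (\<xi> \<bullet> x)) * f x) \<zeta>)"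
    by (intro fourier_multiplication_formula schwartz_integrable \<theta> k)
  finally have 1: "inv_fourier (\<lambda>x. fourier \<theta> x * f x) \<xi> =
    (LINT \<zeta>|lborel. \<theta> \<zeta> * fourier (\<lambda>x. cis ((2 * pi) * (\<xi> \<bullet> x)) * f x) \<zeta>)" .
  have 2: "fourier (\<lambda>x. cis ((2 * pi) * (\<xi> \<bullet> x)) * f x) \<zeta> = inv_fourier f (\<xi> - \<zeta>)" for \<zeta>
    unfolding inv_fourier_def fourier_def
    by (intro Bochner_Integration.integral_cong refl)
       (simp add: mult_ac cis_mult inner_diff_left inner_commute algebra_simps)
  show ?thesis unfolding 1 2 ..
qed

text \<open>The hypothesis \<open>band\<close> expresses that \<open>J\<close> is one on the spectrum of \<open>G\<close>. By Fubini both sides have the same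
  integrals against Schwartz functions, hence agree almost everywhere.\<close>

lemma reproducing_formula:
  fixes G :: "real^'n::finite \<Rightarrow> complex"
  assumes G: "integrable lborel G" and J: "J \<in> schwartz"
    and band: "\<And>\<phi>. \<phi> \<in> schwartz \<Longrightarrow>
      (LINT x|lborel. G x * \<phi> x) = (LINT x|lborel. G x * fourier (\<lambda>\<xi>. J \<xi> * inv_fourier \<phi> \<xi>) x)"
  shows "AE x in lborel. G x = (LINT y|lborel. G y * fourier J (y - x))"
proof -
  let ?K = "fourier J"
  define A where "A = (LINT x|lborel. norm (J x))"
  have KA: "norm (?K x) \<le> A" for x unfolding A_def by (rule norm_fourier_le)
  have A0: "A \<ge> 0" using order_trans[OF norm_ge_zero KA] .
  note [measurable] = borel_measurable_integrable[OF G] schwartz_measurable[OF schwartz_fourier[OF J]]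
  define H where "H x = (LINT y|lborel. G y * ?K (y - x))" for x
  have Hm: "H \<in> borel_measurable borel" unfolding H_def by measurable
  have main: "integrable lborel (\<lambda>x. H x * \<phi> x) \<and> (LINT x|lborel. H x * \<phi> x) = (LINT x|lborel. G x * \<phi> x)"
    if \<phi>: "\<phi> \<in> schwartz" for \<phi>
  proof -
    note [measurable] = schwartz_measurable[OF \<phi>]
    let ?h = "\<lambda>x y. G y * (\<phi> x * ?K (y - x))"
    have m: "(\<lambda>(x, y). ?h x y) \<in> borel_measurable (lborel \<Otimes>\<^sub>M lborel)" by measurable
    have i1: "integrable lborel (\<lambda>x. A * norm (\<phi> x))"
      by (intro integrable_mult_right integrable_norm schwartz_integrable \<phi>)
    have i2: "integrable lborel (\<lambda>y. norm (G y))" by (intro integrable_norm G)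
    have le: "norm (?h x y) \<le> (A * norm (\<phi> x)) * norm (G y)" for x y
    proof -
      have "norm (?h x y) = norm (?K (y - x)) * (norm (\<phi> x) * norm (G y))" by (simp add: norm_mult)
      also have "\<dots> \<le> A * (norm (\<phi> x) * norm (G y))" by (intro mult_right_mono KA) simp
      finally show ?thesis by (simp only: mult.assoc)
    qed
    note F = Fubini_dominated[OF m i1 i2 le]
    have Hx: "(LINT y|lborel. ?h x y) = H x * \<phi> x" for x
      unfolding H_def integral_mult_left_zero[symmetric] by (simp add: mult_ac)
    have "(LINT x|lborel. G x * \<phi> x) = (LINT y|lborel. G y * fourier (\<lambda>\<xi>. J \<xi> * inv_fourier \<phi> \<xi>) y)"
      by (rule band[OF \<phi>])
    also have "\<dots> = (LINT y|lborel. LINT x|lborel. ?h x y)"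
      unfolding fourier_mult_inv_fourier[OF J \<phi>] integral_mult_right_zero ..
    also have "\<dots> = (LINT x|lborel. LINT y|lborel. ?h x y)" by (rule F(1)[symmetric])
    finally show ?thesis using F(2) unfolding Hx by simp
  qed
  have D: "integrable lborel (\<lambda>x. (G x - H x) * \<phi> x)" "(LINT x|lborel. (G x - H x) * \<phi> x) = 0"
    if \<phi>: "\<phi> \<in> schwartz" for \<phi>
  proof -
    obtain B where B: "B > 0" "\<forall>x. norm (\<phi> x) \<le> B"
      using schwartz_decay[OF \<phi>[unfolded schwartz_iff_bounded], of 0] by auto
    note [measurable] = schwartz_measurable[OF \<phi>]
    have G\<phi>: "integrable lborel (\<lambda>x. G x * \<phi> x)"
    proof (rule Bochner_Integration.integrable_bound[of _ "\<lambda>x. norm (G x) * B"])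
      show "integrable lborel (\<lambda>x. norm (G x) * B)" by (intro integrable_mult_left integrable_norm G)
      show "AE x in lborel. norm (G x * \<phi> x) \<le> norm (norm (G x) * B)"
        using B by (intro AE_I2) (simp add: norm_mult mult_left_mono)
    qed measurable
    show "integrable lborel (\<lambda>x. (G x - H x) * \<phi> x)" "(LINT x|lborel. (G x - H x) * \<phi> x) = 0"
      using main[OF \<phi>] G\<phi> by (simp_all add: left_diff_distrib)
  qed
  have "AE x in lborel. G x - H x = 0" by (rule AE_zero_if_orthogonal_to_schwartz[OF D])
  then show ?thesis unfolding H_def by simp
qed

lemma powr_interpolation_le_1:
  fixes a p M :: real
  assumes "0 < p" "p \<le> 1" "0 \<le> a" "a \<le> M"
  shows "a \<le> M powr (1 - p) * a powr p"
proof (cases "a = 0")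
  case False
  have "a = a powr (1 - p) * a powr p" using False assms by (simp add: powr_add[symmetric])
  also have "\<dots> \<le> M powr (1 - p) * a powr p" using assms by (intro mult_right_mono powr_mono2) auto
  finally show ?thesis .
qed simp

text \<open>A substitute for the Hoelder inequality with a free parameter: where \<open>a\<close> exceeds \<open>l\<close>, the first summand dominates it.\<close>

lemma powr_interpolation_ge_1:
  fixes a p l :: real
  assumes "1 \<le> p" "0 \<le> a" "0 < l"
  shows "a \<le> l powr (1 - p) * a powr p + l"
proof (cases "a \<le> l")
  case True
  have "0 \<le> l powr (1 - p) * a powr p" by simp
  with True show ?thesis by linarith
next
  case False
  have "l powr (1 - p) * l powr (p - 1) = 1" using assms by (simp add: powr_add[symmetric])
  moreover have "l powr (p - 1) \<le> a powr (p - 1)" using False assms by (intro powr_mono2) auto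
  ultimately have "1 \<le> l powr (1 - p) * a powr (p - 1)"
    by (metis mult_left_mono powr_ge_zero)
  then have "a * 1 \<le> a * (l powr (1 - p) * a powr (p - 1))" using assms by (intro mult_left_mono) auto
  also have "\<dots> = l powr (1 - p) * a powr p" using False assms by (simp add: powr_diff)
  finally show ?thesis using assms by simp
qed

text \<open>From the reproducing formula, the essential supremum \<open>M\<close> of \<open>G\<close> is bounded by an average of \<open>\<bar>G\<bar>\<close> against the
  kernel. For \<open>p \<le> 1\<close> insert \<open>\<bar>G\<bar> \<le> M^(1-p) \<bar>G\<bar>^p\<close> and divide by \<open>M^(1-p)\<close>. For \<open>p > 1\<close> insert
  \<open>\<bar>G\<bar> \<le> l^(1-p) \<bar>G\<bar>^p + l\<close> and choose \<open>l\<close> so small that the second summand contributes at most \<open>M/2\<close>,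
  which is absorbed. Both steps need \<open>M\<close> to be finite, and this is where the integrability of \<open>G\<close> enters.\<close>

lemma band_limited_sup_bound:
  fixes G :: "real^'n::finite \<Rightarrow> complex"
  assumes G: "integrable lborel G" and K: "integrable lborel K"
    and rep: "AE x in lborel. G x = (LINT y|lborel. G y * K (y - x))"
    and KA: "\<And>x. norm (K x) \<le> A" and A: "0 < A"
    and K1: "(LINT x|lborel. norm (K x)) \<le> \<kappa>" and \<kappa>: "0 < \<kappa>"
    and p: "0 < p" and I: "(\<integral>\<^sup>+x. ennreal (norm (G x) powr p) \<partial>lborel) \<le> ennreal I" and I0: "0 \<le> I"
  shows "AE x in lborel. norm (G x) powr p \<le> max 1 (2 * (2 * \<kappa>) powr (p - 1)) * A * I"
proof -
  note [measurable] = borel_measurable_integrable[OF G] borel_measurable_integrable[OF K]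
  have iGp: "integrable lborel (\<lambda>x. norm (G x) powr p)"
    using I by (intro integrableI_bounded) (auto intro: order.strict_trans1)
  have Gp: "(LINT x|lborel. norm (G x) powr p) \<le> I"
    using I I0 by (subst integral_eq_nn_integral) (auto intro: enn2real_leI)
  have iGK: "integrable lborel (\<lambda>y. norm (G y * K (y - x)))" for x
  proof (rule Bochner_Integration.integrable_bound[of _ "\<lambda>y. norm (G y) * A"])
    show "integrable lborel (\<lambda>y. norm (G y) * A)" by (intro integrable_mult_left integrable_norm G)
    show "AE y in lborel. norm (norm (G y * K (y - x))) \<le> norm (norm (G y) * A)"
      using KA A by (intro AE_I2) (simp add: norm_mult mult_left_mono)
  qed measurable
  have bound: "AE x in lborel. norm (G x) \<le> (LINT y|lborel. norm (G y * K (y - x)))"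
    using rep by eventually_elim (simp only: integral_norm_bound)
  have bound1: "AE x in lborel. norm (G x) \<le> A * (LINT y|lborel. norm (G y))"
    using bound
  proof eventually_elim
    case (elim x)
    also have "(LINT y|lborel. norm (G y * K (y - x))) \<le> (LINT y|lborel. A * norm (G y))"
    proof (rule integral_mono[OF iGK])
      show "integrable lborel (\<lambda>y. A * norm (G y))" by (intro integrable_mult_right integrable_norm G)
      show "norm (G y * K (y - x)) \<le> A * norm (G y)" for y
        unfolding norm_mult using mult_left_mono[OF KA[of "y - x"] norm_ge_zero[of "G y"]] by (simp only: mult.commute)
    qed
    finally show ?case by simp
  qed
  define M where "M = enn2real (esssup lborel (\<lambda>x. ennreal (norm (G x))))"
  have ess: "esssup lborel (\<lambda>x. ennreal (norm (G x))) \<le> ennreal c" if "AE x in lborel. norm (G x) \<le> c" for c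
  proof (rule esssup_I)
    show "AE x in lborel. ennreal (norm (G x)) \<le> ennreal c"
      using that by eventually_elim (rule ennreal_leI)
  qed measurable
  have fin: "esssup lborel (\<lambda>x. ennreal (norm (G x))) < top"
    using ess[OF bound1] by (rule order.strict_trans1) simp
  have M0: "M \<ge> 0" unfolding M_def by simp
  have GM: "AE x in lborel. norm (G x) \<le> M"
    using esssup_AE[of "\<lambda>x. ennreal (norm (G x))" lborel]
  proof eventually_elim
    case (elim x)
    then show ?case unfolding M_def using enn2real_mono[OF elim fin] by simp
  qed
  have Mle: "M \<le> c" if "AE x in lborel. norm (G x) \<le> c" "0 \<le> c" for c
    unfolding M_def using ess[OF that(1)] that(2) by (rule enn2real_leI[rotated])
  have "M powr p \<le> max 1 (2 * (2 * \<kappa>) powr (p - 1)) * A * I"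
  proof (cases "M = 0")
    case True
    have "0 \<le> max 1 (2 * (2 * \<kappa>) powr (p - 1)) * A * I" using A I0 by (intro mult_nonneg_nonneg) auto
    then show ?thesis using True p by simp
  next
    case False
    then have Mpos: "M > 0" using M0 by simp
    have combine: "M powr p = M powr (p - 1) * M" using Mpos by (simp add: powr_diff)
    show ?thesis
    proof (cases "p \<le> 1")
      case True
      have "(LINT y|lborel. norm (G y)) \<le> (LINT y|lborel. M powr (1 - p) * norm (G y) powr p)"
      proof (rule integral_mono_AE)
        show "AE y in lborel. norm (G y) \<le> M powr (1 - p) * norm (G y) powr p"
          using GM by eventually_elim (intro powr_interpolation_le_1 p True norm_ge_zero)
      qed (intro integrable_norm G integrable_mult_right iGp)+
      also have "\<dots> \<le> M powr (1 - p) * I" using Gp by (simp add: mult_left_mono)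
      finally have "A * (LINT y|lborel. norm (G y)) \<le> A * (M powr (1 - p) * I)" using A by (intro mult_left_mono) auto
      note le = this
      have "AE x in lborel. norm (G x) \<le> A * (M powr (1 - p) * I)"
        using bound1 by eventually_elim (rule order_trans[OF _ le])
      then have "M \<le> A * (M powr (1 - p) * I)" using A I0 by (intro Mle) auto
      then have "M powr (p - 1) * M \<le> M powr (p - 1) * (A * (M powr (1 - p) * I))" by (intro mult_left_mono) auto
      also have "\<dots> = (M powr (p - 1) * M powr (1 - p)) * (A * I)" by (simp add: mult_ac)
      also have "M powr (p - 1) * M powr (1 - p) = 1" using Mpos by (simp add: powr_add[symmetric])
      finally have "M powr p \<le> 1 * (A * I)" unfolding combine .
      also have "\<dots> \<le> max 1 (2 * (2 * \<kappa>) powr (p - 1)) * (A * I)" using A I0 by (intro mult_right_mono) auto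
      finally show ?thesis by (simp only: mult.assoc)
    next
      case False
      \<comment> \<open>With this choice the kernel integral of the constant \<open>l\<close> is at most \<open>M / 2\<close>.\<close>
      define l where "l = M / (2 * \<kappa>)"
      have l: "l > 0" unfolding l_def using Mpos \<kappa> by simp
      have iK: "integrable lborel (\<lambda>y. norm (K (y - x)))" and K1x: "(LINT y|lborel. norm (K (y - x))) \<le> \<kappa>" for x
        using integrable_affine[OF integrable_norm[OF K], of 1 "- x"] integral_affine[OF integrable_norm[OF K], of 1 "- x"] K1
        by (simp_all add: add.commute)
      have "AE x in lborel. norm (G x) \<le> A * (l powr (1 - p) * I) + l * \<kappa>"
        using bound
      proof eventually_elim
        case (elim x)
        also have "(LINT y|lborel. norm (G y * K (y - x))) \<le> (LINT y|lborel. (A * l powr (1 - p)) * norm (G y) powr p + l * norm (K (y - x)))"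
        proof (rule integral_mono[OF iGK])
          show "integrable lborel (\<lambda>y. (A * l powr (1 - p)) * norm (G y) powr p + l * norm (K (y - x)))"
            by (intro Bochner_Integration.integrable_add integrable_mult_right iGp iK)
          show "norm (G y * K (y - x)) \<le> (A * l powr (1 - p)) * norm (G y) powr p + l * norm (K (y - x))" for y
          proof -
            have "norm (G y) * norm (K (y - x)) \<le> (l powr (1 - p) * norm (G y) powr p + l) * norm (K (y - x))"
              using False l by (intro mult_right_mono powr_interpolation_ge_1) auto
            also have "\<dots> = (l powr (1 - p) * norm (G y) powr p) * norm (K (y - x)) + l * norm (K (y - x))"
              by (rule distrib_right)
            also have "\<dots> \<le> (l powr (1 - p) * norm (G y) powr p) * A + l * norm (K (y - x))"
              using KA by (intro add_right_mono mult_left_mono) auto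
            finally show ?thesis by (simp add: norm_mult mult_ac)
          qed
        qed
        also have "\<dots> = (A * l powr (1 - p)) * (LINT y|lborel. norm (G y) powr p) + l * (LINT y|lborel. norm (K (y - x)))"
          using iGp iK by simp
        also have "\<dots> \<le> (A * l powr (1 - p)) * I + l * \<kappa>"
          using Gp K1x[of x] A l by (intro add_mono mult_left_mono) auto
        finally show ?case by (simp only: mult.assoc)
      qed
      then have "M \<le> A * (l powr (1 - p) * I) + l * \<kappa>" using A I0 l \<kappa> by (intro Mle) auto
      moreover have "l * \<kappa> = M / 2" unfolding l_def using \<kappa> by simp
      ultimately have "M \<le> 2 * (A * (l powr (1 - p) * I))" by linarith
      then have "M powr (p - 1) * M \<le> M powr (p - 1) * (2 * (A * (l powr (1 - p) * I)))" by (intro mult_left_mono) auto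
      also have "l powr (1 - p) = M powr (1 - p) * (2 * \<kappa>) powr (p - 1)"
        unfolding l_def using Mpos \<kappa> by (simp add: powr_divide powr_minus_divide[of "2 * \<kappa>" "p - 1", symmetric] divide_powr_uminus)
      also have "M powr (p - 1) * (2 * (A * (M powr (1 - p) * (2 * \<kappa>) powr (p - 1) * I))) =
          (M powr (p - 1) * M powr (1 - p)) * ((2 * (2 * \<kappa>) powr (p - 1)) * (A * I))" by (simp add: mult_ac)
      also have "M powr (p - 1) * M powr (1 - p) = 1" using Mpos by (simp add: powr_add[symmetric])
      finally have "M powr p \<le> (2 * (2 * \<kappa>) powr (p - 1)) * (A * I)" unfolding combine by simp
      also have "\<dots> \<le> max 1 (2 * (2 * \<kappa>) powr (p - 1)) * (A * I)" using A I0 by (intro mult_right_mono) auto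
      finally show ?thesis by (simp only: mult.assoc)
    qed
  qed
  note MI = this
  show ?thesis
    using GM
  proof eventually_elim
    case (elim x)
    have "norm (G x) powr p \<le> M powr p" using elim p by (intro powr_mono2) auto
    then show ?case using MI by linarith
  qed
qed

lemma enn2real_inverse:
  fixes p :: ennreal
  assumes "0 < p" "p \<noteq> top"
  shows "0 < enn2real p" "enn2real (1 / p) = 1 / enn2real p" "p = ennreal (enn2real p)"
proof -
  show e: "p = ennreal (enn2real p)" using assms(2) by (cases p) auto
  show p: "0 < enn2real p" using assms by (simp add: enn2real_positive_iff less_top)
  have "1 / ennreal (enn2real p) = ennreal (1 / enn2real p)"
    using divide_ennreal[of 1 "enn2real p"] p by simp
  then show "enn2real (1 / p) = 1 / enn2real p" using p by (subst e) simp
qed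

context alpha_decomposition
begin

text \<open>A compactly supported Schwartz function whose transform equals one at the origin. The transform of a bump does not vanish
  identically, by inversion; modulating moves a point where it is nonzero to the origin.\<close>

lemma window_exists:
  "\<exists>\<theta>\<in>(schwartz :: (real^'n \<Rightarrow> complex) set). \<exists>R>0. (\<forall>\<xi>. \<theta> \<xi> \<noteq> 0 \<longrightarrow> norm \<xi> < R) \<and> fourier \<theta> 0 = 1"
proof -
  obtain J :: "real^'n \<Rightarrow> complex" and R where J: "J \<in> schwartz" and R: "R > 0"
    and J1: "\<forall>\<xi>. norm \<xi> \<le> 1 \<longrightarrow> J \<xi> = 1" and supp: "\<forall>\<xi>. J \<xi> \<noteq> 0 \<longrightarrow> norm \<xi> < R"
    using bump_exists[of 1] by auto
  have "\<exists>a. fourier J a \<noteq> 0"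
  proof (rule ccontr)
    assume "\<not> ?thesis"
    then have "inv_fourier (fourier J) 0 = 0" unfolding inv_fourier_def by simp
    then show False using J1 by (simp add: fourier_inversion[OF J])
  qed
  then obtain a where a: "fourier J a \<noteq> 0" ..
  define \<theta> where "\<theta> \<xi> = (1 / fourier J a) * (cis ((- 2 * pi) * (a \<bullet> \<xi>)) * J \<xi>)" for \<xi>
  have \<theta>: "\<theta> \<in> schwartz" unfolding \<theta>_def by (intro schwartz_cmult schwartz_plane_wave J)
  have "fourier (\<lambda>\<xi>. cis ((- 2 * pi) * (a \<bullet> \<xi>)) * J \<xi>) 0 = fourier J a"
    unfolding fourier_def by (simp add: mult_ac inner_commute)
  then have "fourier \<theta> 0 = 1" unfolding \<theta>_def[abs_def] fourier_cmult using a by simp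
  moreover have "\<forall>\<xi>. \<theta> \<xi> \<noteq> 0 \<longrightarrow> norm \<xi> < R" using supp unfolding \<theta>_def by auto
  ultimately show ?thesis using R by (intro rev_bexI[OF \<theta>]) auto
qed

text \<open>The representing function \<open>g\<close> of a piece need not be integrable, so it is first multiplied by the transform of a narrow
  window. This keeps the spectrum in a slightly larger ball, makes the product integrable since the window transform
  is a Schwartz function, and gives a bound that does not depend on the width of the window. Letting the window shrink
  recovers \<open>g\<close>.\<close>

lemma nikolskii_powr:
  assumes p: "0 < p"
  shows "\<exists>B>0. \<forall>k u g I. represents g (Defs.box \<eta> k u) \<longrightarrow> 0 \<le> I \<longrightarrow>
    (\<integral>\<^sup>+x. ennreal (norm (g x) powr p) \<partial>lborel) \<le> ennreal I \<longrightarrow>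
    (AE x in lborel. norm (g x) powr p \<le> B * radius k ^ CARD('n) * I)"
proof -
  \<comment> \<open>The bump is one on radius \<open>C + 1\<close>: \<open>C\<close> for the spectrum of the piece and \<open>1\<close> for the spreading by the window.\<close>
  obtain J0 :: "real^'n \<Rightarrow> complex" where J0: "J0 \<in> schwartz" and J01: "\<forall>\<xi>. norm \<xi> \<le> C + 1 \<longrightarrow> J0 \<xi> = 1"
    using bump_exists[of "C + 1"] by auto
  obtain \<theta> :: "real^'n \<Rightarrow> complex" and R where \<theta>: "\<theta> \<in> schwartz" and R: "R > 0"
    and supp: "\<forall>\<xi>. \<theta> \<xi> \<noteq> 0 \<longrightarrow> norm \<xi> < R" and \<theta>1: "fourier \<theta> 0 = 1"
    using window_exists by auto
  define T where "T = (LINT \<zeta>|lborel. norm (\<theta> \<zeta>))"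
  have T: "norm (fourier \<theta> x) \<le> T" for x unfolding T_def by (rule norm_fourier_le)
  have T0: "T \<ge> 0" using order_trans[OF norm_ge_zero T] .
  define A0 where "A0 = (LINT \<xi>|lborel. norm (J0 \<xi>)) + 1"
  define \<kappa> where "\<kappa> = (LINT x|lborel. norm (fourier J0 x)) + 1"
  have A0: "A0 > 0" unfolding A0_def by (intro add_nonneg_pos Bochner_Integration.integral_nonneg) auto
  have \<kappa>: "\<kappa> > 0" unfolding \<kappa>_def by (intro add_nonneg_pos Bochner_Integration.integral_nonneg) auto
  define B where "B = max 1 (2 * (2 * \<kappa>) powr (p - 1)) * A0 * (T powr p + 1)"
  have B: "B > 0" unfolding B_def using A0 by (intro mult_pos_pos add_nonneg_pos) auto
  have "AE x in lborel. norm (g x) powr p \<le> B * radius k ^ CARD('n) * I"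
    if g: "represents g (Defs.box \<eta> k u)" and I0: "0 \<le> I"
      and I: "(\<integral>\<^sup>+x. ennreal (norm (g x) powr p) \<partial>lborel) \<le> ennreal I" for k u g I
  proof -
    let ?r = "radius k"
    have gm[measurable]: "g \<in> borel_measurable borel" using g unfolding represents_def by simp
    have gint: "integrable lborel (\<lambda>x. g x * \<phi> x)" and geq: "Defs.box \<eta> k u \<phi> = (LINT x|lborel. g x * \<phi> x)"
      if "\<phi> \<in> schwartz" for \<phi> using g that unfolding represents_def by auto
    define J where "J \<xi> = J0 ((1 / ?r) *\<^sub>R (\<xi> - center k))" for \<xi>
    have J: "J \<in> schwartz"
    proof -
      have "(\<lambda>\<xi>. J0 ((- (1 / ?r)) *\<^sub>R center k + (1 / ?r) *\<^sub>R \<xi>)) \<in> schwartz"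
        using radius_pos[of k] by (intro schwartz_affine J0) simp
      then show ?thesis unfolding J_def by (simp add: scaleR_diff_right)
    qed
    have J1: "J \<xi> = 1" if "norm (\<xi> - center k) \<le> (C + 1) * ?r" for \<xi>
    proof -
      have "norm ((1 / ?r) *\<^sub>R (\<xi> - center k)) \<le> C + 1"
        using that radius_pos[of k] by (simp add: divide_le_eq)
      then show ?thesis unfolding J_def using J01 by blast
    qed
    have fJ: "fourier J x = ?r ^ CARD('n) * (cis (- 2 * pi * (center k \<bullet> x)) * fourier J0 (?r *\<^sub>R x))" for x
      unfolding J_def using fourier_dilate[OF schwartz_integrable[OF J0] radius_pos[of k], of "center k" x] by simp
    have KA: "norm (fourier J x) \<le> ?r ^ CARD('n) * A0" for x
    proof -
      have "norm (fourier J0 (?r *\<^sub>R x)) \<le> A0" unfolding A0_def using norm_fourier_le[of J0 "?r *\<^sub>R x"] by simp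
      then show ?thesis unfolding fJ using radius_pos[of k] by (simp add: norm_mult norm_power mult_left_mono)
    qed
    have K1: "(LINT x|lborel. norm (fourier J x)) \<le> \<kappa>"
    proof -
      have "(LINT x|lborel. norm (fourier J x)) = (LINT x|lborel. ?r ^ CARD('n) * norm (fourier J0 (0 + ?r *\<^sub>R x)))"
        unfolding fJ using radius_pos[of k] by (simp add: norm_mult norm_power)
      also have "\<dots> = (LINT x|lborel. norm (fourier J0 x))"
        using integral_affine[OF integrable_norm[OF schwartz_integrable[OF schwartz_fourier[OF J0]]], of ?r 0] radius_pos[of k]
        by simp
      finally show ?thesis unfolding \<kappa>_def by simp
    qed
    \<comment> \<open>The window dilated by \<open>d m\<close> is supported in the unit ball, and \<open>d m\<close> tends to zero.\<close>
    define d where "d m = 1 / (R * real (Suc m))" for m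
    have d: "d m > 0" and dR: "d m * R \<le> 1" for m unfolding d_def using R by (auto simp: divide_le_eq)
    have main: "AE x in lborel. norm (g x * fourier \<theta> (d m *\<^sub>R x)) powr p \<le> B * ?r ^ CARD('n) * I" for m
    proof -
      define \<theta>' where "\<theta>' \<zeta> = (1 / d m ^ CARD('n)) * \<theta> ((1 / d m) *\<^sub>R \<zeta>)" for \<zeta>
      have \<theta>': "\<theta>' \<in> schwartz"
        unfolding \<theta>'_def using schwartz_affine[OF \<theta>, of "1 / d m" 0] d[of m] by (intro schwartz_cmult) simp
      have f\<theta>': "fourier \<theta>' = (\<lambda>x. fourier \<theta> (d m *\<^sub>R x))"
      proof
        fix x
        define c :: complex where "c = 1 / d m ^ CARD('n)"
        have "fourier \<theta>' x = fourier (\<lambda>\<zeta>. c * \<theta> ((1 / d m) *\<^sub>R \<zeta>)) x"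
          unfolding \<theta>'_def[abs_def] c_def by simp
        also have "\<dots> = c * (of_real (d m ^ CARD('n)) * fourier \<theta> (d m *\<^sub>R x))"
          unfolding fourier_cmult
          using fourier_dilate[OF schwartz_integrable[OF \<theta>] d[of m], of 0 x] by simp
        also have "\<dots> = fourier \<theta> (d m *\<^sub>R x)" unfolding c_def using d[of m] by simp
        finally show "fourier \<theta>' x = fourier \<theta> (d m *\<^sub>R x)" .
      qed
      have supp': "norm \<zeta> < 1" if "\<theta>' \<zeta> \<noteq> 0" for \<zeta>
      proof -
        have "norm ((1 / d m) *\<^sub>R \<zeta>) < R" using that supp unfolding \<theta>'_def by auto
        then have "norm \<zeta> < d m * R" using d[of m] by (simp add: divide_less_eq mult.commute)
        then show ?thesis using dR[of m] by simp
      qed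
      have ft: "fourier \<theta>' \<in> schwartz" by (rule schwartz_fourier[OF \<theta>'])
      define G where "G x = g x * fourier \<theta>' x" for x
      have G: "integrable lborel G" unfolding G_def by (rule gint[OF ft])
      \<comment> \<open>On the support of \<open>\<eta> k\<close>, spread by the window, the adapted bump \<open>J\<close> is one, so it does not change the pairing.\<close>
      have band: "(LINT x|lborel. G x * \<phi> x) = (LINT x|lborel. G x * fourier (\<lambda>\<xi>. J \<xi> * inv_fourier \<phi> \<xi>) x)"
        if \<phi>: "\<phi> \<in> schwartz" for \<phi>
      proof -
        define \<phi>' where "\<phi>' = fourier (\<lambda>\<xi>. J \<xi> * inv_fourier \<phi> \<xi>)"
        have Ji: "(\<lambda>\<xi>. J \<xi> * inv_fourier \<phi> \<xi>) \<in> schwartz" by (intro schwartz_mult J schwartz_inv_fourier \<phi>)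
        have \<phi>': "\<phi>' \<in> schwartz" unfolding \<phi>'_def by (rule schwartz_fourier[OF Ji])
        have inv': "inv_fourier \<phi>' = (\<lambda>\<xi>. J \<xi> * inv_fourier \<phi> \<xi>)" unfolding \<phi>'_def by (rule fourier_inversion[OF Ji])
        have val: "(LINT x|lborel. G x * f x) = u (fourier (\<lambda>\<xi>. \<eta> k \<xi> * (LINT \<zeta>|lborel. \<theta>' \<zeta> * inv_fourier f (\<xi> - \<zeta>))))"
          if f: "f \<in> schwartz" for f
        proof -
          have s: "(\<lambda>x. fourier \<theta>' x * f x) \<in> schwartz" by (intro schwartz_mult ft f)
          have "(LINT x|lborel. G x * f x) = Defs.box \<eta> k u (\<lambda>x. fourier \<theta>' x * f x)"
            unfolding geq[OF s] G_def by (simp only: mult.assoc)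
          also have "\<dots> = u (fourier (\<lambda>\<xi>. \<eta> k \<xi> * inv_fourier (\<lambda>x. fourier \<theta>' x * f x) \<xi>))"
            by (rule box_apply[of \<eta> k, OF \<eta>_schwartz s])
          finally show ?thesis unfolding inv_fourier_mult_fourier[OF \<theta>' f] .
        qed
        have "\<eta> k \<xi> * (LINT \<zeta>|lborel. \<theta>' \<zeta> * inv_fourier \<phi> (\<xi> - \<zeta>)) = \<eta> k \<xi> * (LINT \<zeta>|lborel. \<theta>' \<zeta> * inv_fourier \<phi>' (\<xi> - \<zeta>))" for \<xi>
        proof (cases "\<eta> k \<xi> = 0")
          case False
          have "\<theta>' \<zeta> * inv_fourier \<phi> (\<xi> - \<zeta>) = \<theta>' \<zeta> * inv_fourier \<phi>' (\<xi> - \<zeta>)" for \<zeta>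
          proof (cases "\<theta>' \<zeta> = 0")
            case nz: False
            have "norm (\<xi> - \<zeta> - center k) \<le> norm (\<xi> - center k) + norm \<zeta>"
              using norm_triangle_ineq4[of "\<xi> - center k" \<zeta>] by (simp add: algebra_simps)
            also have "\<dots> \<le> C * ?r + 1 * ?r"
              using support[OF False] supp'[OF nz] radius_ge_1[of k] by simp
            finally have "J (\<xi> - \<zeta>) = 1" by (intro J1) (simp add: distrib_right)
            then show ?thesis unfolding inv' by simp
          qed simp
          then show ?thesis by (simp only:)
        qed simp
        then have "(\<lambda>\<xi>. \<eta> k \<xi> * (LINT \<zeta>|lborel. \<theta>' \<zeta> * inv_fourier \<phi> (\<xi> - \<zeta>)))
            = (\<lambda>\<xi>. \<eta> k \<xi> * (LINT \<zeta>|lborel. \<theta>' \<zeta> * inv_fourier \<phi>' (\<xi> - \<zeta>)))" ..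
        then show ?thesis unfolding val[OF \<phi>] \<phi>'_def[symmetric] val[OF \<phi>'] by (simp only:)
      qed
      have rep: "AE x in lborel. G x = (LINT y|lborel. G y * fourier J (y - x))"
        by (rule reproducing_formula[OF G J band])
      have GI: "(\<integral>\<^sup>+x. ennreal (norm (G x) powr p) \<partial>lborel) \<le> ennreal (T powr p * I)"
      proof -
        have "(\<integral>\<^sup>+x. ennreal (norm (G x) powr p) \<partial>lborel) \<le> (\<integral>\<^sup>+x. ennreal (T powr p) * ennreal (norm (g x) powr p) \<partial>lborel)"
        proof (rule nn_integral_mono)
          fix x
          have "norm (G x) \<le> T * norm (g x)"
            unfolding G_def f\<theta>' norm_mult
            using mult_left_mono[OF T[of "d m *\<^sub>R x"] norm_ge_zero[of "g x"]] by (simp only: mult.commute)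
          then have "norm (G x) powr p \<le> (T * norm (g x)) powr p" using p by (intro powr_mono2) auto
          also have "\<dots> = T powr p * norm (g x) powr p" using T0 by (simp add: powr_mult)
          finally show "ennreal (norm (G x) powr p) \<le> ennreal (T powr p) * ennreal (norm (g x) powr p)"
            by (simp add: ennreal_mult[symmetric] ennreal_leI)
        qed
        also have "\<dots> = ennreal (T powr p) * (\<integral>\<^sup>+x. ennreal (norm (g x) powr p) \<partial>lborel)"
          by (intro nn_integral_cmult) measurable
        also have "\<dots> \<le> ennreal (T powr p) * ennreal I" using I by (intro mult_left_mono) auto
        finally show ?thesis using I0 by (simp add: ennreal_mult)
      qed
      have "AE x in lborel. norm (G x) powr p \<le> max 1 (2 * (2 * \<kappa>) powr (p - 1)) * (?r ^ CARD('n) * A0) * (T powr p * I)"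
        by (rule band_limited_sup_bound[OF G schwartz_integrable[OF schwartz_fourier[OF J]] rep KA _ K1 \<kappa> p GI])
           (use A0 I0 radius_pos[of k] in auto)
      note bd = this
      have le: "max 1 (2 * (2 * \<kappa>) powr (p - 1)) * (?r ^ CARD('n) * A0) * (T powr p * I) \<le> B * ?r ^ CARD('n) * I"
      proof -
        have "(max 1 (2 * (2 * \<kappa>) powr (p - 1)) * A0 * ?r ^ CARD('n) * I) * T powr p \<le>
            (max 1 (2 * (2 * \<kappa>) powr (p - 1)) * A0 * ?r ^ CARD('n) * I) * (T powr p + 1)"
          using A0 I0 radius_pos[of k] by (intro mult_left_mono) auto
        then show ?thesis unfolding B_def by (simp only: mult_ac)
      qed
      show ?thesis
        using bd unfolding G_def f\<theta>' by eventually_elim (rule order_trans[OF _ le])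
    qed
    then have "AE x in lborel. \<forall>m. norm (g x * fourier \<theta> (d m *\<^sub>R x)) powr p \<le> B * ?r ^ CARD('n) * I"
      by (simp add: AE_all_countable)
    then show ?thesis
    proof eventually_elim
      case (elim x)
      have "d \<longlonglongrightarrow> 0"
      proof -
        have "(\<lambda>m. (1 / R) * (1 / real (Suc m))) \<longlonglongrightarrow> (1 / R) * 0"
          by (intro tendsto_mult tendsto_const LIMSEQ_Suc[OF lim_1_over_n])
        then show ?thesis by (simp add: d_def[abs_def])
      qed
      then have "(\<lambda>m. d m *\<^sub>R x) \<longlonglongrightarrow> 0 *\<^sub>R x" by (rule tendsto_scaleR[OF _ tendsto_const])
      then have l0: "(\<lambda>m. d m *\<^sub>R x) \<longlonglongrightarrow> 0" by simp
      have "isCont (fourier \<theta>) 0"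
        by (rule differentiable_imp_continuous_within[OF smooth_differentiable[OF smooth_fourier[OF \<theta>]]])
      from isCont_tendsto_compose[OF this l0]
      have "(\<lambda>m. fourier \<theta> (d m *\<^sub>R x)) \<longlonglongrightarrow> 1" by (simp add: \<theta>1)
      then have "(\<lambda>m. norm (g x * fourier \<theta> (d m *\<^sub>R x)) powr p) \<longlonglongrightarrow> norm (g x * 1) powr p"
        by (intro tendsto_powr' tendsto_norm tendsto_mult tendsto_const) (use p in auto)
      then have "norm (g x * 1) powr p \<le> B * ?r ^ CARD('n) * I"
        by (rule LIMSEQ_le_const2) (use elim in auto)
      then show ?case by simp
    qed
  qed
  then show ?thesis using B by (intro exI[of _ B]) auto
qed

text \<open>The \<open>p\<close>-th root of the previous estimate. For \<open>p = \<infinity>\<close> the exponent of the radius is zero.\<close>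

lemma nikolskii:
  assumes p: "0 < p"
  shows "\<exists>A>0. \<forall>k u g. represents g (Defs.box \<eta> k u) \<longrightarrow>
    Lp_norm top g \<le> ennreal (A * radius k powr (real CARD('n) * enn2real (1 / p))) * Lp_norm p g"
proof (cases "p = top")
  case True
  show ?thesis
    by (intro exI[of _ 1]) (use radius_pos in \<open>auto simp: True dual_order.strict_iff_order\<close>)
next
  case False
  define q where "q = enn2real p"
  have q: "0 < q" "enn2real (1 / p) = 1 / q" unfolding q_def using enn2real_inverse[OF p False] by auto
  obtain B where B: "B > 0" and bound: "\<forall>k u g I. represents g (Defs.box \<eta> k u) \<longrightarrow> 0 \<le> I \<longrightarrow>
    (\<integral>\<^sup>+x. ennreal (norm (g x) powr q) \<partial>lborel) \<le> ennreal I \<longrightarrow>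
    (AE x in lborel. norm (g x) powr q \<le> B * radius k ^ CARD('n) * I)"
    using nikolskii_powr[OF q(1)] by auto
  have "Lp_norm top g \<le> ennreal (B powr (1 / q) * radius k powr (real CARD('n) * enn2real (1 / p))) * Lp_norm p g"
    if g: "represents g (Defs.box \<eta> k u)" for k u g
  proof (cases "(\<integral>\<^sup>+x. ennreal (norm (g x) powr q) \<partial>lborel) = top")
    case inf: True
    have "B powr (1 / q) * radius k powr (real CARD('n) * enn2real (1 / p)) > 0"
      using B radius_pos[of k] by simp
    then show ?thesis using inf False B radius_pos[of k] unfolding Lp_norm_def ennreal_powr_def q_def
      by (auto simp: ennreal_mult_top)
  next
    case fin: False
    define I where "I = enn2real (\<integral>\<^sup>+x. ennreal (norm (g x) powr q) \<partial>lborel)"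
    have I: "(\<integral>\<^sup>+x. ennreal (norm (g x) powr q) \<partial>lborel) = ennreal I" "0 \<le> I"
      unfolding I_def using fin by (simp_all add: ennreal_enn2real_if)
    have Lp: "Lp_norm p g = ennreal (I powr (1 / q))"
      unfolding Lp_norm_def ennreal_powr_def q(2) using False I unfolding q_def by simp
    have gm[measurable]: "g \<in> borel_measurable borel" using g unfolding represents_def by simp
    have "AE x in lborel. norm (g x) powr q \<le> B * radius k ^ CARD('n) * I"
      using bound g I by simp
    then have "AE x in lborel. ennreal (norm (g x)) \<le> ennreal (B powr (1 / q) * radius k powr (real CARD('n) * (1 / q)) * I powr (1 / q))"
    proof eventually_elim
      case (elim x)
      have "norm (g x) = (norm (g x) powr q) powr (1 / q)" using q by (simp add: powr_powr)
      also have "\<dots> \<le> (B * radius k ^ CARD('n) * I) powr (1 / q)"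
        using elim q by (intro powr_mono2) auto
      also have "\<dots> = B powr (1 / q) * (radius k ^ CARD('n)) powr (1 / q) * I powr (1 / q)"
        using B I radius_pos[of k] by (simp add: powr_mult)
      also have "(radius k ^ CARD('n)) powr (1 / q) = radius k powr (real CARD('n) * (1 / q))"
        using radius_pos[of k] by (simp add: powr_realpow[symmetric] powr_powr)
      finally show ?case by (rule ennreal_leI)
    qed
    then have "Lp_norm top g \<le> ennreal (B powr (1 / q) * radius k powr (real CARD('n) * (1 / q)) * I powr (1 / q))"
      unfolding Lp_norm_def by (simp add: esssup_I)
    then show ?thesis unfolding Lp q(2) using B radius_pos[of k] by (simp add: ennreal_mult[symmetric])
  qed
  then show ?thesis using B by (intro exI[of _ "B powr (1 / q)"]) auto
qed

end

section \<open>Sums over the lattice\<close>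

lemma sum_abs_int_le:
  fixes f :: "nat \<Rightarrow> real"
  assumes "\<And>n. 0 \<le> f n"
  shows "(\<Sum>m\<in>{- int M..int M}. f (nat \<bar>m\<bar>)) \<le> 2 * (\<Sum>n\<le>M. f n)"
proof -
  have "{- int M..int M} \<subseteq> int ` {..M} \<union> (\<lambda>n. - int n) ` {..M}"
  proof
    fix m assume m: "m \<in> {- int M..int M}"
    show "m \<in> int ` {..M} \<union> (\<lambda>n. - int n) ` {..M}"
    proof (cases "0 \<le> m")
      case True
      then have "m = int (nat m)" "nat m \<in> {..M}" using m by auto
      then show ?thesis by blast
    next
      case False
      then have "m = - int (nat (- m))" "nat (- m) \<in> {..M}" using m by auto
      then show ?thesis by blast
    qed
  qed
  then have "(\<Sum>m\<in>{- int M..int M}. f (nat \<bar>m\<bar>)) \<le> (\<Sum>m\<in>int ` {..M} \<union> (\<lambda>n. - int n) ` {..M}. f (nat \<bar>m\<bar>))"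
    using assms by (intro sum_mono2) auto
  also have "\<dots> \<le> (\<Sum>m\<in>int ` {..M}. f (nat \<bar>m\<bar>)) + (\<Sum>m\<in>(\<lambda>n. - int n) ` {..M}. f (nat \<bar>m\<bar>))"
    using assms by (subst sum.union_inter[symmetric]) (auto intro!: sum_nonneg)
  also have "(\<Sum>m\<in>int ` {..M}. f (nat \<bar>m\<bar>)) = (\<Sum>n\<le>M. f n)"
    by (subst sum.reindex) auto
  also have "(\<Sum>m\<in>(\<lambda>n. - int n) ` {..M}. f (nat \<bar>m\<bar>)) = (\<Sum>n\<le>M. f n)"
    by (subst sum.reindex) (auto simp: inj_on_def)
  finally show ?thesis by simp
qed

text \<open>The weight is at most a product over the coordinates of \<open>(1 + \<bar>k_i\<bar>)^(-\<gamma>/n)\<close> up to a constant, and each factor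
  is summable over the integers since \<open>\<gamma>/n > 1\<close>.\<close>

lemma lattice_sum_bounded:
  assumes \<gamma>: "\<gamma> > real CARD('n::finite)"
  shows "\<exists>H>0. \<forall>F :: (int^'n) set. finite F \<longrightarrow> (\<Sum>k\<in>F. japanese k powr (- \<gamma>)) \<le> H"
proof -
  define n where "n = CARD('n)"
  have n: "0 < n" unfolding n_def by simp
  define h where "h m = (1 + real m) powr (- (\<gamma> / n))" for m
  have h0: "0 \<le> h m" for m unfolding h_def by simp
  have g1: "\<gamma> / n > 1" using \<gamma> n unfolding n_def by simp
  have "summable (\<lambda>m. real m powr (- (\<gamma> / n)))" using g1 by (subst summable_real_powr_iff) simp
  then have "summable (\<lambda>m. real (Suc m) powr (- (\<gamma> / n)))" by (subst summable_Suc_iff)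
  then have sh: "summable h" unfolding h_def by (simp add: add.commute)
  define H where "H = 2 * suminf h"
  have le: "japanese k powr (- \<gamma>) \<le> 2 powr \<gamma> * (\<Prod>i\<in>UNIV. h (nat \<bar>k $ i\<bar>))" for k :: "int^'n"
  proof -
    have "japanese k powr (- (\<gamma> / n)) \<le> 2 powr (\<gamma> / n) * h (nat \<bar>k $ i\<bar>)" for i
    proof -
      have "1 + \<bar>real_of_int (k $ i)\<bar> \<le> 2 * japanese k"
        using component_le_norm_cart[of "lattice_vec k" i] norm_lattice_vec_le[of k] japanese_ge_1[of k]
        by (simp add: lattice_vec_def)
      then have "(1 + \<bar>real_of_int (k $ i)\<bar>) / 2 \<le> japanese k" by simp
      then have "japanese k powr (- (\<gamma> / n)) \<le> ((1 + \<bar>real_of_int (k $ i)\<bar>) / 2) powr (- (\<gamma> / n))"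
        using g1 by (intro powr_mono2') auto
      also have "\<dots> = 2 powr (\<gamma> / n) * h (nat \<bar>k $ i\<bar>)"
        unfolding h_def by (simp add: powr_divide powr_minus_divide)
      finally show ?thesis .
    qed
    then have "(\<Prod>i\<in>(UNIV :: 'n set). japanese k powr (- (\<gamma> / n))) \<le> (\<Prod>i\<in>UNIV. 2 powr (\<gamma> / n) * h (nat \<bar>k $ i\<bar>))"
      by (intro prod_mono) auto
    moreover have "(\<Prod>i\<in>(UNIV :: 'n set). japanese k powr (- (\<gamma> / n))) = japanese k powr (- \<gamma>)"
      using n japanese_pos[of k] unfolding n_def by (simp add: powr_realpow[symmetric] powr_powr)
    moreover have "(\<Prod>i\<in>UNIV. 2 powr (\<gamma> / n) * h (nat \<bar>k $ i\<bar>)) = 2 powr \<gamma> * (\<Prod>i\<in>UNIV. h (nat \<bar>k $ i\<bar>))"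
      using n unfolding n_def by (simp add: prod.distrib powr_realpow[symmetric] powr_powr)
    ultimately show ?thesis by simp
  qed
  have "(\<Sum>k\<in>F. japanese k powr (- \<gamma>)) \<le> 2 powr \<gamma> * H ^ n" if F: "finite F" for F :: "(int^'n) set"
  proof -
    have "\<exists>M. \<forall>k\<in>F. \<forall>i. \<bar>k $ i\<bar> \<le> int M"
    proof -
      define M where "M = (\<Sum>k\<in>F. \<Sum>i\<in>UNIV. nat \<bar>k $ i\<bar>)"
      have "\<bar>k $ i\<bar> \<le> int M" if "k \<in> F" for k i
      proof -
        have "nat \<bar>k $ i\<bar> \<le> (\<Sum>i\<in>UNIV. nat \<bar>k $ i\<bar>)" by (rule member_le_sum) auto
        also have "\<dots> \<le> M" unfolding M_def using that F by (intro member_le_sum) auto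
        finally show ?thesis by simp
      qed
      then show ?thesis by blast
    qed
    then obtain M where M: "\<forall>k\<in>F. \<forall>i. \<bar>k $ i\<bar> \<le> int M" ..
    let ?P = "(UNIV :: 'n set) \<rightarrow>\<^sub>E {- int M..int M}"
    have finP: "finite ?P" by (intro finite_PiE) auto
    have inj: "inj_on vec_nth F" by (simp add: inj_on_def vec_nth_inject)
    have sub: "vec_nth ` F \<subseteq> ?P"
    proof
      fix f assume "f \<in> vec_nth ` F"
      then obtain k where k: "k \<in> F" "f = vec_nth k" by blast
      have "- int M \<le> k $ i \<and> k $ i \<le> int M" for i using M[rule_format, OF k(1), of i] unfolding abs_le_iff by linarith
      then show "f \<in> ?P" unfolding k(2) by auto
    qed
    have "(\<Sum>k\<in>F. japanese k powr (- \<gamma>)) \<le> (\<Sum>k\<in>F. 2 powr \<gamma> * (\<Prod>i\<in>UNIV. h (nat \<bar>k $ i\<bar>)))"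
      by (intro sum_mono le)
    also have "\<dots> = 2 powr \<gamma> * (\<Sum>f\<in>vec_nth ` F. \<Prod>i\<in>UNIV. h (nat \<bar>f i\<bar>))"
      by (simp add: sum_distrib_left sum.reindex[OF inj])
    also have "(\<Sum>f\<in>vec_nth ` F. \<Prod>i\<in>UNIV. h (nat \<bar>f i\<bar>)) \<le> (\<Sum>f\<in>?P. \<Prod>i\<in>UNIV. h (nat \<bar>f i\<bar>))"
      using finP sub h0 by (intro sum_mono2 prod_nonneg) auto
    also have "\<dots> = (\<Prod>i\<in>(UNIV :: 'n set). \<Sum>m\<in>{- int M..int M}. h (nat \<bar>m\<bar>))"
      by (rule prod_sum_PiE[symmetric]) auto
    also have "\<dots> \<le> (\<Prod>i\<in>(UNIV :: 'n set). H)"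
    proof (intro prod_mono conjI sum_nonneg h0)
      have "(\<Sum>m\<in>{- int M..int M}. h (nat \<bar>m\<bar>)) \<le> 2 * (\<Sum>m\<le>M. h m)" by (rule sum_abs_int_le[OF h0])
      also have "\<dots> \<le> H" unfolding H_def using sum_le_suminf[OF sh, of "{..M}"] h0 by simp
      finally show "(\<Sum>m\<in>{- int M..int M}. h (nat \<bar>m\<bar>)) \<le> H" .
    qed
    also have "\<dots> = H ^ n" unfolding n_def by simp
    finally show ?thesis by simp
  qed
  then show ?thesis by (intro exI[of _ "max 1 (2 powr \<gamma> * H ^ n)"]) (auto simp: le_max_iff_disj)
qed

text \<open>Young's inequality without the sharp constants.\<close>

lemma powr_young:
  fixes x y q r :: real
  assumes "0 \<le> x" "0 \<le> y" and q: "1 < q" and r: "r = q / (q - 1)"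
  shows "x * y \<le> x powr q + y powr r"
proof (cases "x = 0 \<or> y = 0")
  case True then show ?thesis by auto
next
  case False
  then have pos: "x > 0" "y > 0" using assms by auto
  show ?thesis
  proof (cases "y \<le> x powr (q - 1)")
    case True
    have "x * y \<le> x * x powr (q - 1)" using True pos by (intro mult_left_mono) auto
    also have "\<dots> = x powr q" using pos by (simp add: powr_diff)
    finally show ?thesis using powr_ge_zero[of y r] by linarith
  next
    case False
    have "x = (x powr (q - 1)) powr (1 / (q - 1))" using pos q by (simp add: powr_powr)
    also have "\<dots> \<le> y powr (1 / (q - 1))" using False q by (intro powr_mono2) auto
    finally have "x * y \<le> y powr (1 / (q - 1)) * y" using pos by (intro mult_right_mono) auto
    also have "\<dots> = y powr (1 / (q - 1) + 1)" using pos by (simp add: powr_add)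
    also have "1 / (q - 1) + 1 = r" unfolding r using q by (simp add: field_simps)
    finally show ?thesis using powr_ge_zero[of x q] by linarith
  qed
qed

text \<open>The \<open>l^q\<close> norm of a nonnegative sequence is at most \<open>N\<close>, in terms of finite partial sums.\<close>

definition lq_bounded :: "ennreal \<Rightarrow> (int^'n::finite \<Rightarrow> real) \<Rightarrow> real \<Rightarrow> bool" where
  "lq_bounded q t N \<longleftrightarrow>
    (if q = top then \<forall>k. t k \<le> N
     else \<forall>F. finite F \<longrightarrow> (\<Sum>k\<in>F. t k powr enn2real q) \<le> N powr enn2real q)"

text \<open>For \<open>q \<le> 1\<close> this is \<open>l^q \<subseteq> l^1\<close>. For \<open>q > 1\<close> it is the Hoelder inequality, as \<open>\<langle>k\<rangle>^(-\<sigma>)\<close> lies in the dual space \<open>l^(q')\<close>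
  exactly if \<open>\<sigma> q' > n\<close>. For finite \<open>q\<close> the sequence is normalized to \<open>N = 1\<close> and then estimated term by term.\<close>

lemma discrete_hoelder:
  assumes q: "0 < q" and "q \<le> 1 \<longrightarrow> \<sigma> \<ge> 0"
    and "q > 1 \<longrightarrow> \<sigma> > real CARD('n::finite) * (1 - enn2real (1 / q))"
  shows "\<exists>H>0. \<forall>(t :: int^'n \<Rightarrow> real) N. (\<forall>k. 0 \<le> t k) \<longrightarrow> 0 \<le> N \<longrightarrow> lq_bounded q t N \<longrightarrow>
    (\<forall>F. finite F \<longrightarrow> (\<Sum>k\<in>F. japanese k powr (- \<sigma>) * t k) \<le> H * N)"
proof (cases "q = top")
  note \<sigma>1 = assms(2)[rule_format] and \<sigma>2 = assms(3)[rule_format]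
  case True
  then have "\<sigma> > real CARD('n)" using \<sigma>2 by simp
  then obtain H where H: "H > 0" "\<forall>F :: (int^'n) set. finite F \<longrightarrow> (\<Sum>k\<in>F. japanese k powr (- \<sigma>)) \<le> H"
    using lattice_sum_bounded[of \<sigma>, where ?'n = 'n] by auto
  have "(\<Sum>k\<in>F. japanese k powr (- \<sigma>) * t k) \<le> H * N"
    if "\<forall>k. 0 \<le> t k" "0 \<le> N" "lq_bounded q t N" "finite F" for t :: "int^'n \<Rightarrow> real" and N :: real and F :: "(int^'n) set"
  proof -
    have "(\<Sum>k\<in>F. japanese k powr (- \<sigma>) * t k) \<le> (\<Sum>k\<in>F. japanese k powr (- \<sigma>) * N)"
      using that True unfolding lq_bounded_def by (intro sum_mono mult_left_mono) auto
    also have "\<dots> = (\<Sum>k\<in>F. japanese k powr (- \<sigma>)) * N" by (rule sum_distrib_right[symmetric])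
    also have "\<dots> \<le> H * N" using H that by (intro mult_right_mono) auto
    finally show ?thesis .
  qed
  note * = this
  show ?thesis by (intro exI[of _ H] conjI allI impI H(1)) (rule *)
next
  note \<sigma>1 = assms(2)[rule_format] and \<sigma>2 = assms(3)[rule_format]
  case False
  define r where "r = enn2real q"
  have r: "0 < r" "enn2real (1 / q) = 1 / r" "q = ennreal r" unfolding r_def using enn2real_inverse[OF q False] by auto
  have zero: "t k = 0" if "\<forall>k. 0 \<le> t k" "lq_bounded q t 0" for t :: "int^'n \<Rightarrow> real" and k
  proof -
    have "\<forall>F. finite F \<longrightarrow> (\<Sum>k\<in>F. t k powr r) \<le> 0"
      using that False r(1) unfolding lq_bounded_def r_def by simp
    then have "(\<Sum>k\<in>{k}. t k powr r) \<le> 0" by blast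
    then show ?thesis by simp
  qed
  have normalized: "(\<Sum>k\<in>F. (t k / N) powr r) \<le> 1"
    if "\<forall>k. 0 \<le> t k" "0 < N" "lq_bounded q t N" "finite F" for t :: "int^'n \<Rightarrow> real" and N :: real and F :: "(int^'n) set"
  proof -
    have "(\<Sum>k\<in>F. (t k / N) powr r) = (\<Sum>k\<in>F. t k powr r) / N powr r"
      using that by (simp add: powr_divide sum_divide_distrib)
    also have "\<dots> \<le> N powr r / N powr r"
      using that False unfolding lq_bounded_def r_def by (intro divide_right_mono) auto
    finally show ?thesis using that by simp
  qed
  have reduce: "\<exists>H>0. \<forall>(t :: int^'n \<Rightarrow> real) N. (\<forall>k. 0 \<le> t k) \<longrightarrow> 0 \<le> N \<longrightarrow> lq_bounded q t N \<longrightarrow>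
    (\<forall>F. finite F \<longrightarrow> (\<Sum>k\<in>F. japanese k powr (- \<sigma>) * t k) \<le> H * N)"
    if H: "H > 0" and pos: "\<And>(t :: int^'n \<Rightarrow> real) N F. \<forall>k. 0 \<le> t k \<Longrightarrow> 0 < N \<Longrightarrow> lq_bounded q t N \<Longrightarrow> finite F \<Longrightarrow>
      (\<Sum>k\<in>F. japanese k powr (- \<sigma>) * (t k / N)) \<le> H" for H
  proof (intro exI[of _ H] conjI allI impI H)
    fix t :: "int^'n \<Rightarrow> real" and N :: real and F :: "(int^'n) set"
    assume t: "\<forall>k. 0 \<le> t k" "0 \<le> N" "lq_bounded q t N" "finite F"
    show "(\<Sum>k\<in>F. japanese k powr (- \<sigma>) * t k) \<le> H * N"
    proof (cases "N = 0")
      case True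
      then have "t k = 0" for k using zero t by simp
      then show ?thesis using True by simp
    next
      case False
      then have "(\<Sum>k\<in>F. japanese k powr (- \<sigma>) * (t k / N)) \<le> H" using pos t by simp
      moreover have "(\<Sum>k\<in>F. japanese k powr (- \<sigma>) * (t k / N)) = (\<Sum>k\<in>F. japanese k powr (- \<sigma>) * t k) / N"
        by (simp add: sum_divide_distrib)
      ultimately show ?thesis using False t(2) by (simp add: divide_le_eq)
    qed
  qed
  show ?thesis
  proof (cases "q \<le> 1")
    case True
    have r1: "r \<le> 1" using True unfolding r(3) by simp
    have s0: "\<sigma> \<ge> 0" using \<sigma>1 True .
    show ?thesis
    proof (rule reduce[of 1])
      fix t :: "int^'n \<Rightarrow> real" and N :: real and F :: "(int^'n) set"
      assume t: "\<forall>k. 0 \<le> t k" "0 < N" "lq_bounded q t N" "finite F"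
      have "japanese k powr (- \<sigma>) * (t k / N) \<le> (t k / N) powr r" for k
      proof -
        have x0: "0 \<le> t k / N" using t by simp
        have "(\<Sum>k\<in>{k}. (t k / N) powr r) \<le> 1" by (rule normalized) (use t in auto)
        then have "(t k / N) powr r \<le> 1" by simp
        have x1: "t k / N \<le> 1"
        proof (rule ccontr)
          assume "\<not> t k / N \<le> 1"
          then have "1 powr r < (t k / N) powr r" using r(1) by (intro powr_less_mono2) auto
          then show False using \<open>(t k / N) powr r \<le> 1\<close> by simp
        qed
        have "japanese k powr (- \<sigma>) \<le> 1" using powr_mono[of "- \<sigma>" 0 "japanese k"] japanese_ge_1[of k] s0 by simp
        then have "japanese k powr (- \<sigma>) * (t k / N) \<le> 1 * (t k / N)" using x0 by (intro mult_right_mono)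
        also have "\<dots> \<le> (t k / N) powr r"
          using powr_interpolation_le_1[OF r(1) r1 x0 x1] by simp
        finally show ?thesis .
      qed
      then have "(\<Sum>k\<in>F. japanese k powr (- \<sigma>) * (t k / N)) \<le> (\<Sum>k\<in>F. (t k / N) powr r)" by (intro sum_mono)
      also have "\<dots> \<le> 1" by (rule normalized[OF t])
      finally show "(\<Sum>k\<in>F. japanese k powr (- \<sigma>) * (t k / N)) \<le> 1" .
    qed simp
  next
    case False
    then have "1 < q" by simp
    then have r1: "1 < r" 
    proof -
      have "ennreal 1 < ennreal r" using \<open>1 < q\<close> r(3) by simp
      then show ?thesis by (rule ennreal_less_iff[THEN iffD1, rotated]) simp
    qed
    \<comment> \<open>The conjugate exponent.\<close>
    define r' where "r' = r / (r - 1)"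
    have r': "r' > 0" "1 - 1 / r = 1 / r'" unfolding r'_def using r1 by (auto simp: field_simps)
    have "\<sigma> > real CARD('n) * (1 / r')" using \<sigma>2[OF \<open>1 < q\<close>] unfolding r(2) r'(2) .
    then have "\<sigma> * r' > real CARD('n)" using r'(1) by (simp add: field_simps)
    then obtain H where H: "H > 0" "\<forall>F :: (int^'n) set. finite F \<longrightarrow> (\<Sum>k\<in>F. japanese k powr (- (\<sigma> * r'))) \<le> H"
      using lattice_sum_bounded[of "\<sigma> * r'", where ?'n = 'n] by auto
    show ?thesis
    proof (rule reduce[of "1 + H"])
      fix t :: "int^'n \<Rightarrow> real" and N :: real and F :: "(int^'n) set"
      assume t: "\<forall>k. 0 \<le> t k" "0 < N" "lq_bounded q t N" "finite F"
      have "japanese k powr (- \<sigma>) * (t k / N) \<le> (t k / N) powr r + japanese k powr (- (\<sigma> * r'))" for k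
        using powr_young[of "t k / N" "japanese k powr (- \<sigma>)" r r'] t r1 by (simp add: r'_def powr_powr mult.commute)
      then have "(\<Sum>k\<in>F. japanese k powr (- \<sigma>) * (t k / N)) \<le> (\<Sum>k\<in>F. (t k / N) powr r + japanese k powr (- (\<sigma> * r')))"
        by (intro sum_mono)
      also have "\<dots> = (\<Sum>k\<in>F. (t k / N) powr r) + (\<Sum>k\<in>F. japanese k powr (- (\<sigma> * r')))" by (rule sum.distrib)
      also have "\<dots> \<le> 1 + H" using normalized[OF t] H(2) t(4) by (intro add_mono) auto
      finally show "(\<Sum>k\<in>F. japanese k powr (- \<sigma>) * (t k / N)) \<le> 1 + H" .
    qed (use H in simp)
  qed
qed

section \<open>Sufficiency\<close>

text \<open>A finite modulation norm makes every piece finite, and the weighted sequence of the norms of the pieces has this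
  norm in \<open>l^q\<close>.\<close>

lemma modulation_norm_coefficients:
  fixes \<eta> :: "int^'n::finite \<Rightarrow> real^'n \<Rightarrow> complex"
  assumes q: "0 < q" and fin: "modulation_norm \<eta> \<alpha> s p q u < top"
  shows "Lp_norm_distr p (Defs.box \<eta> k u) < top"
    and "lq_bounded q (\<lambda>k. japanese k powr (s / (1 - \<alpha>)) * enn2real (Lp_norm_distr p (Defs.box \<eta> k u)))
      (enn2real (modulation_norm \<eta> \<alpha> s p q u))"
proof -
  let ?a = "\<lambda>k. Lp_norm_distr p (Defs.box \<eta> k u)"
  let ?w = "\<lambda>k. japanese k powr (s / (1 - \<alpha>))"
  let ?N = "modulation_norm \<eta> \<alpha> s p q u"
  have w: "?w k > 0" for k using japanese_pos[of k] by simp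
  have both: "(\<forall>k. ?a k < top) \<and> lq_bounded q (\<lambda>k. ?w k * enn2real (?a k)) (enn2real ?N)"
  proof (cases "q = top")
    case True
    have le: "ennreal (?w k) * ?a k \<le> ?N" for k
      using True unfolding modulation_norm_def by (auto intro: SUP_upper)
    have f: "?a k < top" for k
    proof (rule ccontr)
      assume "\<not> ?a k < top"
      then have "ennreal (?w k) * ?a k = top" using w[of k] by (simp add: less_top[symmetric] ennreal_mult_top)
      then show False using le[of k] fin by (simp add: top_unique)
    qed
    have "?w k * enn2real (?a k) \<le> enn2real ?N" for k
    proof -
      have "enn2real (ennreal (?w k) * ?a k) \<le> enn2real ?N" using le fin by (intro enn2real_mono)
      then show ?thesis using w[of k] by (simp add: enn2real_mult)
    qed
    then show ?thesis using f True unfolding lq_bounded_def by simp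
  next
    case False
    define r where "r = enn2real q"
    have r: "0 < r" "enn2real (1 / q) = 1 / r" unfolding r_def using enn2real_inverse[OF q False] by auto
    let ?e = "\<lambda>k. ennreal (japanese k powr (s * r / (1 - \<alpha>))) * ennreal_powr (?a k) r"
    define S where "S = (\<Sum>\<^sub>\<infinity>k. ?e k)"
    have N: "?N = ennreal_powr S (1 / r)"
      unfolding modulation_norm_def S_def r(2) r_def[symmetric] using False by simp
    have S: "S < top" using fin unfolding N ennreal_powr_def by (auto simp: less_top split: if_splits)
    have part: "(\<Sum>k\<in>F. ?e k) \<le> S" if "finite F" for F
      unfolding S_def using that by (subst nonneg_infsum_complete) (auto intro: SUP_upper)
    have f: "?a k < top" for k
    proof (rule ccontr)
      assume "\<not> ?a k < top"
      then have "?e k = top" using japanese_pos[of k] by (simp add: less_top[symmetric] ennreal_powr_def ennreal_mult_top)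
      then show False using part[of "{k}"] S by (simp add: top_unique)
    qed
    have e: "?e k = ennreal ((?w k * enn2real (?a k)) powr r)" for k
    proof -
      have "(?w k * enn2real (?a k)) powr r = japanese k powr (s * r / (1 - \<alpha>)) * enn2real (?a k) powr r"
        by (simp add: powr_mult powr_powr)
      then show ?thesis using f[of k] unfolding ennreal_powr_def by (simp add: ennreal_mult)
    qed
    have "(\<Sum>k\<in>F. (?w k * enn2real (?a k)) powr r) \<le> enn2real ?N powr r" if "finite F" for F
    proof -
      have hS: "ennreal (\<Sum>k\<in>F. (?w k * enn2real (?a k)) powr r) \<le> S"
        using part[OF that] unfolding e by (simp add: sum_ennreal)
      have "(\<Sum>k\<in>F. (?w k * enn2real (?a k)) powr r) \<le> enn2real S"
        using enn2real_mono[OF hS S] by (simp only: enn2real_ennreal[OF sum_nonneg[OF powr_ge_zero]])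
      moreover have "enn2real ?N = enn2real S powr (1 / r)" unfolding N ennreal_powr_def using S by simp
      ultimately show ?thesis using r(1) by (simp add: powr_powr)
    qed
    then show ?thesis using f False unfolding lq_bounded_def r_def by simp
  qed
  from both show "?a k < top" by (elim conjE allE)
  from both show "lq_bounded q (\<lambda>k. ?w k * enn2real (?a k)) (enn2real ?N)" by (elim conjE)
qed

context alpha_decomposition
begin

lemma lattice_ball_eventually:
  "filterlim (\<lambda>N. lattice_ball (real N)) (finite_subsets_at_top UNIV) sequentially"
  unfolding filterlim_finite_subsets_at_top
proof (intro allI impI)
  fix F :: "(int^'n) set" assume F: "finite F \<and> F \<subseteq> UNIV"
  define N0 where "N0 = nat \<lceil>\<Sum>k\<in>F. norm (lattice_vec k)\<rceil>"
  have "F \<subseteq> lattice_ball (real N)" if "N \<ge> N0" for N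
  proof
    fix k assume k: "k \<in> F"
    have "norm (lattice_vec k) \<le> (\<Sum>k\<in>F. norm (lattice_vec k))" using F k by (intro member_le_sum) auto
    also have "\<dots> \<le> real N0" unfolding N0_def by (rule real_nat_ceiling_ge)
    also have "\<dots> \<le> real N" using that by simp
    finally show "k \<in> lattice_ball (real N)" unfolding lattice_ball_def by simp
  qed
  then show "\<forall>\<^sub>F N in sequentially. finite (lattice_ball (real N)) \<and> F \<subseteq> lattice_ball (real N) \<and> lattice_ball (real N) \<subseteq> UNIV"
    using finite_ball by (intro eventually_sequentiallyI[of N0]) auto
qed

text \<open>Absolute summability gives a pointwise limit \<open>G\<close> of the partial sums, bounded by \<open>L\<close>. Dominated convergence identifies
  the pairing with \<open>G\<close> as the limit of the partial sums of the decomposition, which is \<open>u\<close>.\<close>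

lemma bounded_pieces_sum:
  assumes u: "u \<in> tempered" and g: "\<And>k. represents (g k) (Defs.box \<eta> k u)"
    and M: "\<And>k. AE x in lborel. norm (g k x) \<le> M k" and M0: "\<And>k. 0 \<le> M k"
    and L: "\<And>F. finite F \<Longrightarrow> (\<Sum>k\<in>F. M k) \<le> L"
  shows "u \<in> Linfty \<and> Lp_norm_distr top u \<le> ennreal L"
proof -
  define GN where "GN N x = (\<Sum>k\<in>lattice_ball (real N). g k x)" for N x
  define G where "G x = lim (\<lambda>N. GN N x)" for x
  have gm[measurable]: "g k \<in> borel_measurable borel" for k using g[of k] unfolding represents_def by simp
  have GNm[measurable]: "GN N \<in> borel_measurable borel" for N unfolding GN_def by measurable
  have Gm: "G \<in> borel_measurable borel" unfolding G_def by (rule borel_measurable_lim_metric) measurable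
  have "AE x in lborel. \<forall>k. norm (g k x) \<le> M k" using M by (simp add: AE_all_countable)
  then have ae: "AE x in lborel. (\<forall>N. norm (GN N x) \<le> L) \<and> (\<lambda>N. GN N x) \<longlonglongrightarrow> G x"
  proof eventually_elim
    case (elim x)
    have le: "(\<Sum>k\<in>F. norm (g k x)) \<le> L" if "finite F" for F
    proof -
      have "(\<Sum>k\<in>F. norm (g k x)) \<le> (\<Sum>k\<in>F. M k)" using elim by (intro sum_mono) auto
      then show ?thesis using L[OF that] by linarith
    qed
    have "(\<lambda>k. norm (g k x)) summable_on UNIV"
      by (rule nonneg_bdd_above_summable_on) (auto intro!: bdd_aboveI2[where M = L] le)
    then have "(\<lambda>k. g k x) summable_on UNIV" by (rule abs_summable_summable)
    then obtain S where "((\<lambda>k. g k x) has_sum S) UNIV" by (auto simp: summable_on_def)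
    then have "(\<lambda>N. GN N x) \<longlonglongrightarrow> S"
      unfolding has_sum_def GN_def by (rule filterlim_compose[OF _ lattice_ball_eventually])
    then have "(\<lambda>N. GN N x) \<longlonglongrightarrow> G x" unfolding G_def by (simp add: limI)
    moreover have "norm (GN N x) \<le> L" for N
      unfolding GN_def by (rule order_trans[OF norm_sum le[OF finite_ball]])
    ultimately show ?case by simp
  qed
  have GL: "AE x in lborel. norm (G x) \<le> L"
    using ae
  proof eventually_elim
    case (elim x)
    have "(\<lambda>N. norm (GN N x)) \<longlonglongrightarrow> norm (G x)" using elim by (intro tendsto_norm) simp
    then show ?case by (rule LIMSEQ_le_const2) (use elim in auto)
  qed
  have rep: "represents G u"
    unfolding represents_def
  proof (intro conjI ballI)
    show "G \<in> borel_measurable lborel" using Gm by simp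
    fix \<phi> :: "real^'n \<Rightarrow> complex" assume \<phi>: "\<phi> \<in> schwartz"
    note [measurable] = schwartz_measurable[OF \<phi>] Gm
    have dom: "integrable lborel (\<lambda>x. L * norm (\<phi> x))"
      by (intro integrable_mult_right integrable_norm schwartz_integrable \<phi>)
    have lim: "AE x in lborel. (\<lambda>N. GN N x * \<phi> x) \<longlonglongrightarrow> G x * \<phi> x"
      using ae by eventually_elim (intro tendsto_mult_right, simp)
    have bd: "AE x in lborel. norm (GN N x * \<phi> x) \<le> L * norm (\<phi> x)" for N
      using ae by eventually_elim (simp add: norm_mult mult_right_mono)
    show "integrable lborel (\<lambda>x. G x * \<phi> x)" by (rule integrable_dominated_convergence[OF _ _ dom lim bd]) measurable
    have "(\<lambda>N. LINT x|lborel. GN N x * \<phi> x) \<longlonglongrightarrow> (LINT x|lborel. G x * \<phi> x)"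
      by (rule integral_dominated_convergence[OF _ _ dom lim bd]) measurable
    moreover have "(LINT x|lborel. GN N x * \<phi> x) = (\<Sum>k\<in>lattice_ball (real N). Defs.box \<eta> k u \<phi>)" for N
    proof -
      have "integrable lborel (\<lambda>x. g k x * \<phi> x)" "Defs.box \<eta> k u \<phi> = (LINT x|lborel. g k x * \<phi> x)" for k
        using g[of k] \<phi> unfolding represents_def by auto
      then show ?thesis unfolding GN_def sum_distrib_right by simp
    qed
    ultimately have "(\<lambda>N. \<Sum>k\<in>lattice_ball (real N). Defs.box \<eta> k u \<phi>) \<longlonglongrightarrow> (LINT x|lborel. G x * \<phi> x)" by simp
    then show "u \<phi> = (LINT x|lborel. G x * \<phi> x)"
      using decomposition_converges[OF u \<phi>] by (rule LIMSEQ_unique[rotated])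
  qed
  have "Lp_norm_distr top u = Lp_norm top G" by (rule Lp_norm_distr_eq[OF rep])
  also have "\<dots> \<le> ennreal L"
    unfolding Lp_norm_def if_P[OF refl]
  proof (rule esssup_I)
    show "(\<lambda>x. ennreal (norm (G x))) \<in> borel_measurable lborel" using Gm by measurable
    show "AE x in lborel. ennreal (norm (G x)) \<le> ennreal L"
      using GL by eventually_elim (rule ennreal_leI)
  qed
  finally have "Lp_norm_distr top u \<le> ennreal L" .
  moreover then have "Lp_norm_distr top u < top" by (rule order.strict_trans1) simp
  ultimately show ?thesis using u unfolding Linfty_def by simp
qed

text \<open>The Nikolskii factor \<open>r_k^(n/p)\<close> equals \<open>\<langle>k\<rangle>^(-\<sigma>) \<langle>k\<rangle>^(s/(1-\<alpha>))\<close>, so the sup norms of the pieces are at most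
  \<open>\<langle>k\<rangle>^(-\<sigma>)\<close> times a sequence whose \<open>l^q\<close> norm is the modulation norm.\<close>

theorem embedding_sufficient:
  assumes p: "0 < p" and q: "0 < q"
    and s: "s \<ge> real CARD('n) * \<alpha> * enn2real (1 / p) + (1 - \<alpha>) * B_index CARD('n) top q"
    and s': "q > 1 \<Longrightarrow> s > real CARD('n) * \<alpha> * enn2real (1 / p) + (1 - \<alpha>) * B_index CARD('n) top q"
  shows "embeds (modulation_space \<eta> \<alpha> s p q) (modulation_norm \<eta> \<alpha> s p q) Linfty (Lp_norm_distr top)"
proof -
  let ?n = "real CARD('n)"
  define \<sigma> where "\<sigma> = (s - ?n * \<alpha> * enn2real (1 / p)) / (1 - \<alpha>)"
  have B: "B_index CARD('n) top q \<ge> 0" "B_index CARD('n) top q \<ge> ?n * (1 - enn2real (1 / q))"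
    unfolding B_index_def by (auto intro!: Max_ge)
  have "\<sigma> \<ge> B_index CARD('n) top q" using s \<alpha>1 unfolding \<sigma>_def by (simp add: le_divide_eq mult.commute)
  then have \<sigma>1: "q \<le> 1 \<longrightarrow> \<sigma> \<ge> 0" using B by linarith
  have \<sigma>2: "q > 1 \<longrightarrow> \<sigma> > ?n * (1 - enn2real (1 / q))"
  proof
    assume "q > 1"
    have "\<sigma> > B_index CARD('n) top q" using s'[OF \<open>q > 1\<close>] \<alpha>1 unfolding \<sigma>_def by (simp add: less_divide_eq mult.commute)
    then show "\<sigma> > ?n * (1 - enn2real (1 / q))" using B by linarith
  qed
  obtain H where H: "H > 0" "\<forall>(t :: int^'n \<Rightarrow> real) N. (\<forall>k. 0 \<le> t k) \<longrightarrow> 0 \<le> N \<longrightarrow> lq_bounded q t N \<longrightarrow>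
    (\<forall>F. finite F \<longrightarrow> (\<Sum>k\<in>F. japanese k powr (- \<sigma>) * t k) \<le> H * N)"
    using discrete_hoelder[OF q \<sigma>1 \<sigma>2] by (elim exE conjE)
  obtain A where A: "A > 0" "\<forall>k u g. represents g (Defs.box \<eta> k u) \<longrightarrow>
    Lp_norm top g \<le> ennreal (A * radius k powr (?n * enn2real (1 / p))) * Lp_norm p g"
    using nikolskii[OF p] by (elim exE conjE)
  have main: "u \<in> Linfty \<and> Lp_norm_distr top u \<le> ennreal (A * H) * modulation_norm \<eta> \<alpha> s p q u"
    if u: "u \<in> modulation_space \<eta> \<alpha> s p q" for u
  proof -
    let ?a = "\<lambda>k. Lp_norm_distr p (Defs.box \<eta> k u)"
    define N where "N = enn2real (modulation_norm \<eta> \<alpha> s p q u)"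
    have ut: "u \<in> tempered" and fin: "modulation_norm \<eta> \<alpha> s p q u < top"
      using u unfolding modulation_space_def by auto
    have N: "modulation_norm \<eta> \<alpha> s p q u = ennreal N" "0 \<le> N" unfolding N_def using fin by auto
    define t where "t k = japanese k powr (s / (1 - \<alpha>)) * enn2real (?a k)" for k
    have a: "?a k < top" for k by (rule modulation_norm_coefficients(1)[OF q fin])
    have lq: "lq_bounded q t N" unfolding t_def N_def by (rule modulation_norm_coefficients(2)[OF q fin])
    have "\<forall>k. \<exists>g. represents g (Defs.box \<eta> k u) \<and> Lp_norm p g = ?a k" by (intro allI Lp_norm_distr_finite[OF a])
    then obtain g where g: "\<forall>k. represents (g k) (Defs.box \<eta> k u) \<and> Lp_norm p (g k) = ?a k" by (rule choice[THEN exE])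
    define M where "M k = A * (japanese k powr (- \<sigma>) * t k)" for k
    have M: "AE x in lborel. norm (g k x) \<le> M k" for k
    proof -
      have "A * radius k powr (?n * enn2real (1 / p)) * enn2real (?a k) = M k"
      proof -
        have "radius k powr (?n * enn2real (1 / p)) = japanese k powr (- \<sigma>) * japanese k powr (s / (1 - \<alpha>))"
        proof -
          have "\<alpha> / (1 - \<alpha>) * (?n * enn2real (1 / p)) = - \<sigma> + s / (1 - \<alpha>)"
            unfolding \<sigma>_def by (simp add: diff_divide_distrib mult_ac)
          then show ?thesis unfolding radius_def powr_powr powr_add[symmetric] by simp
        qed
        then show ?thesis unfolding M_def t_def by simp
      qed
      moreover have "Lp_norm top (g k) \<le> ennreal (A * radius k powr (?n * enn2real (1 / p))) * ?a k"
        using A(2)[rule_format, OF conjunct1[OF g[rule_format]], of k] conjunct2[OF g[rule_format], of k] by simp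
      moreover have "?a k = ennreal (enn2real (?a k))" using a[of k] by simp
      ultimately have "Lp_norm top (g k) \<le> ennreal (A * radius k powr (?n * enn2real (1 / p))) * ennreal (enn2real (?a k))"
        by simp
      also have "\<dots> = ennreal (M k)"
        unfolding \<open>_ = M k\<close>[symmetric] using A(1) by (simp add: ennreal_mult)
      finally have "Lp_norm top (g k) \<le> ennreal (M k)" .
      note le = this
      have "AE x in lborel. ennreal (norm (g k x)) \<le> Lp_norm top (g k)"
        unfolding Lp_norm_def if_P[OF refl] by (rule esssup_AE)
      then have "AE x in lborel. ennreal (norm (g k x)) \<le> ennreal (M k)"
        by eventually_elim (rule order_trans[OF _ le])
      moreover have "0 \<le> M k" unfolding M_def t_def using A(1) by simp
      ultimately show ?thesis by (simp add: ennreal_le_iff)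
    qed
    have "u \<in> Linfty \<and> Lp_norm_distr top u \<le> ennreal (A * H * N)"
    proof (rule bounded_pieces_sum[OF ut _ M])
      show "represents (g k) (Defs.box \<eta> k u)" for k using g by blast
      show "0 \<le> M k" for k unfolding M_def t_def using A(1) by simp
      fix F :: "(int^'n) set" assume F: "finite F"
      have "\<forall>k. 0 \<le> t k" unfolding t_def by simp
      then have "(\<Sum>k\<in>F. japanese k powr (- \<sigma>) * t k) \<le> H * N" using H(2)[rule_format, OF _ N(2) lq F] by simp
      then show "(\<Sum>k\<in>F. M k) \<le> A * H * N"
        unfolding M_def sum_distrib_left[symmetric] using A(1) by (simp add: mult.assoc mult_left_mono)
    qed
    then show ?thesis unfolding N(1) using A(1) H(1) N(2) by (simp add: ennreal_mult)
  qed
  show ?thesis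
    unfolding embeds_def using main A(1) H(1) by (intro conjI subsetI exI[of _ "A * H"] ballI) auto
qed

end

section \<open>Necessity\<close>

text \<open>Scaling: a bump of height \<open>c\<close> concentrated on the scale \<open>1/r\<close> has \<open>L^p\<close> norm of order \<open>c r^(-n/p)\<close>. The decay exponent
  \<open>m\<close> is chosen with \<open>m p \<ge> 2 n\<close> so that the \<open>p\<close>-th power is integrable, also for small \<open>p\<close>.\<close>

lemma Lp_norm_of_decay:
  fixes p :: ennreal
  assumes p: "0 < p"
  shows "\<exists>m. \<exists>W>0. \<forall>(g :: real^'n::finite \<Rightarrow> complex) c r. g \<in> borel_measurable borel \<longrightarrow> 0 \<le> c \<longrightarrow> 0 < r \<longrightarrow>
    (\<forall>x. norm (g x) \<le> c * (1 / (1 + r * norm x) ^ m)) \<longrightarrow>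
    Lp_norm p g \<le> ennreal (c * W * r powr (- (real CARD('n) * enn2real (1 / p))))"
proof (cases "p = top")
  case True
  have "Lp_norm p g \<le> ennreal (c * 1 * r powr (- (real CARD('n) * enn2real (1 / p))))"
    if [measurable]: "g \<in> borel_measurable borel" and r: "0 < r" and le: "\<forall>x. norm (g x) \<le> c * (1 / (1 + r * norm x) ^ 0)"
    for g :: "real^'n \<Rightarrow> complex" and c r
    unfolding Lp_norm_def if_P[OF True]
    by (rule esssup_I) (use le r True in \<open>auto intro!: ennreal_leI\<close>)
  then show ?thesis by (intro exI[of _ 0] exI[of _ 1] conjI allI impI) simp_all
next
  case False
  define q where "q = enn2real p"
  have q: "0 < q" "enn2real (1 / p) = 1 / q" unfolding q_def using enn2real_inverse[OF p False] by auto
  let ?n = "CARD('n)"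
  define m where "m = nat \<lceil>2 * real ?n / q\<rceil>"
  have mq: "2 * real ?n \<le> real m * q"
  proof -
    have "2 * real ?n / q \<le> real m" unfolding m_def by (rule real_nat_ceiling_ge)
    then show ?thesis using q by (simp add: divide_le_eq)
  qed
  define V where "V = (LINT x|lborel. 1 / (1 + norm (x :: real^'n)) ^ (2 * ?n))"
  define W where "W = (V + 1) powr (1 / q)"
  have V: "V \<ge> 0" unfolding V_def by (intro Bochner_Integration.integral_nonneg) auto
  have W: "W > 0" unfolding W_def using V by simp
  have "Lp_norm p g \<le> ennreal (c * W * r powr (- (real ?n * enn2real (1 / p))))"
    if [measurable]: "g \<in> borel_measurable borel" and c: "0 \<le> c" and r: "0 < r"
      and le: "\<forall>x. norm (g x) \<le> c * (1 / (1 + r * norm x) ^ m)"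
    for g :: "real^'n \<Rightarrow> complex" and c r
  proof -
    have pt: "norm (g x) powr q \<le> c powr q * (1 / (1 + norm (0 + r *\<^sub>R x)) ^ (2 * ?n))" for x
    proof -
      let ?b = "1 + r * norm x"
      have b: "1 \<le> ?b" using r by simp
      have "norm (g x) powr q \<le> (c * (1 / ?b ^ m)) powr q" using le q by (intro powr_mono2) auto
      also have "\<dots> = c powr q * (?b powr (- (real m * q)))"
      proof -
        have "1 / ?b ^ m = ?b powr (- real m)" using b by (simp add: powr_minus_divide powr_realpow)
        then show ?thesis using b c by (simp add: powr_mult powr_powr)
      qed
      also have "\<dots> \<le> c powr q * (?b powr (- (2 * real ?n)))"
        using mq b by (intro mult_left_mono powr_mono) auto
      also have "?b powr (- (2 * real ?n)) = 1 / ?b ^ (2 * ?n)"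
        using b powr_realpow[of ?b "2 * ?n"] by (simp add: powr_minus_divide)
      finally show ?thesis using r by simp
    qed
    have iV: "integrable lborel (\<lambda>x::real^'n. 1 / (1 + norm x) ^ (2 * ?n))" by (rule integrable_inverse_weight)
    have ir: "integrable lborel (\<lambda>x::real^'n. 1 / (1 + norm (0 + r *\<^sub>R x)) ^ (2 * ?n))"
      using integrable_affine[OF iV, of r 0] r by simp
    have Vr: "(LINT x|lborel. 1 / (1 + norm (0 + r *\<^sub>R (x :: real^'n))) ^ (2 * ?n)) = V / r ^ ?n"
      using integral_affine[OF iV, of r 0] r unfolding V_def by (simp add: field_simps)
    have "(\<integral>\<^sup>+x. ennreal (norm (g x) powr q) \<partial>lborel) \<le> (\<integral>\<^sup>+x. ennreal (c powr q * (1 / (1 + norm (0 + r *\<^sub>R (x :: real^'n))) ^ (2 * ?n))) \<partial>lborel)"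
      using pt by (intro nn_integral_mono ennreal_leI)
    also have "\<dots> = ennreal (LINT x|lborel. c powr q * (1 / (1 + norm (0 + r *\<^sub>R (x :: real^'n))) ^ (2 * ?n)))"
      by (intro nn_integral_eq_integral integrable_mult_right ir) auto
    also have "\<dots> = ennreal (c powr q * (V / r ^ ?n))" unfolding integral_mult_right_zero Vr ..
    also have "\<dots> \<le> ennreal (c powr q * ((V + 1) / r ^ ?n))"
      using r by (intro ennreal_leI mult_left_mono divide_right_mono) auto
    finally have I: "(\<integral>\<^sup>+x. ennreal (norm (g x) powr q) \<partial>lborel) \<le> ennreal (c powr q * ((V + 1) / r ^ ?n))" .
    then have fin: "(\<integral>\<^sup>+x. ennreal (norm (g x) powr q) \<partial>lborel) < top" by (rule order.strict_trans1) simp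
    have "enn2real (\<integral>\<^sup>+x. ennreal (norm (g x) powr q) \<partial>lborel) \<le> c powr q * ((V + 1) / r ^ ?n)"
      using V r by (intro enn2real_leI I) simp
    then have "enn2real (\<integral>\<^sup>+x. ennreal (norm (g x) powr q) \<partial>lborel) powr (1 / q) \<le> (c powr q * ((V + 1) / r ^ ?n)) powr (1 / q)"
      using q by (intro powr_mono2) auto
    also have "\<dots> = c * W * r powr (- (real ?n * (1 / q)))"
    proof -
      have "(r ^ ?n) powr (1 / q) = r powr (real ?n * (1 / q))"
        using r by (simp add: powr_realpow[symmetric] powr_powr)
      then show ?thesis using c q r V unfolding W_def by (simp add: powr_mult powr_divide powr_powr powr_minus_divide)
    qed
    finally have "ennreal (enn2real (\<integral>\<^sup>+x. ennreal (norm (g x) powr q) \<partial>lborel) powr (1 / q)) \<le> ennreal (c * W * r powr (- (real ?n * (1 / q))))"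
      by (rule ennreal_leI)
    then show ?thesis
      using fin[THEN less_imp_neq] False unfolding Lp_norm_def ennreal_powr_def q(2) q_def[symmetric] by simp
  qed
  note * = this
  show ?thesis by (intro exI[of _ m] exI[of _ W] conjI allI impI W) (rule *)
qed

lemma continuous_AE_le:
  fixes f :: "'a::euclidean_space \<Rightarrow> complex"
  assumes f: "continuous_on UNIV f" and le: "AE x in lborel. norm (f x) \<le> M"
  shows "norm (f x) \<le> M"
proof (rule ccontr)
  assume "\<not> ?thesis"
  then have ne: "{x. M < norm (f x)} \<noteq> {}" by (auto simp: not_le)
  have op: "open {x. M < norm (f x)}" using f by (intro open_Collect_less continuous_intros)
  have "{x. M < norm (f x)} \<in> null_sets lborel"
  proof -
    have "AE x in lborel. x \<notin> {x. M < norm (f x)}" using le by eventually_elim simp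
    then show ?thesis using op by (subst (asm) AE_iff_null_sets[symmetric]) auto
  qed
  then have "negligible {x. M < norm (f x)}"
    using op by (simp add: negligible_iff_null_sets null_sets_completion_iff)
  then show False using open_not_negligible[OF op ne] by blast
qed

text \<open>The dyadic cube of side \<open>2^m\<close> contains \<open>2^(m n)\<close> lattice points of size at most a constant times \<open>2^m\<close>, so each of these
  disjoint cubes contributes at least a fixed amount.\<close>

lemma lattice_sum_unbounded:
  "\<exists>F :: (int^'n::finite) set. finite F \<and> H < (\<Sum>k\<in>F. japanese k powr (- real CARD('n)))"
proof -
  let ?n = "CARD('n)"
  define Q :: "nat \<Rightarrow> (int^'n) set" where "Q m = vec_lambda ` ((UNIV :: 'n set) \<rightarrow>\<^sub>E {2 ^ m..<2 ^ Suc m})" for m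
  have finQ: "finite (Q m)" for m unfolding Q_def by (intro finite_imageI finite_PiE) auto
  have inj: "inj_on vec_lambda A" for A :: "('n \<Rightarrow> int) set"
    by (rule inj_onI) (metis UNIV_I vec_lambda_inverse)
  have cardQ: "card (Q m) = (2 ^ m) ^ ?n" for m
    unfolding Q_def card_image[OF inj] by (simp add: card_PiE nat_power_eq)
  have Qi: "2 ^ m \<le> k $ i \<and> k $ i < 2 ^ Suc m" if "k \<in> Q m" for k i m
    using that unfolding Q_def by (auto simp: PiE_iff)
  define c where "c = (2 * real ?n + 1) powr (- real ?n)"
  have c: "c > 0" unfolding c_def by simp
  have QS: "c \<le> (\<Sum>k\<in>Q m. japanese k powr (- real ?n))" for m
  proof -
    have le: "c * (2 ^ m) powr (- real ?n) \<le> japanese k powr (- real ?n)" if k: "k \<in> Q m" for k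
    proof -
      have "norm (lattice_vec k) \<le> (\<Sum>i\<in>UNIV. \<bar>lattice_vec k $ i\<bar>)" by (rule norm_le_l1_cart)
      also have "\<dots> \<le> (\<Sum>i\<in>(UNIV :: 'n set). 2 ^ Suc m)"
      proof (rule sum_mono)
        fix i
        have "\<bar>k $ i\<bar> \<le> 2 ^ Suc m" using Qi[OF k, of i] order_trans[OF zero_le_power[of "2::int" m], of "k $ i"] by simp
        then have "real_of_int \<bar>k $ i\<bar> \<le> real_of_int (2 ^ Suc m)" by (simp only: of_int_le_iff)
        then show "\<bar>lattice_vec k $ i\<bar> \<le> 2 ^ Suc m" by (simp add: lattice_vec_def)
      qed
      finally have "japanese k \<le> 1 + real ?n * 2 ^ Suc m" using japanese_le[of k] by simp
      also have "\<dots> \<le> (2 * real ?n + 1) * 2 ^ m" by (simp add: algebra_simps)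
      finally have "((2 * real ?n + 1) * 2 ^ m) powr (- real ?n) \<le> japanese k powr (- real ?n)"
        using japanese_pos[of k] by (intro powr_mono2') auto
      then show ?thesis unfolding c_def by (simp add: powr_mult)
    qed
    have "c = (\<Sum>k\<in>Q m. c * (2 ^ m) powr (- real ?n))"
    proof -
      have "(2 ^ m) powr (- real ?n) = 1 / (2 ^ m) ^ ?n"
        using powr_realpow[of "2 ^ m" ?n] by (simp add: powr_minus_divide)
      then show ?thesis by (simp add: cardQ)
    qed
    also have "\<dots> \<le> (\<Sum>k\<in>Q m. japanese k powr (- real ?n))" by (intro sum_mono le)
    finally show ?thesis .
  qed
  have disj: "Q m \<inter> Q m' = {}" if "m \<noteq> m'" for m m'
  proof (rule ccontr)
    assume "Q m \<inter> Q m' \<noteq> {}"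
    then obtain k where k: "k \<in> Q m" "k \<in> Q m'" by blast
    let ?x = "k $ undefined"
    have x: "2 ^ m \<le> ?x" "?x < 2 ^ Suc m" "2 ^ m' \<le> ?x" "?x < 2 ^ Suc m'" using Qi k by blast+
    then have "(2::int) ^ m < 2 ^ Suc m'" "(2::int) ^ m' < 2 ^ Suc m" by linarith+
    then have "m < Suc m'" "m' < Suc m" using power_strict_increasing_iff[of "2::int" m "Suc m'"] power_strict_increasing_iff[of "2::int" m' "Suc m"] by auto
    then show False using that by simp
  qed
  obtain M :: nat where M: "H < real M * c" using reals_Archimedean3[OF c] by blast
  have "real M * c = (\<Sum>m<M. c)" by simp
  also have "\<dots> \<le> (\<Sum>m<M. \<Sum>k\<in>Q m. japanese k powr (- real ?n))" by (intro sum_mono QS)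
  also have "\<dots> = (\<Sum>k\<in>(\<Union>m<M. Q m). japanese k powr (- real ?n))"
    using finQ disj by (intro sum.UNION_disjoint[symmetric]) auto
  finally show ?thesis using M finQ by (intro exI[of _ "\<Union>m<M. Q m"]) auto
qed

lemma japanese_unbounded: "\<exists>k :: int^'n::finite. H < japanese k"
proof -
  obtain N :: nat where N: "H < real N" using reals_Archimedean2 by blast
  define k :: "int^'n" where "k = (\<chi> i. int N)"
  have "real N = \<bar>lattice_vec k $ undefined\<bar>" unfolding k_def lattice_vec_def by simp
  also have "\<dots> \<le> norm (lattice_vec k)" by (rule component_le_norm_cart)
  also have "\<dots> \<le> japanese k" by (rule norm_lattice_vec_le)
  finally show ?thesis using N by (intro exI[of _ k]) simp
qed

context alpha_decomposition
begin

text \<open>For a function given by its Fourier transform, the piece is obtained by multiplying the transform with \<open>\<eta> j\<close>.\<close>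

lemma represents_box:
  assumes \<Psi>: "\<Psi> \<in> schwartz"
  shows "represents (inv_fourier (\<lambda>\<xi>. \<eta> j \<xi> * \<Psi> \<xi>))
    (Defs.box \<eta> j (\<lambda>\<phi>\<in>schwartz. LINT x|lborel. inv_fourier \<Psi> x * \<phi> x))"
  unfolding represents_def
proof (intro conjI ballI)
  have s: "(\<lambda>\<xi>. \<eta> j \<xi> * \<Psi> \<xi>) \<in> schwartz" by (intro schwartz_mult \<eta>_schwartz \<Psi>)
  then show "inv_fourier (\<lambda>\<xi>. \<eta> j \<xi> * \<Psi> \<xi>) \<in> borel_measurable lborel"
    using schwartz_measurable[OF schwartz_inv_fourier[OF s]] by simp
  fix \<phi> :: "real^'n \<Rightarrow> complex" assume \<phi>: "\<phi> \<in> schwartz"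
  show "integrable lborel (\<lambda>x. inv_fourier (\<lambda>\<xi>. \<eta> j \<xi> * \<Psi> \<xi>) x * \<phi> x)"
    by (intro schwartz_integrable schwartz_mult schwartz_inv_fourier s \<phi>)
  have e: "(\<lambda>\<xi>. \<eta> j \<xi> * inv_fourier \<phi> \<xi>) \<in> schwartz" by (intro schwartz_mult \<eta>_schwartz schwartz_inv_fourier \<phi>)
  have "Defs.box \<eta> j (\<lambda>\<phi>\<in>schwartz. LINT x|lborel. inv_fourier \<Psi> x * \<phi> x) \<phi> =
      (LINT x|lborel. inv_fourier \<Psi> x * fourier (\<lambda>\<xi>. \<eta> j \<xi> * inv_fourier \<phi> \<xi>) x)"
    by (simp add: box_apply[of \<eta> j, OF \<eta>_schwartz \<phi>] schwartz_fourier[OF e])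
  also have "\<dots> = (LINT \<xi>|lborel. \<Psi> \<xi> * inv_fourier (fourier (\<lambda>\<xi>. \<eta> j \<xi> * inv_fourier \<phi> \<xi>)) \<xi>)"
    by (rule inv_fourier_multiplication_formula[OF \<Psi> schwartz_fourier[OF e]])
  also have "\<dots> = (LINT \<xi>|lborel. (\<eta> j \<xi> * \<Psi> \<xi>) * inv_fourier \<phi> \<xi>)"
    unfolding fourier_inversion[OF e] by (simp add: mult_ac)
  also have "\<dots> = (LINT x|lborel. inv_fourier (\<lambda>\<xi>. \<eta> j \<xi> * \<Psi> \<xi>) x * \<phi> x)"
    by (rule inv_fourier_multiplication_formula[OF s \<phi>, symmetric])
  finally show "Defs.box \<eta> j (\<lambda>\<phi>\<in>schwartz. LINT x|lborel. inv_fourier \<Psi> x * \<phi> x) \<phi> =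
      (LINT x|lborel. inv_fourier (\<lambda>\<xi>. \<eta> j \<xi> * \<Psi> \<xi>) x * \<phi> x)" .
qed

text \<open>The indicator function of the \<open>D\<close>-neighbourhood of \<open>F\<close> in the lattice, real-valued so that it can appear as a factor
  in estimates.\<close>

definition near :: "real \<Rightarrow> (int^'n) set \<Rightarrow> int^'n \<Rightarrow> real" where
  "near D F j = (if \<exists>k\<in>F. norm (lattice_vec (j - k)) \<le> D then 1 else 0)"

lemma japanese_comparable:
  assumes "norm (lattice_vec (j - k)) \<le> D"
  shows "japanese j \<le> 4 * (1 + D) * japanese k" "japanese k \<le> 4 * (1 + D) * japanese j"
proof -
  have "norm (lattice_vec (k - j)) \<le> D"
    using assms by (simp add: lattice_vec_diff norm_minus_commute)
  then have d: "japanese (j - k) \<le> 1 + D" "japanese (k - j) \<le> 1 + D"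
    using japanese_le[of "j - k"] japanese_le[of "k - j"] assms by auto
  have "4 * japanese k * japanese (j - k) \<le> 4 * japanese k * (1 + D)"
    using d japanese_pos[of k] by (intro mult_left_mono) auto
  then show "japanese j \<le> 4 * (1 + D) * japanese k" using japanese_peetre[of j k] by (simp add: mult_ac)
  have "4 * japanese j * japanese (k - j) \<le> 4 * japanese j * (1 + D)"
    using d japanese_pos[of j] by (intro mult_left_mono) auto
  then show "japanese k \<le> 4 * (1 + D) * japanese j" using japanese_peetre[of k j] by (simp add: mult_ac)
qed

lemma japanese_powr_comparable:
  assumes D: "0 \<le> D" and n: "norm (lattice_vec (j - k)) \<le> D"
  shows "japanese j powr \<gamma> \<le> (4 * (1 + D)) powr \<bar>\<gamma>\<bar> * japanese k powr \<gamma>"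
proof (cases "\<gamma> \<ge> 0")
  case True
  have "japanese j powr \<gamma> \<le> (4 * (1 + D) * japanese k) powr \<gamma>"
    using True japanese_comparable(1)[OF n] japanese_pos[of j] by (intro powr_mono2) auto
  then show ?thesis using True D japanese_pos[of k] by (simp add: powr_mult)
next
  case False
  have "japanese j powr \<gamma> \<le> (japanese k / (4 * (1 + D))) powr \<gamma>"
    using False japanese_comparable(2)[OF n] japanese_pos[of k] D
    by (intro powr_mono2') (auto simp: divide_le_eq mult.commute)
  then show ?thesis using False D japanese_pos[of k] by (simp add: powr_divide powr_minus_divide)
qed

text \<open>The neighbourhood consists of boundedly many translates of \<open>F\<close>, and the weight is comparable along each of them.\<close>

lemma near_sum_le:
  assumes D: "0 \<le> D" and F: "finite F" and F': "finite F'"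
  shows "(\<Sum>j\<in>F'. near D F j * japanese j powr \<gamma>) \<le>
    real (card {d :: int^'n. norm (lattice_vec d) \<le> D}) * (4 * (1 + D)) powr \<bar>\<gamma>\<bar> * (\<Sum>k\<in>F. japanese k powr \<gamma>)"
proof -
  let ?Ds = "{d :: int^'n. norm (lattice_vec d) \<le> D}"
  have finD: "finite ?Ds" by (rule finite_lattice_ball)
  let ?N = "{j \<in> F'. \<exists>k\<in>F. norm (lattice_vec (j - k)) \<le> D}"
  have "(\<Sum>j\<in>F'. near D F j * japanese j powr \<gamma>) = (\<Sum>j\<in>?N. japanese j powr \<gamma>)"
    using F' by (intro sum.mono_neutral_cong_right) (auto simp: near_def)
  also have "\<dots> \<le> (\<Sum>j\<in>(\<lambda>(k, d). k + d) ` (F \<times> ?Ds). japanese j powr \<gamma>)"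
  proof (rule sum_mono2)
    show "?N \<subseteq> (\<lambda>(k, d). k + d) ` (F \<times> ?Ds)"
    proof
      fix j assume "j \<in> ?N"
      then obtain k where "k \<in> F" "norm (lattice_vec (j - k)) \<le> D" by blast
      then show "j \<in> (\<lambda>(k, d). k + d) ` (F \<times> ?Ds)" by (intro rev_image_eqI[of "(k, j - k)"]) auto
    qed
  qed (use F finD in auto)
  also have "\<dots> \<le> (\<Sum>x\<in>F \<times> ?Ds. japanese (case x of (k, d) \<Rightarrow> k + d) powr \<gamma>)"
    using sum_image_le[of "F \<times> ?Ds" "\<lambda>j. japanese j powr \<gamma>" "\<lambda>(k, d). k + d"] F finD by (simp add: o_def)
  also have "\<dots> = (\<Sum>k\<in>F. \<Sum>d\<in>?Ds. japanese (k + d) powr \<gamma>)"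
    by (subst sum.cartesian_product) (simp add: case_prod_beta)
  also have "\<dots> \<le> (\<Sum>k\<in>F. \<Sum>d\<in>?Ds. (4 * (1 + D)) powr \<bar>\<gamma>\<bar> * japanese k powr \<gamma>)"
    by (intro sum_mono japanese_powr_comparable D) auto
  also have "\<dots> = real (card ?Ds) * (4 * (1 + D)) powr \<bar>\<gamma>\<bar> * (\<Sum>k\<in>F. japanese k powr \<gamma>)"
    by (simp add: sum_distrib_left mult.assoc)
  finally show ?thesis .
qed

text \<open>For nearby \<open>j\<close> and \<open>k\<close> the two radii are comparable. Rescaling the \<open>k\<close>-th ball to unit size therefore turns the functions
  \<open>\<eta> j\<close> into a moderate family indexed by the pairs \<open>(j, k)\<close>: the scaling factors of the derivatives cancel the growth that the
  partition estimates allow. The Fourier transform then gives decay that is uniform in \<open>j\<close> and \<open>k\<close>.\<close>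

lemma localized_piece_decay:
  fixes \<theta> :: "real^'n \<Rightarrow> complex"
  assumes \<theta>: "\<theta> \<in> schwartz" and D: "0 \<le> D"
  shows "\<exists>A>0. \<forall>j k x. norm (lattice_vec (j - k)) \<le> D \<longrightarrow>
    norm (inv_fourier (\<lambda>\<xi>. \<eta> j \<xi> * \<theta> ((1 / radius k) *\<^sub>R (\<xi> - center k))) x)
      \<le> radius k ^ CARD('n) * (A * (1 / (1 + radius j * norm x) ^ m))"
proof -
  define I where "I = {(j, k). norm (lattice_vec (j - k :: int^'n)) \<le> D}"
  \<comment> \<open>A bound for the quotient of the radii of two nearby balls.\<close>
  define \<rho> where "\<rho> = (4 * (1 + D)) powr (\<alpha> / (1 - \<alpha>))"
  have \<rho>: "\<rho> \<ge> 1" unfolding \<rho>_def using D by (intro ge_one_powr_ge_zero exponent_nonneg) simp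
  have rr: "radius k \<le> \<rho> * radius j" "radius j \<le> \<rho> * radius k" if "(j, k) \<in> I" for j k
  proof -
    have n: "norm (lattice_vec (j - k)) \<le> D" "norm (lattice_vec (k - j)) \<le> D"
      using that unfolding I_def by (auto simp: lattice_vec_diff norm_minus_commute)
    show "radius k \<le> \<rho> * radius j" "radius j \<le> \<rho> * radius k"
      using japanese_powr_comparable[OF D n(1), of "\<alpha> / (1 - \<alpha>)"] japanese_powr_comparable[OF D n(2), of "\<alpha> / (1 - \<alpha>)"]
        abs_of_nonneg[OF exponent_nonneg]
      unfolding \<rho>_def radius_def by simp_all
  qed
  \<comment> \<open>The piece \<open>\<eta> j\<close> seen from the \<open>k\<close>-th ball rescaled to the unit ball.\<close>
  define E where "E = (\<lambda>(j, k) \<xi>. \<eta> j (center k + radius k *\<^sub>R \<xi>))"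
  have E: "moderate I E"
    unfolding moderate_def
  proof (intro conjI allI ballI)
    show "smooth (E i)" for i
      unfolding E_def by (cases i) (simp add: smooth_affine schwartz_smooth \<eta>_schwartz)
    fix "is" :: "'n list"
    obtain B where B: "\<forall>\<xi> k. norm (partials is (\<eta> k) \<xi>) \<le> B * japanese k powr (- (\<alpha> * real (length is) / (1 - \<alpha>)))"
      using \<eta>_partials by blast
    have "norm (partials is (E (j, k)) \<xi>) \<le> (\<bar>B\<bar> * \<rho> ^ length is) * (1 + norm \<xi>) ^ 0" if jk: "(j, k) \<in> I" for j k \<xi>
    proof -
      have e: "japanese j powr (- (\<alpha> * real (length is) / (1 - \<alpha>))) = 1 / radius j ^ length is"
        unfolding radius_def powr_minus_divide using japanese_pos[of j]
        by (simp add: powr_realpow[symmetric] powr_powr)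
      have "norm (partials is (E (j, k)) \<xi>) = radius k ^ length is * norm (partials is (\<eta> j) (center k + radius k *\<^sub>R \<xi>))"
        unfolding E_def using radius_pos[of k]
        by (simp add: partials_affine[OF schwartz_smooth[OF \<eta>_schwartz]] norm_mult norm_power)
      also have "\<dots> \<le> radius k ^ length is * (\<bar>B\<bar> * (1 / radius j ^ length is))"
      proof (intro mult_left_mono)
        have "norm (partials is (\<eta> j) (center k + radius k *\<^sub>R \<xi>)) \<le> B * (1 / radius j ^ length is)"
          using B unfolding e[symmetric] by blast
        also have "\<dots> \<le> \<bar>B\<bar> * (1 / radius j ^ length is)" using radius_pos[of j] by (intro mult_right_mono) auto
        finally show "norm (partials is (\<eta> j) (center k + radius k *\<^sub>R \<xi>)) \<le> \<bar>B\<bar> * (1 / radius j ^ length is)" .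
      qed (use radius_pos[of k] in simp)
      also have "\<dots> = \<bar>B\<bar> * (radius k / radius j) ^ length is" by (simp add: power_divide)
      also have "\<dots> \<le> \<bar>B\<bar> * \<rho> ^ length is"
        using rr[OF jk] radius_pos[of j] radius_pos[of k] by (intro mult_left_mono power_mono) (auto simp: divide_le_eq)
      finally show ?thesis by simp
    qed
    then show "\<exists>C m. \<forall>i\<in>I. \<forall>\<xi>. norm (partials is (E i) \<xi>) \<le> C * (1 + norm \<xi>) ^ m"
      by (intro exI[of _ "\<bar>B\<bar> * \<rho> ^ length is"] exI[of _ 0] ballI allI) (simp only: split_paired_all)
  qed
  have "schwartz_bounded I (\<lambda>i. fourier (\<lambda>\<xi>. E i \<xi> * \<theta> \<xi>))"
    by (intro schwartz_bounded_fourier schwartz_bounded_mult E schwartz_bounded_single \<theta>)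
  from schwartz_decay[OF this, of m]
  obtain A where A: "A > 0" "\<forall>i\<in>I. \<forall>x. norm (fourier (\<lambda>\<xi>. E i \<xi> * \<theta> \<xi>) x) \<le> A * (1 / (1 + norm x) ^ m)"
    by (elim exE conjE)
  have "norm (inv_fourier (\<lambda>\<xi>. \<eta> j \<xi> * \<theta> ((1 / radius k) *\<^sub>R (\<xi> - center k))) x)
      \<le> radius k ^ CARD('n) * (A * \<rho> ^ m * (1 / (1 + radius j * norm x) ^ m))"
    if jk: "norm (lattice_vec (j - k)) \<le> D" for j k x
  proof -
    let ?r = "radius k"
    have I: "(j, k) \<in> I" using jk unfolding I_def by simp
    have s: "(\<lambda>\<xi>. E (j, k) \<xi> * \<theta> \<xi>) \<in> schwartz"
      using schwartz_boundedD[OF schwartz_bounded_mult[OF E schwartz_bounded_single[OF \<theta>]] I] .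
    have "center k + ?r *\<^sub>R ((1 / ?r) *\<^sub>R (\<xi> - center k)) = \<xi>" for \<xi>
      unfolding scaleR_scaleR using radius_pos[of k] by simp
    then have "(\<lambda>\<xi>. \<eta> j \<xi> * \<theta> ((1 / ?r) *\<^sub>R (\<xi> - center k)))
        = (\<lambda>\<xi>. E (j, k) ((1 / ?r) *\<^sub>R (\<xi> - center k)) * \<theta> ((1 / ?r) *\<^sub>R (\<xi> - center k)))"
      unfolding E_def by simp
    then have "inv_fourier (\<lambda>\<xi>. \<eta> j \<xi> * \<theta> ((1 / ?r) *\<^sub>R (\<xi> - center k))) x
        = fourier (\<lambda>\<xi>. E (j, k) ((1 / ?r) *\<^sub>R (\<xi> - center k)) * \<theta> ((1 / ?r) *\<^sub>R (\<xi> - center k))) (- x)"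
      unfolding inv_fourier_eq by simp
    also have "\<dots> = ?r ^ CARD('n) * (cis (- 2 * pi * (center k \<bullet> (- x))) * fourier (\<lambda>\<xi>. E (j, k) \<xi> * \<theta> \<xi>) (?r *\<^sub>R (- x)))"
      using fourier_dilate[OF schwartz_integrable[OF s] radius_pos[of k], of "center k" "- x"] by simp
    finally have "norm (inv_fourier (\<lambda>\<xi>. \<eta> j \<xi> * \<theta> ((1 / ?r) *\<^sub>R (\<xi> - center k))) x)
        = ?r ^ CARD('n) * norm (fourier (\<lambda>\<xi>. E (j, k) \<xi> * \<theta> \<xi>) (?r *\<^sub>R (- x)))"
      using radius_pos[of k] by (simp add: norm_mult norm_power)
    also have "\<dots> \<le> ?r ^ CARD('n) * (A * (1 / (1 + ?r * norm x) ^ m))"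
    proof (intro mult_left_mono)
      show "norm (fourier (\<lambda>\<xi>. E (j, k) \<xi> * \<theta> \<xi>) (?r *\<^sub>R (- x))) \<le> A * (1 / (1 + ?r * norm x) ^ m)"
        using A(2)[rule_format, OF I, of "?r *\<^sub>R (- x)"] radius_pos[of k] by simp
    qed (use radius_pos[of k] in simp)
    also have "\<dots> \<le> ?r ^ CARD('n) * (A * \<rho> ^ m * (1 / (1 + radius j * norm x) ^ m))"
    proof -
      have pos: "0 < 1 + radius j * norm x" "0 < 1 + ?r * norm x"
        using radius_pos[of j] radius_pos[of k] by (auto intro: add_pos_nonneg)
      have "radius j * norm x \<le> \<rho> * ?r * norm x" using rr(2)[OF I] by (intro mult_right_mono) auto
      then have "1 + radius j * norm x \<le> \<rho> * (1 + ?r * norm x)" using \<rho> by (simp add: distrib_left)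
      then have "(1 + radius j * norm x) ^ m \<le> \<rho> ^ m * (1 + ?r * norm x) ^ m"
        unfolding power_mult_distrib[symmetric] using pos by (intro power_mono) auto
      then have "1 / (1 + ?r * norm x) ^ m \<le> \<rho> ^ m * (1 / (1 + radius j * norm x) ^ m)"
        using pos by (simp add: field_simps)
      then have "A * (1 / (1 + ?r * norm x) ^ m) \<le> A * (\<rho> ^ m * (1 / (1 + radius j * norm x) ^ m))"
        using A(1) by (intro mult_left_mono) auto
      then show ?thesis unfolding mult.assoc[of A] by (rule mult_left_mono) (use radius_pos[of k] in simp)
    qed
    finally show ?thesis .
  qed
  note * = this
  have "A * \<rho> ^ m > 0" using A(1) \<rho> by simp
  then show ?thesis by (intro exI[of _ "A * \<rho> ^ m"] conjI allI impI *)
qed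

text \<open>The packets have the same phase at the origin, which makes the sup norm as large as possible, while each frequency piece
  sees only boundedly many of them.\<close>

lemma wave_packets:
  assumes p: "0 < p"
  shows "\<exists>D\<ge>0. \<exists>A>0. \<forall>F. finite F \<longrightarrow> (\<exists>u\<in>tempered.
    (\<forall>j. Lp_norm_distr p (Defs.box \<eta> j u) \<le>
       ennreal (A * near D F j * japanese j powr (- \<tau>) * radius j powr (- (real CARD('n) * enn2real (1 / p))))) \<and>
    ennreal (\<Sum>k\<in>F. japanese k powr (- \<tau>)) \<le> Lp_norm_distr top u)"
proof -
  let ?n = "CARD('n)"
  obtain \<theta> :: "real^'n \<Rightarrow> complex" and R where \<theta>: "\<theta> \<in> schwartz" and R: "R > 0"
    and supp: "\<forall>\<xi>. \<theta> \<xi> \<noteq> 0 \<longrightarrow> norm \<xi> < R" and \<theta>1: "fourier \<theta> 0 = 1"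
    using window_exists by auto
  \<comment> \<open>A packet and a piece whose indices differ by at least \<open>D\<close> have disjoint frequency supports.\<close>
  define D where "D = 2 * max C R"
  have D: "0 \<le> D" unfolding D_def using R by simp
  obtain m W where W: "W > 0" and Lp: "\<forall>(g :: real^'n \<Rightarrow> complex) c r. g \<in> borel_measurable borel \<longrightarrow> 0 \<le> c \<longrightarrow> 0 < r \<longrightarrow>
    (\<forall>x. norm (g x) \<le> c * (1 / (1 + r * norm x) ^ m)) \<longrightarrow>
    Lp_norm p g \<le> ennreal (c * W * r powr (- (real CARD('n) * enn2real (1 / p))))"
    using Lp_norm_of_decay[OF p, where ?'n = 'n] by (elim exE conjE)
  obtain A0 where A0: "A0 > 0" and dec: "\<forall>j k x. norm (lattice_vec (j - k)) \<le> D \<longrightarrow>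
    norm (inv_fourier (\<lambda>\<xi>. \<eta> j \<xi> * \<theta> ((1 / radius k) *\<^sub>R (\<xi> - center k))) x)
      \<le> radius k ^ CARD('n) * (A0 * (1 / (1 + radius j * norm x) ^ m))"
    using localized_piece_decay[OF \<theta> D, of m] by (elim exE conjE)
  define K where "K = real (card {d :: int^'n. norm (lattice_vec d) \<le> D})"
  define L where "L = (4 * (1 + D)) powr \<bar>\<tau>\<bar>"
  have L: "L > 0" unfolding L_def using D by simp
  define A where "A = (K + 1) * L * A0 * W"
  have K0: "K \<ge> 0" unfolding K_def by simp
  have A: "A > 0" unfolding A_def using K0 L A0 W by simp
  have "\<exists>u\<in>tempered.
    (\<forall>j. Lp_norm_distr p (Defs.box \<eta> j u) \<le>
       ennreal (A * near D F j * japanese j powr (- \<tau>) * radius j powr (- (real CARD('n) * enn2real (1 / p))))) \<and>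
    ennreal (\<Sum>k\<in>F. japanese k powr (- \<tau>)) \<le> Lp_norm_distr top u" if F: "finite F" for F
  proof -
    define \<psi> where "\<psi> k \<xi> = \<theta> ((1 / radius k) *\<^sub>R (\<xi> - center k))" for k \<xi>
    have \<psi>: "\<psi> k \<in> schwartz" for k
    proof -
      have "(\<lambda>\<xi>. \<theta> ((- (1 / radius k)) *\<^sub>R center k + (1 / radius k) *\<^sub>R \<xi>)) \<in> schwartz"
        using radius_pos[of k] by (intro schwartz_affine \<theta>) simp
      then show ?thesis unfolding \<psi>_def by (simp add: scaleR_diff_right)
    qed
    \<comment> \<open>The coefficient cancels the value \<open>r_k^n\<close> of the \<open>k\<close>-th packet at the origin.\<close>
    define a where "a k = japanese k powr (- \<tau>) / radius k ^ ?n" for k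
    have a0: "a k \<ge> 0" for k unfolding a_def using radius_pos[of k] by simp
    have ar: "a k * radius k ^ ?n = japanese k powr (- \<tau>)" for k unfolding a_def using radius_pos[of k] by simp
    define \<Psi> where "\<Psi> \<xi> = (\<Sum>k\<in>F. of_real (a k) * \<psi> k \<xi>)" for \<xi>
    have \<Psi>: "\<Psi> \<in> schwartz" unfolding \<Psi>_def by (intro schwartz_sum schwartz_cmult \<psi>)
    define f where "f = inv_fourier \<Psi>"
    have f: "f \<in> schwartz" unfolding f_def by (rule schwartz_inv_fourier[OF \<Psi>])
    define u where "u = (\<lambda>\<phi>\<in>schwartz. LINT x|lborel. f x * \<phi> x)"
    have u: "u \<in> tempered" and rep: "represents f u" unfolding u_def by (rule tempered_of_schwartz[OF f])+
    have pieces: "Lp_norm_distr p (Defs.box \<eta> j u) \<le>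
       ennreal (A * near D F j * japanese j powr (- \<tau>) * radius j powr (- (real CARD('n) * enn2real (1 / p))))" for j
    proof -
      define g where "g = inv_fourier (\<lambda>\<xi>. \<eta> j \<xi> * \<Psi> \<xi>)"
      have gs: "(\<lambda>\<xi>. \<eta> j \<xi> * \<Psi> \<xi>) \<in> schwartz" by (intro schwartz_mult \<eta>_schwartz \<Psi>)
      have gm: "g \<in> borel_measurable borel" unfolding g_def by (rule schwartz_measurable[OF schwartz_inv_fourier[OF gs]])
      have repg: "represents g (Defs.box \<eta> j u)" unfolding g_def u_def f_def by (rule represents_box[OF \<Psi>])
      let ?N = "{k \<in> F. norm (lattice_vec (j - k)) \<le> D}"
      let ?h = "\<lambda>k. inv_fourier (\<lambda>\<xi>. \<eta> j \<xi> * \<psi> k \<xi>)"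
      have s: "(\<lambda>\<xi>. \<eta> j \<xi> * \<psi> k \<xi>) \<in> schwartz" for k by (intro schwartz_mult \<eta>_schwartz \<psi>)
      have gsum: "g x = (\<Sum>k\<in>F. of_real (a k) * ?h k x)" for x
      proof -
        have "(\<lambda>\<xi>. \<eta> j \<xi> * \<Psi> \<xi>) = (\<lambda>\<xi>. \<Sum>k\<in>F. of_real (a k) * (\<eta> j \<xi> * \<psi> k \<xi>))"
          unfolding \<Psi>_def sum_distrib_left by (simp add: mult_ac)
        then have "g x = fourier (\<lambda>\<xi>. \<Sum>k\<in>F. of_real (a k) * (\<eta> j \<xi> * \<psi> k \<xi>)) (- x)"
          unfolding g_def inv_fourier_eq by simp
        also have "\<dots> = (\<Sum>k\<in>F. fourier (\<lambda>\<xi>. of_real (a k) * (\<eta> j \<xi> * \<psi> k \<xi>)) (- x))"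
          by (intro fourier_sum schwartz_integrable schwartz_cmult s)
        finally show ?thesis unfolding fourier_cmult inv_fourier_eq .
      qed
      have far: "?h k x = 0" if "\<not> norm (lattice_vec (j - k)) \<le> D" for k x
      proof -
        have "\<eta> j \<xi> * \<psi> k \<xi> = 0" for \<xi>
        proof (rule ccontr)
          assume nz: "\<eta> j \<xi> * \<psi> k \<xi> \<noteq> 0"
          have "norm ((1 / radius k) *\<^sub>R (\<xi> - center k)) < R" using nz supp unfolding \<psi>_def by auto
          then have "norm (\<xi> - center k) < R * radius k" using radius_pos[of k] by (simp add: divide_less_eq)
          also have "\<dots> \<le> max C R * radius k" using radius_pos[of k] by (intro mult_right_mono) auto
          finally have 1: "norm (\<xi> - center k) < max C R * radius k" .
          have "norm (\<xi> - center j) < C * radius j" using nz by (intro support) auto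
          also have "\<dots> \<le> max C R * radius j" using radius_pos[of j] by (intro mult_right_mono) auto
          finally have "norm (lattice_vec (j - k)) < D" unfolding D_def using 1 by (rule overlap)
          then show False using that by simp
        qed
        then have "(\<lambda>\<xi>. \<eta> j \<xi> * \<psi> k \<xi>) = (\<lambda>\<xi>. 0)" by (rule ext)
        then show ?thesis by (simp only:) (simp add: inv_fourier_def)
      qed
      define c where "c = near D F j * (K * (L * japanese j powr (- \<tau>)) * A0)"
      have c0: "0 \<le> c" unfolding c_def near_def using K0 L A0 by auto
      have bound: "norm (g x) \<le> c * (1 / (1 + radius j * norm x) ^ m)" for x
      proof -
        let ?w = "1 / (1 + radius j * norm x) ^ m"
        have w0: "0 \<le> ?w" using radius_pos[of j] by simp
        have "g x = (\<Sum>k\<in>?N. of_real (a k) * ?h k x)"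
          unfolding gsum using F far by (intro sum.mono_neutral_right) auto
        then have "norm (g x) \<le> (\<Sum>k\<in>?N. a k * norm (?h k x))"
          using a0 by (auto intro!: sum_norm_le simp: norm_mult)
        also have "\<dots> \<le> (\<Sum>k\<in>?N. L * japanese j powr (- \<tau>) * (A0 * ?w))"
        proof (rule sum_mono)
          fix k assume "k \<in> ?N"
          then have k: "norm (lattice_vec (j - k)) \<le> D" by simp
          then have k': "norm (lattice_vec (k - j)) \<le> D" by (simp add: lattice_vec_diff norm_minus_commute)
          have "a k * norm (?h k x) \<le> a k * (radius k ^ ?n * (A0 * ?w))"
            using dec[rule_format, OF k, of x] a0 unfolding \<psi>_def[abs_def] by (intro mult_left_mono)
          also have "\<dots> = japanese k powr (- \<tau>) * (A0 * ?w)" unfolding ar[symmetric] by (simp only: mult.assoc)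
          also have "\<dots> \<le> (L * japanese j powr (- \<tau>)) * (A0 * ?w)"
            using japanese_powr_comparable[OF D k', of "- \<tau>"] A0 w0 unfolding L_def by (intro mult_right_mono) auto
          finally show "a k * norm (?h k x) \<le> L * japanese j powr (- \<tau>) * (A0 * ?w)" .
        qed
        also have "\<dots> = real (card ?N) * (L * japanese j powr (- \<tau>) * (A0 * ?w))" by simp
        also have "\<dots> \<le> (near D F j * K) * (L * japanese j powr (- \<tau>) * (A0 * ?w))"
        proof (rule mult_right_mono)
          show "real (card ?N) \<le> near D F j * K"
          proof (cases "?N = {}")
            case True
            then show ?thesis using K0 by (simp only: card.empty) (simp add: near_def)
          next
            case False
            then have "near D F j = 1" unfolding near_def by auto
            moreover have "card ?N \<le> card {d :: int^'n. norm (lattice_vec d) \<le> D}"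
            proof (rule card_inj_on_le[OF _ _ finite_lattice_ball])
              show "inj_on (\<lambda>k. j - k) ?N" by (simp add: inj_on_def)
            qed auto
            ultimately show ?thesis unfolding K_def by simp
          qed
          show "0 \<le> L * japanese j powr (- \<tau>) * (A0 * ?w)" using L A0 w0 by simp
        qed
        finally show ?thesis unfolding c_def by (simp only: mult.assoc)
      qed
      have "Lp_norm_distr p (Defs.box \<eta> j u) = Lp_norm p g" by (rule Lp_norm_distr_eq[OF repg])
      also have "\<dots> \<le> ennreal (c * W * radius j powr (- (real CARD('n) * enn2real (1 / p))))"
        using Lp[rule_format, OF gm c0 radius_pos[of j] bound] .
      also have "\<dots> \<le> ennreal (A * near D F j * japanese j powr (- \<tau>) * radius j powr (- (real CARD('n) * enn2real (1 / p))))"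
      proof (intro ennreal_leI mult_right_mono)
        have "c * W = K * (L * A0 * W * near D F j * japanese j powr (- \<tau>))" unfolding c_def by (simp only: mult_ac)
        also have "\<dots> \<le> (K + 1) * (L * A0 * W * near D F j * japanese j powr (- \<tau>))"
          using L A0 W unfolding near_def by (intro mult_right_mono) auto
        also have "\<dots> = A * near D F j * japanese j powr (- \<tau>)" unfolding A_def by (simp only: mult_ac)
        finally show "c * W \<le> A * near D F j * japanese j powr (- \<tau>)" .
      qed simp
      finally show ?thesis .
    qed
    have f0: "f 0 = (\<Sum>k\<in>F. complex_of_real (japanese k powr (- \<tau>)))"
    proof -
      have "f 0 = fourier \<Psi> 0" unfolding f_def inv_fourier_eq by simp
      also have "\<dots> = (\<Sum>k\<in>F. of_real (a k) * fourier (\<psi> k) 0)"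
        unfolding \<Psi>_def[abs_def] fourier_cmult[symmetric] by (intro fourier_sum schwartz_integrable schwartz_cmult \<psi>)
      also have "\<dots> = (\<Sum>k\<in>F. complex_of_real (japanese k powr (- \<tau>)))"
      proof (rule sum.cong[OF refl])
        fix k
        have "fourier (\<psi> k) 0 = of_real (radius k ^ ?n)"
          unfolding \<psi>_def[abs_def] using fourier_dilate[OF schwartz_integrable[OF \<theta>] radius_pos[of k], of "center k" 0] \<theta>1 by simp
        then show "of_real (a k) * fourier (\<psi> k) 0 = complex_of_real (japanese k powr (- \<tau>))"
          unfolding ar[symmetric] by simp
      qed
      finally show ?thesis .
    qed
    \<comment> \<open>The essential supremum of a continuous function is at least its modulus at the origin.\<close>
    have "ennreal (\<Sum>k\<in>F. japanese k powr (- \<tau>)) \<le> Lp_norm_distr top u"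
    proof (cases "Lp_norm top f = top")
      case True then show ?thesis unfolding Lp_norm_distr_eq[OF rep] by simp
    next
      case False
      define M where "M = enn2real (Lp_norm top f)"
      have M: "Lp_norm top f = ennreal M" "0 \<le> M" unfolding M_def using False by (simp_all add: ennreal_enn2real_if)
      have "AE x in lborel. ennreal (norm (f x)) \<le> ennreal M"
        unfolding M(1)[symmetric] Lp_norm_def if_P[OF refl] by (rule esssup_AE)
      then have ae: "AE x in lborel. norm (f x) \<le> M" using M(2) by (simp add: ennreal_le_iff)
      have "norm (f 0) \<le> M" by (rule continuous_AE_le[OF smooth_continuous[OF schwartz_smooth[OF f]] ae])
      moreover have "norm (f 0) = (\<Sum>k\<in>F. japanese k powr (- \<tau>))"
        unfolding f0 of_real_sum[symmetric] norm_of_real by (simp add: sum_nonneg)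
      ultimately show ?thesis unfolding Lp_norm_distr_eq[OF rep] M(1) by (intro ennreal_leI) simp
    qed
    then show ?thesis using pieces by (intro bexI[OF _ u] conjI allI)
  qed
  note * = this
  show ?thesis by (intro exI[of _ D] exI[of _ A] conjI allI impI D A *)
qed

text \<open>The weight of the modulation norm times the size of the \<open>j\<close>-th piece of a superposition of wave packets.\<close>

lemma packet_weight:
  fixes p :: ennreal and s :: real
  defines "\<sigma> \<equiv> (s - real CARD('n) * \<alpha> * enn2real (1 / p)) / (1 - \<alpha>)"
  shows "japanese j powr (s / (1 - \<alpha>)) * (japanese j powr (- \<tau>) * radius j powr (- (real CARD('n) * enn2real (1 / p))))
    = japanese j powr (\<sigma> - \<tau>)"
proof -
  have e: "s / (1 - \<alpha>) + (- \<tau> + \<alpha> / (1 - \<alpha>) * (- (real CARD('n) * enn2real (1 / p)))) = \<sigma> - \<tau>"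
    unfolding \<sigma>_def by (simp add: diff_divide_distrib mult_ac)
  show ?thesis unfolding radius_def powr_powr powr_add[symmetric] e ..
qed

text \<open>The embedding applied to the superpositions of wave packets over \<open>F\<close>. The modulation norm of such a function is at most a
  constant times \<open>(\<Sum>k\<in>F. \<langle>k\<rangle>^((\<sigma>-\<tau>)q))^(1/q)\<close>, since a neighbourhood of \<open>F\<close> carries a weighted sum comparable to that over \<open>F\<close>.\<close>

lemma embedding_test_inequality_finite:
  assumes p: "0 < p" and q: "0 < q" "q \<noteq> top"
    and emb: "embeds (modulation_space \<eta> \<alpha> s p q) (modulation_norm \<eta> \<alpha> s p q) Linfty (Lp_norm_distr top)"
  defines "\<sigma> \<equiv> (s - real CARD('n) * \<alpha> * enn2real (1 / p)) / (1 - \<alpha>)"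
  shows "\<exists>A>0. \<forall>F :: (int^'n) set. finite F \<longrightarrow>
    (\<Sum>k\<in>F. japanese k powr (- \<tau>)) powr enn2real q \<le> A * (\<Sum>k\<in>F. japanese k powr ((\<sigma> - \<tau>) * enn2real q))"
proof -
  define r where "r = enn2real q"
  have r: "0 < r" "enn2real (1 / q) = 1 / r" unfolding r_def using enn2real_inverse[OF q] by auto
  obtain E where E: "E > 0" and emb': "\<forall>u\<in>modulation_space \<eta> \<alpha> s p q. Lp_norm_distr top u \<le> ennreal E * modulation_norm \<eta> \<alpha> s p q u"
    using emb unfolding embeds_def by auto
  obtain D A where D: "0 \<le> D" and A: "0 < A" and packets: "\<forall>F. finite F \<longrightarrow> (\<exists>u\<in>tempered.
    (\<forall>j. Lp_norm_distr p (Defs.box \<eta> j u) \<le>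
       ennreal (A * near D F j * japanese j powr (- \<tau>) * radius j powr (- (real CARD('n) * enn2real (1 / p))))) \<and>
    ennreal (\<Sum>k\<in>F. japanese k powr (- \<tau>)) \<le> Lp_norm_distr top u)"
    using wave_packets[OF p, of \<tau>] by (elim exE conjE)
  define Z where "Z = A powr r * (real (card {d :: int^'n. norm (lattice_vec d) \<le> D}) * (4 * (1 + D)) powr \<bar>(\<sigma> - \<tau>) * r\<bar>)"
  have Z: "0 \<le> Z" unfolding Z_def by simp
  have "(\<Sum>k\<in>F. japanese k powr (- \<tau>)) powr r \<le> (E powr r * (Z + 1)) * (\<Sum>k\<in>F. japanese k powr ((\<sigma> - \<tau>) * r))"
    if F: "finite F" for F :: "(int^'n) set"
  proof -
    let ?S = "\<Sum>k\<in>F. japanese k powr ((\<sigma> - \<tau>) * r)"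
    have S0: "0 \<le> ?S" by (intro sum_nonneg) simp
    obtain u where u: "u \<in> tempered" and
      up: "\<forall>j. Lp_norm_distr p (Defs.box \<eta> j u) \<le> ennreal (A * near D F j * japanese j powr (- \<tau>) * radius j powr (- (real CARD('n) * enn2real (1 / p))))"
      and low: "ennreal (\<Sum>k\<in>F. japanese k powr (- \<tau>)) \<le> Lp_norm_distr top u"
      using packets[rule_format, OF F] by (elim bexE conjE)
    let ?e = "\<lambda>j. ennreal (japanese j powr (s * r / (1 - \<alpha>))) * ennreal_powr (Lp_norm_distr p (Defs.box \<eta> j u)) r"
    have e: "?e j \<le> ennreal (A powr r * (near D F j * japanese j powr ((\<sigma> - \<tau>) * r)))" for j
    proof -
      define b where "b = A * near D F j * japanese j powr (- \<tau>) * radius j powr (- (real CARD('n) * enn2real (1 / p)))"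
      have n0: "0 \<le> near D F j" "near D F j powr r = near D F j" unfolding near_def by auto
      have b0: "0 \<le> b" unfolding b_def using A n0 by simp
      have le: "Lp_norm_distr p (Defs.box \<eta> j u) \<le> ennreal b" unfolding b_def using up by blast
      then have fin: "Lp_norm_distr p (Defs.box \<eta> j u) < top" by (rule order.strict_trans1) simp
      have "enn2real (Lp_norm_distr p (Defs.box \<eta> j u)) \<le> b" by (rule enn2real_leI[OF b0 le])
      then have "enn2real (Lp_norm_distr p (Defs.box \<eta> j u)) powr r \<le> b powr r" using r by (intro powr_mono2) auto
      then have "ennreal_powr (Lp_norm_distr p (Defs.box \<eta> j u)) r \<le> ennreal (b powr r)"
        unfolding ennreal_powr_def if_not_P[OF less_imp_neq[OF fin]] by (rule ennreal_leI)
      then have "?e j \<le> ennreal (japanese j powr (s * r / (1 - \<alpha>))) * ennreal (b powr r)" by (intro mult_left_mono) auto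
      also have "\<dots> = ennreal (japanese j powr (s * r / (1 - \<alpha>)) * b powr r)" by (simp add: ennreal_mult)
      also have "japanese j powr (s * r / (1 - \<alpha>)) * b powr r = (japanese j powr (s / (1 - \<alpha>)) * b) powr r"
        using b0 by (simp add: powr_mult powr_powr)
      also have "japanese j powr (s / (1 - \<alpha>)) * b = (A * near D F j) * japanese j powr (\<sigma> - \<tau>)"
        unfolding b_def \<sigma>_def packet_weight[of j s \<tau> p, symmetric] by (simp only: mult_ac)
      also have "((A * near D F j) * japanese j powr (\<sigma> - \<tau>)) powr r = A powr r * (near D F j * japanese j powr ((\<sigma> - \<tau>) * r))"
        using A n0 by (simp add: powr_mult powr_powr mult.assoc)
      finally show ?thesis .
    qed
    have part: "(\<Sum>j\<in>F'. ?e j) \<le> ennreal (Z * ?S)" if "finite F'" for F'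
    proof -
      have "(\<Sum>j\<in>F'. ?e j) \<le> (\<Sum>j\<in>F'. ennreal (A powr r * (near D F j * japanese j powr ((\<sigma> - \<tau>) * r))))"
        by (intro sum_mono e)
      also have "\<dots> = ennreal (\<Sum>j\<in>F'. A powr r * (near D F j * japanese j powr ((\<sigma> - \<tau>) * r)))"
        by (rule sum_ennreal) (auto simp: near_def)
      also have "\<dots> \<le> ennreal (Z * ?S)"
        unfolding sum_distrib_left[symmetric] Z_def mult.assoc[of "A powr r"]
        by (intro ennreal_leI mult_left_mono near_sum_le D F that) simp
      finally show ?thesis .
    qed
    define S where "S = (\<Sum>\<^sub>\<infinity>j. ?e j)"
    have S: "S \<le> ennreal (Z * ?S)"
      unfolding S_def by (subst nonneg_infsum_complete) (auto intro!: SUP_least part)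
    have Sfin: "S < top" using S by (rule order.strict_trans1) simp
    have N: "modulation_norm \<eta> \<alpha> s p q u = ennreal (enn2real S powr (1 / r))"
      unfolding modulation_norm_def if_not_P[OF q(2)] r_def[symmetric] r(2) S_def[symmetric]
      unfolding ennreal_powr_def if_not_P[OF less_imp_neq[OF Sfin]] ..
    have "u \<in> modulation_space \<eta> \<alpha> s p q" unfolding modulation_space_def using u N by simp
    then have "Lp_norm_distr top u \<le> ennreal E * modulation_norm \<eta> \<alpha> s p q u" by (rule bspec[OF emb'])
    then have "ennreal (\<Sum>k\<in>F. japanese k powr (- \<tau>)) \<le> ennreal E * ennreal (enn2real S powr (1 / r))"
      unfolding N using low by (rule order_trans[rotated])
    then have "(\<Sum>k\<in>F. japanese k powr (- \<tau>)) \<le> E * enn2real S powr (1 / r)"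
      using E by (simp add: ennreal_mult[symmetric])
    then have "(\<Sum>k\<in>F. japanese k powr (- \<tau>)) powr r \<le> (E * enn2real S powr (1 / r)) powr r"
      using r by (intro powr_mono2 sum_nonneg) auto
    also have "\<dots> = E powr r * enn2real S" using E r by (simp add: powr_mult powr_powr)
    also have "\<dots> \<le> E powr r * (Z * ?S)" using S Z S0 by (intro mult_left_mono enn2real_leI) auto
    also have "\<dots> \<le> E powr r * ((Z + 1) * ?S)" using S0 by (intro mult_left_mono mult_right_mono) auto
    finally show ?thesis by (simp only: mult.assoc)
  qed
  note * = this
  have "E powr r * (Z + 1) > 0" using E Z by simp
  then show ?thesis unfolding r_def[symmetric] by (intro exI[of _ "E powr r * (Z + 1)"] conjI allI impI *)
qed

text \<open>The same test for \<open>q = \<infinity>\<close>: if \<open>\<sigma> \<le> \<tau>\<close>, the superpositions of wave packets are bounded in the modulation space.\<close>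

lemma embedding_test_inequality_top:
  assumes p: "0 < p"
    and emb: "embeds (modulation_space \<eta> \<alpha> s p top) (modulation_norm \<eta> \<alpha> s p top) Linfty (Lp_norm_distr top)"
  defines "\<sigma> \<equiv> (s - real CARD('n) * \<alpha> * enn2real (1 / p)) / (1 - \<alpha>)"
  assumes \<tau>: "\<sigma> \<le> \<tau>"
  shows "\<exists>A. \<forall>F :: (int^'n) set. finite F \<longrightarrow> (\<Sum>k\<in>F. japanese k powr (- \<tau>)) \<le> A"
proof -
  obtain E where E: "E > 0" and emb': "\<forall>u\<in>modulation_space \<eta> \<alpha> s p top. Lp_norm_distr top u \<le> ennreal E * modulation_norm \<eta> \<alpha> s p top u"
    using emb unfolding embeds_def by auto
  obtain D A where D: "0 \<le> D" and A: "0 < A" and packets: "\<forall>F. finite F \<longrightarrow> (\<exists>u\<in>tempered.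
    (\<forall>j. Lp_norm_distr p (Defs.box \<eta> j u) \<le>
       ennreal (A * near D F j * japanese j powr (- \<tau>) * radius j powr (- (real CARD('n) * enn2real (1 / p))))) \<and>
    ennreal (\<Sum>k\<in>F. japanese k powr (- \<tau>)) \<le> Lp_norm_distr top u)"
    using wave_packets[OF p, of \<tau>] by (elim exE conjE)
  have "(\<Sum>k\<in>F. japanese k powr (- \<tau>)) \<le> E * A" if F: "finite F" for F :: "(int^'n) set"
  proof -
    obtain u where u: "u \<in> tempered" and
      up: "\<forall>j. Lp_norm_distr p (Defs.box \<eta> j u) \<le> ennreal (A * near D F j * japanese j powr (- \<tau>) * radius j powr (- (real CARD('n) * enn2real (1 / p))))"
      and low: "ennreal (\<Sum>k\<in>F. japanese k powr (- \<tau>)) \<le> Lp_norm_distr top u"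
      using packets[rule_format, OF F] by (elim bexE conjE)
    have "ennreal (japanese j powr (s / (1 - \<alpha>))) * Lp_norm_distr p (Defs.box \<eta> j u) \<le> ennreal A" for j
    proof -
      define b where "b = A * near D F j * japanese j powr (- \<tau>) * radius j powr (- (real CARD('n) * enn2real (1 / p)))"
      have n0: "0 \<le> near D F j" "near D F j \<le> 1" unfolding near_def by auto
      have b0: "0 \<le> b" unfolding b_def using A n0 by simp
      have "ennreal (japanese j powr (s / (1 - \<alpha>))) * Lp_norm_distr p (Defs.box \<eta> j u) \<le> ennreal (japanese j powr (s / (1 - \<alpha>))) * ennreal b"
        using up unfolding b_def by (intro mult_left_mono) auto
      also have "\<dots> = ennreal (japanese j powr (s / (1 - \<alpha>)) * b)" using b0 by (simp add: ennreal_mult)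
      also have "japanese j powr (s / (1 - \<alpha>)) * b = A * (near D F j * japanese j powr (\<sigma> - \<tau>))"
        unfolding b_def \<sigma>_def packet_weight[of j s \<tau> p, symmetric] by (simp only: mult_ac)
      also have "ennreal \<dots> \<le> ennreal (A * (1 * 1))"
      proof (intro ennreal_leI mult_left_mono mult_mono n0)
        show "japanese j powr (\<sigma> - \<tau>) \<le> 1"
          using powr_mono[of "\<sigma> - \<tau>" 0 "japanese j"] japanese_ge_1[of j] \<tau> by simp
      qed (use A in auto)
      finally show ?thesis by simp
    qed
    then have N: "modulation_norm \<eta> \<alpha> s p top u \<le> ennreal A"
      unfolding modulation_norm_def if_P[OF refl] by (intro SUP_least)
    then have "modulation_norm \<eta> \<alpha> s p top u < top" by (rule order.strict_trans1) simp
    then have "u \<in> modulation_space \<eta> \<alpha> s p top" unfolding modulation_space_def using u by simp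
    then have "Lp_norm_distr top u \<le> ennreal E * modulation_norm \<eta> \<alpha> s p top u" by (rule bspec[OF emb'])
    also have "\<dots> \<le> ennreal E * ennreal A" using N by (intro mult_left_mono) auto
    also have "\<dots> = ennreal (E * A)" using E A by (simp add: ennreal_mult)
    finally have "Lp_norm_distr top u \<le> ennreal (E * A)" .
    with low have "ennreal (\<Sum>k\<in>F. japanese k powr (- \<tau>)) \<le> ennreal (E * A)" by (rule order_trans)
    then show ?thesis using E A by (simp add: ennreal_le_iff)
  qed
  then show ?thesis by (intro exI[of _ "E * A"] allI impI)
qed

text \<open>For \<open>q \<le> 1\<close> a single distant packet decides. For \<open>q > 1\<close> suppose that \<open>\<sigma> \<le> n(1-1/q)\<close>; the choice \<open>\<tau> = n\<close> makes
  \<open>(\<sigma>-\<tau>)q \<le> -n\<close>, so the test inequality compares a divergent sum \<open>T\<close> with its own power: \<open>T^q \<le> A T\<close>.\<close>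

theorem embedding_necessary:
  assumes p: "0 < p" and q: "0 < q"
    and emb: "embeds (modulation_space \<eta> \<alpha> s p q) (modulation_norm \<eta> \<alpha> s p q) Linfty (Lp_norm_distr top)"
  defines "\<sigma> \<equiv> (s - real CARD('n) * \<alpha> * enn2real (1 / p)) / (1 - \<alpha>)"
  shows "q \<le> 1 \<Longrightarrow> \<sigma> \<ge> 0" and "q > 1 \<Longrightarrow> \<sigma> > real CARD('n) * (1 - enn2real (1 / q))"
proof -
  let ?n = "real CARD('n)"
  show "\<sigma> \<ge> 0" if "q \<le> 1"
  proof (rule ccontr)
    assume "\<not> \<sigma> \<ge> 0"
    have qt: "q \<noteq> top" using that by (auto simp: top_unique)
    define r where "r = enn2real q"
    have r: "0 < r" unfolding r_def using enn2real_inverse[OF q qt] by auto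
    define e where "e = - (\<sigma> * r)"
    have e: "e > 0" unfolding e_def using \<open>\<not> \<sigma> \<ge> 0\<close> r by (simp add: mult_neg_pos)
    obtain A where A: "A > 0" "\<forall>F :: (int^'n) set. finite F \<longrightarrow>
      (\<Sum>k\<in>F. japanese k powr (- 0)) powr r \<le> A * (\<Sum>k\<in>F. japanese k powr ((\<sigma> - 0) * r))"
      using embedding_test_inequality_finite[OF p q qt emb, of 0] unfolding \<sigma>_def[symmetric] r_def[symmetric]
      by (elim exE conjE)
    \<comment> \<open>Beyond this size the weight of one packet exceeds what the test inequality allows.\<close>
    obtain k :: "int^'n" where k: "A powr (1 / e) < japanese k" using japanese_unbounded by blast
    have "1 \<le> A * japanese k powr (- e)"
      using A(2)[rule_format, of "{k}"] japanese_pos[of k] unfolding e_def by simp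
    then have "japanese k powr e \<le> A" using japanese_pos[of k] by (simp add: powr_minus_divide field_simps)
    moreover have "(A powr (1 / e)) powr e < japanese k powr e" using k e by (intro powr_less_mono2) auto
    ultimately show False using A(1) e by (simp add: powr_powr)
  qed
  show "\<sigma> > ?n * (1 - enn2real (1 / q))" if q1: "q > 1"
  proof (rule ccontr)
    assume "\<not> \<sigma> > ?n * (1 - enn2real (1 / q))"
    then have le: "\<sigma> \<le> ?n * (1 - enn2real (1 / q))" by simp
    show False
    proof (cases "q = top")
      case True
      then have "\<sigma> \<le> ?n" using le by simp
      then obtain A where "\<forall>F :: (int^'n) set. finite F \<longrightarrow> (\<Sum>k\<in>F. japanese k powr (- ?n)) \<le> A"
        using embedding_test_inequality_top[OF p emb[unfolded True], of ?n] unfolding \<sigma>_def by auto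
      then show False using lattice_sum_unbounded[of A, where ?'n = 'n] by (auto simp: not_less[symmetric])
    next
      case False
      define r where "r = enn2real q"
      have r: "0 < r" "enn2real (1 / q) = 1 / r" "q = ennreal r" unfolding r_def using enn2real_inverse[OF q False] by auto
      have r1: "1 < r"
      proof -
        have "ennreal 1 < ennreal r" using q1 r(3) by simp
        then show ?thesis by (rule ennreal_less_iff[THEN iffD1, rotated]) simp
      qed
      obtain A where A: "A > 0" "\<forall>F :: (int^'n) set. finite F \<longrightarrow>
        (\<Sum>k\<in>F. japanese k powr (- ?n)) powr r \<le> A * (\<Sum>k\<in>F. japanese k powr ((\<sigma> - ?n) * r))"
        using embedding_test_inequality_finite[OF p q False emb, of ?n] unfolding \<sigma>_def[symmetric] r_def[symmetric]
        by (elim exE conjE)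
      have exp: "(\<sigma> - ?n) * r \<le> - ?n"
      proof -
        have "(\<sigma> - ?n) * r \<le> (?n * (1 - 1 / r) - ?n) * r" using le r by (intro mult_right_mono) auto
        also have "\<dots> = - ?n" using r by (simp add: field_simps)
        finally show ?thesis .
      qed
      obtain F :: "(int^'n) set" where F: "finite F" "max 1 (A powr (1 / (r - 1))) < (\<Sum>k\<in>F. japanese k powr (- ?n))"
        using lattice_sum_unbounded by blast
      define T where "T = (\<Sum>k\<in>F. japanese k powr (- ?n))"
      have T: "T > 1" "T > A powr (1 / (r - 1))" using F(2) unfolding T_def by auto
      have "T powr r \<le> A * (\<Sum>k\<in>F. japanese k powr ((\<sigma> - ?n) * r))" unfolding T_def using A(2) F(1) by blast
      also have "\<dots> \<le> A * T"
        unfolding T_def using A(1) exp japanese_ge_1 by (intro mult_left_mono sum_mono powr_mono) auto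
      finally have "T powr (r - 1) * T \<le> A * T" using T(1) by (simp add: powr_diff)
      then have "T powr (r - 1) \<le> A" using T(1) by simp
      moreover have "(A powr (1 / (r - 1))) powr (r - 1) < T powr (r - 1)" using T r1 by (intro powr_less_mono2) auto
      ultimately show False using A(1) r1 by (simp add: powr_powr)
    qed
  qed
qed

end

lemma B_index_infinity:
  "B_index n top q = max 0 (real n * (1 - enn2real (1 / q)))"
proof -
  have absorb: "max 0 (max x y) = max 0 x" if "y \<le> 0" for x y :: real using that by (auto simp: max_def)
  have le: "real n * (0 - enn2real (1 / q)) \<le> 0" by (simp add: mult_nonneg_nonneg)
  have "B_index n top q = Max {0, real n * (1 - enn2real (1 / q)), real n * (0 - enn2real (1 / q))}"
    unfolding B_index_def by simp
  also have "\<dots> = max 0 (max (real n * (1 - enn2real (1 / q))) (real n * (0 - enn2real (1 / q))))"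
    by (simp only: Max_insert finite.intros insert_not_empty not_False_eq_True Max_singleton)
  also have "\<dots> = max 0 (real n * (1 - enn2real (1 / q)))" by (rule absorb[OF le])
  finally show ?thesis .
qed

theorem theorem1p6:
  fixes \<eta> :: "int^'n::finite \<Rightarrow> real^'n \<Rightarrow> complex"
    and \<alpha> s :: real and p q :: ennreal
  assumes "0 \<le> \<alpha>" and "\<alpha> < 1" and "0 < p" and "0 < q"
    and "alpha_partition \<alpha> \<eta>"
  shows "embeds (modulation_space \<eta> \<alpha> s p q) (modulation_norm \<eta> \<alpha> s p q)
           Linfty (Lp_norm_distr top)
    \<longleftrightarrow>
      s \<ge> real CARD('n) * \<alpha> * enn2real (1 / p) + (1 - \<alpha>) * B_index CARD('n) top q \<and>
      (q > 1 \<longrightarrow>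
       s > real CARD('n) * \<alpha> * enn2real (1 / p) + (1 - \<alpha>) * B_index CARD('n) top q)"
proof -
  obtain C where "C > 0" "\<And>k. closure {\<xi>. \<eta> k \<xi> \<noteq> 0} \<subseteq>
        {\<xi>. norm (\<xi> - japanese k powr (\<alpha> / (1 - \<alpha>)) *\<^sub>R lattice_vec k) < C * japanese k powr (\<alpha> / (1 - \<alpha>))}"
    using assms(5) unfolding alpha_partition_def by auto
  then interpret alpha_decomposition \<alpha> \<eta> C
    using assms unfolding alpha_partition_def by unfold_locales auto
  let ?n = "real CARD('n)"
  let ?\<sigma> = "(s - ?n * \<alpha> * enn2real (1 / p)) / (1 - \<alpha>)"
  let ?B = "B_index CARD('n) top q"
  show ?thesis
  proof
    assume emb: "embeds (modulation_space \<eta> \<alpha> s p q) (modulation_norm \<eta> \<alpha> s p q) Linfty (Lp_norm_distr top)"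
    note nec = embedding_necessary[OF assms(3,4) emb]
    show "s \<ge> ?n * \<alpha> * enn2real (1 / p) + (1 - \<alpha>) * ?B \<and> (q > 1 \<longrightarrow> s > ?n * \<alpha> * enn2real (1 / p) + (1 - \<alpha>) * ?B)"
    proof (cases "q \<le> 1")
      case True
      have qt: "q \<noteq> top" using True by (auto simp: top_unique)
      have "enn2real q \<le> 1" using True enn2real_mono[OF True] by simp
      then have "1 \<le> enn2real (1 / q)"
        using enn2real_inverse[OF assms(4) qt] by (simp add: le_divide_eq)
      then have "?n * (1 - enn2real (1 / q)) \<le> 0" by (intro mult_nonneg_nonpos) auto
      then have "?B = 0" unfolding B_index_infinity by (rule max_absorb1)
      moreover have "?\<sigma> \<ge> 0" by (rule nec(1)[OF True])
      moreover have "\<not> q > 1" using True by (simp add: not_less)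
      ultimately show ?thesis using assms(2) by (simp add: zero_le_divide_iff)
    next
      case False
      then have q1: "q > 1" by simp
      have "1 \<ge> enn2real (1 / q)"
      proof (cases "q = top")
        case fin: False
        have "enn2real 1 \<le> enn2real q" using q1 fin by (intro enn2real_mono) (auto simp: less_top)
        then show ?thesis using enn2real_inverse[OF assms(4) fin] by (simp add: divide_le_eq)
      qed simp
      then have "0 \<le> ?n * (1 - enn2real (1 / q))" by (intro mult_nonneg_nonneg) auto
      then have "?B = ?n * (1 - enn2real (1 / q))" unfolding B_index_infinity by (rule max_absorb2)
      then have "?\<sigma> > ?B" using nec(2)[OF q1] by simp
      then have "s > ?n * \<alpha> * enn2real (1 / p) + (1 - \<alpha>) * ?B"
        using assms(2) by (simp add: less_divide_eq mult.commute)
      then show ?thesis by simp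
    qed
  next
    assume "s \<ge> ?n * \<alpha> * enn2real (1 / p) + (1 - \<alpha>) * ?B \<and> (q > 1 \<longrightarrow> s > ?n * \<alpha> * enn2real (1 / p) + (1 - \<alpha>) * ?B)"
    then show "embeds (modulation_space \<eta> \<alpha> s p q) (modulation_norm \<eta> \<alpha> s p q) Linfty (Lp_norm_distr top)"
      using assms by (intro embedding_sufficient) auto
  qed
qed

end
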